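(* Let $\Omega \subset \mathbb{R}^2$ be a bounded, convex domain with $C^1$ boundary. For $L \ge 0$ let $$E_\Omega(L) = \inf_{|\mathcal{L}| = L}\ \frac{1}{4}\int n_\ell(\mathcal{L})^2\, d\mu(\ell),$$ where the infimum is taken over all 1-rectifiable sets $\mathcal{L}$ contained in $\overline{\Omega}$ (counted with multiplicity) of total length $L$. Then for all $L\geq 0$ $$\frac{|\partial\Omega|}{2}\left\{\frac{2L}{|\partial\Omega|}\right\}\left(1 - \left\{\frac{2L}{|\partial\Omega|}\right\}\right) \leq E_\Omega(L) - \frac{2L^2}{|\partial\Omega|} \leq \frac{|\partial\Omega|}{4},$$ where $\{x\} = x - \lfloor x\rfloor$. The lower bound is sharp (i.e. holds with equality) if $n|\partial\Omega| \leq L \leq n|\partial\Omega| + \operatorname{diam}(\Omega)$ for some $n\in\mathbb{N} = \{0,1,2,\dots\}$: an extremal set (one attaining the infimum) is given by $n$ copies of $\partial\Omega$ and a line segment in $\overline{\Omega}$ of length $L - n|\partial\Omega|$.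
   Context: $|\cdot|$ denotes length (one-dimensional Hausdorff measure). $\mu$ is the kinematic measure on lines $\ell$ in $\mathbb{R}^2$: the rotation- and translation-invariant measure (uniform in the angle and uniform in the displacement from the origin, $d\phi\wedge dx$), normalized so that Crofton's formula reads $|\mathcal{L}| = \frac14\int n_\ell(\mathcal{L})\, d\mu(\ell)$; that is, $\mu$ is the push-forward of Lebesgue measure $d\phi\,dp$ on $[0,2\pi)\times\mathbb{R}$ under $(\phi,p)\mapsto\{x : \langle x,(\cos\phi,\sin\phi)\rangle = p\}$. $n_\ell(\mathcal{L})$ is the number of intersections of $\mathcal{L}$ with the line $\ell$. Sets are counted with multiplicity: an admissible $\mathcal{L}$ is a finite family $(\Gamma_1,\dots,\Gamma_N)$ of 1-rectifiable subsets of $\overline{\Omega}$ of finite length, possibly overlapping or repeated, with $|\mathcal{L}| = \sum_i|\Gamma_i|$ and $n_\ell(\mathcal{L}) = \sum_i \#(\ell\cap\Gamma_i)$. "$n$ copies of $\partial\Omega$" means that $\partial\Omega$ is repeated $n$ times in the family. A line segment of length $0$ is regarded as contributing nothing. *)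

theory Defs
  imports "HOL-Analysis.Analysis"
begin

definition hausdorff1_delta :: "real \<Rightarrow> 'a::metric_space set \<Rightarrow> ennreal" where
  "hausdorff1_delta \<delta> A =
     (INF U \<in> {U :: nat \<Rightarrow> 'a set. A \<subseteq> (\<Union>i. U i) \<and> (\<forall>i. bounded (U i) \<and> diameter (U i) \<le> \<delta>)}.
        (\<Sum>i. ennreal (diameter (U i))))"

text \<open>One-dimensional Hausdorff (outer) measure. In dimension one the normalizing constant is 1,
  so that segments get their usual length.\<close>

definition hausdorff1 :: "'a::metric_space set \<Rightarrow> ennreal" where
  "hausdorff1 A = (SUP \<delta> \<in> {0<..}. hausdorff1_delta \<delta> A)"

text \<open>Caratheodory measurability for \<^const>\<open>hausdorff1\<close> is part of the notion, as usual; without it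
  the intersection numbers need not be measurable functions of the line.\<close>

definition one_rectifiable :: "'a::metric_space set \<Rightarrow> bool" where
  "one_rectifiable A \<longleftrightarrow>
     A \<in> lambda_system UNIV UNIV hausdorff1 \<and>
     (\<exists>f :: nat \<Rightarrow> real \<Rightarrow> 'a. (\<forall>i. \<exists>C. C-lipschitz_on UNIV (f i)) \<and>
        hausdorff1 (A - (\<Union>i. range (f i))) = 0)"

text \<open>The domain lies locally, in suitable orthonormal coordinates, strictly above the graph of a
  \<open>C\<^sup>1\<close> function.\<close>

definition C1_boundary :: "(real^2) set \<Rightarrow> bool" where
  "C1_boundary \<Omega> \<longleftrightarrow>
     (\<forall>x \<in> frontier \<Omega>. \<exists>r e1 e2. \<exists>g :: real \<Rightarrow> real.
        r > 0 \<and> norm e1 = 1 \<and> norm e2 = 1 \<and> e1 \<bullet> e2 = 0 \<and>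
        g C1_differentiable_on UNIV \<and>
        \<Omega> \<inter> ball x r = {y \<in> ball x r. y \<bullet> e2 > g (y \<bullet> e1)})"

text \<open>The real-valued length of the boundary; the conversion loses nothing for the domains of
  interest, since a bounded convex set has a boundary of finite length.\<close>

definition perimeter :: "(real^2) set \<Rightarrow> real" where
  "perimeter \<Omega> = enn2real (hausdorff1 (frontier \<Omega>))"

definition line_of :: "real \<times> real \<Rightarrow> (real^2) set" where
  "line_of = (\<lambda>(\<phi>, p). {x. x \<bullet> vector [cos \<phi>, sin \<phi>] = p})"

abbreviation line_params :: "(real \<times> real) measure" where
  "line_params \<equiv> lebesgue_on ({0..<2*pi} \<times> UNIV)"

text \<open>The lines carry the largest sigma-algebra making \<^const>\<open>line_of\<close> measurable. Every line has two
  parameters, \<open>(\<phi>, p)\<close> and \<open>(\<phi> \<plusminus> pi, - p)\<close>, which is what the factor 1/4 in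
  Crofton's formula accounts for.\<close>

definition line_sets :: "(real^2) set set set" where
  "line_sets = {A. A \<subseteq> range line_of \<and> line_of -` A \<inter> space line_params \<in> sets line_params}"

definition kinematic_measure :: "(real^2) set measure" where
  "kinematic_measure = distr line_params (sigma (range line_of) line_sets) line_of"

lemma line_of_measurable:
  "line_of \<in> measurable line_params (sigma (range line_of) line_sets)"
  by (rule measurable_measure_of) (auto simp: line_sets_def)

lemma sigma_algebra_line_sets: "sigma_algebra (range line_of) line_sets"
  unfolding sigma_algebra_iff2
proof (intro conjI ballI allI impI)
  show "line_sets \<subseteq> Pow (range line_of)" "{} \<in> line_sets"
    by (auto simp: line_sets_def)
next
  fix A assume A: "A \<in> line_sets"
  have "line_of -` (range line_of - A) \<inter> space line_params
      = space line_params - (line_of -` A \<inter> space line_params)"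
    by auto
  with A show "range line_of - A \<in> line_sets"
    unfolding line_sets_def by (auto simp del: space_restrict_space)
next
  fix A :: "nat \<Rightarrow> (real^2) set set" assume A: "range A \<subseteq> line_sets"
  have "line_of -` (\<Union>i. A i) \<inter> space line_params
      = (\<Union>i. line_of -` A i \<inter> space line_params)"
    by auto
  also have "\<dots> \<in> sets line_params"
    using A by (intro sets.countable_UN) (auto simp: line_sets_def)
  finally show "(\<Union>i. A i) \<in> line_sets"
    using A unfolding line_sets_def by blast
qed

lemma emeasure_kinematic_measure:
  assumes "A \<in> line_sets"
  shows "emeasure kinematic_measure A = emeasure line_params (line_of -` A \<inter> space line_params)"
  unfolding kinematic_measure_def
  using assms line_of_measurable
  by (intro emeasure_distr)
     (auto simp: sigma_algebra.sets_measure_of_eq[OF sigma_algebra_line_sets])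

text \<open>A set with multiplicity is a list of sets. The counting measure makes infinite intersections
  contribute \<open>\<infinity>\<close>.\<close>

definition admissible :: "(real^2) set \<Rightarrow> (real^2) set list \<Rightarrow> bool" where
  "admissible \<Omega> \<Gamma>s \<longleftrightarrow>
     (\<forall>\<Gamma> \<in> set \<Gamma>s. \<Gamma> \<subseteq> closure \<Omega> \<and> one_rectifiable \<Gamma> \<and> hausdorff1 \<Gamma> < \<infinity>)"

definition total_length :: "(real^2) set list \<Rightarrow> ennreal" where
  "total_length \<Gamma>s = (\<Sum>\<Gamma>\<leftarrow>\<Gamma>s. hausdorff1 \<Gamma>)"

definition crossings :: "(real^2) set \<Rightarrow> (real^2) set list \<Rightarrow> ennreal" where
  "crossings l \<Gamma>s = (\<Sum>\<Gamma>\<leftarrow>\<Gamma>s. emeasure (count_space UNIV) (l \<inter> \<Gamma>))"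

definition energy :: "(real^2) set list \<Rightarrow> ennreal" where
  "energy \<Gamma>s = (\<integral>\<^sup>+ l. (crossings l \<Gamma>s)\<^sup>2 \<partial>kinematic_measure) / 4"

definition min_energy :: "(real^2) set \<Rightarrow> real \<Rightarrow> ennreal" where
  "min_energy \<Omega> L = (INF \<Gamma>s \<in> {\<Gamma>s. admissible \<Omega> \<Gamma>s \<and> total_length \<Gamma>s = ennreal L}. energy \<Gamma>s)"

definition extremal :: "(real^2) set \<Rightarrow> real \<Rightarrow> (real^2) set list \<Rightarrow> bool" where
  "extremal \<Omega> L \<Gamma>s \<longleftrightarrow>
     admissible \<Omega> \<Gamma>s \<and> total_length \<Gamma>s = ennreal L \<and> energy \<Gamma>s = min_energy \<Omega> L"

text \<open>The excess over the leading term, in the extended reals: no finiteness of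
  \<^const>\<open>min_energy\<close> is presupposed.\<close>

definition excess :: "(real^2) set \<Rightarrow> real \<Rightarrow> ereal" where
  "excess \<Omega> L = enn2ereal (min_energy \<Omega> L) - ereal (2 * L\<^sup>2 / perimeter \<Omega>)"

end

theory Submission
  imports Defs
begin

text \<open>
  Let \<open>P\<close> be the perimeter. The lines meeting the domain have measure \<open>2 P\<close>, and almost all of
  them cross the boundary twice. By Crofton's formula a family of length \<open>L\<close> is crossed
  \<open>2 L / P\<close> times on average by such a line. The crossing number \<open>c\<close> is an integer, so
  \<open>(c - k) (c - k - 1) \<ge> 0\<close> for every integer \<open>k\<close>; integrating this with
  \<open>k = \<lfloor>2 L / P\<rfloor>\<close> gives the lower bound, and equality holds when almost every
  line has crossing number \<open>k\<close> or \<open>k + 1\<close>, as for copies of the boundary and a segment.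

  For the upper bound, add to the copies of the boundary a subset of the boundary of the remaining
  length \<open>r\<close>, composed of many small arcs chosen so that the two crossings of a line with the
  boundary are hit as if independently, each with probability \<open>r / P\<close>. The variance
  of the crossing number is then about \<open>2 (r / P) (1 - r / P) \<le> 1 / 2\<close>.

  Only two cases of Crofton's formula are needed: the inequality \<open>\<ge>\<close> for rectifiable sets and
  equality for the boundary. For the former, the diameter of a small piece of a
  curve is at most a quarter of the measure of the lines hitting that piece, and no differentiability
  is required. For the latter, the boundary is compared with its inscribed polygons.
\<close>

section \<open>Hausdorff measure of dimension one\<close>

text \<open>Origin of the constants: on the lines meeting \<open>\<Omega>\<close>, of total measure
  \<open>2 * P\<close>, the energy is \<open>P / 2\<close> times the mean square of the crossing
  number, the mean being \<open>2 * L / P\<close>. Hence the energy minus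
  \<open>2 * L\<^sup>2 / P\<close> is \<open>P / 2\<close> times the variance. An integer variable
  of mean \<open>x\<close> has variance at least \<open>frac x * (1 - frac x)\<close>, which is the
  lower bound, while the variance \<open>2 * y * (1 - y)\<close> with \<open>y = r / P\<close> costs
  \<open>P * y * (1 - y)\<close>, which is at most \<open>P / 4\<close>.

  The obstacle is measurability. The crossing number of an admissible set is not known here to be a
  measurable function of the line, and the integral of such a function, a supremum over simple
  functions below it, is monotone but not additive. Lower estimates therefore count the crossings
  with smaller sets, for which the count is Borel. The sets constructed for upper estimates are
  images of countable unions of compact sets, which keeps everything Borel.\<close>

lemma hausdorff1_delta_le:
  assumes "A \<subseteq> (\<Union>i. U i)" "\<And>i::nat. bounded (U i)" "\<And>i. diameter (U i) \<le> \<delta>"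
  shows "hausdorff1_delta \<delta> A \<le> (\<Sum>i. ennreal (diameter (U i)))"
  unfolding hausdorff1_delta_def using assms by (intro INF_lower) auto

lemma hausdorff1_delta_le_finite:
  assumes "A \<subseteq> (\<Union>i<n. U i)" "\<And>i::nat. i < n \<Longrightarrow> bounded (U i)"
    "\<And>i. i < n \<Longrightarrow> diameter (U i) \<le> \<delta>" "0 \<le> \<delta>"
  shows "hausdorff1_delta \<delta> A \<le> (\<Sum>i<n. ennreal (diameter (U i)))"
proof -
  define V where "V i = (if i < n then U i else {})" for i
  have "hausdorff1_delta \<delta> A \<le> (\<Sum>i. ennreal (diameter (V i)))"
    using assms by (intro hausdorff1_delta_le) (auto simp: V_def split: if_splits)
  also have "\<dots> = (\<Sum>i<n. ennreal (diameter (V i)))"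
    by (intro suminf_finite) (auto simp: V_def)
  finally show ?thesis by (simp add: V_def)
qed

lemma hausdorff1_delta_approx:
  assumes "hausdorff1_delta \<delta> A < c"
  obtains U :: "nat \<Rightarrow> 'a::metric_space set" where "A \<subseteq> (\<Union>i. U i)" "\<And>i. bounded (U i)"
    "\<And>i. diameter (U i) \<le> \<delta>" "(\<Sum>i. ennreal (diameter (U i))) < c"
  using assms unfolding hausdorff1_delta_def INF_less_iff by blast

lemma hausdorff1_delta_mono: "A \<subseteq> B \<Longrightarrow> hausdorff1_delta \<delta> A \<le> hausdorff1_delta \<delta> B"
  unfolding hausdorff1_delta_def by (intro INF_superset_mono) auto

lemma hausdorff1_delta_le_hausdorff1: "0 < \<delta> \<Longrightarrow> hausdorff1_delta \<delta> A \<le> hausdorff1 A"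
  unfolding hausdorff1_def by (intro SUP_upper) auto

lemma hausdorff1_leI: "(\<And>\<delta>. 0 < \<delta> \<Longrightarrow> hausdorff1_delta \<delta> A \<le> c) \<Longrightarrow> hausdorff1 A \<le> c"
  unfolding hausdorff1_def by (intro SUP_least) auto

lemma hausdorff1_mono: "A \<subseteq> B \<Longrightarrow> hausdorff1 A \<le> hausdorff1 B"
  unfolding hausdorff1_def by (intro SUP_mono) (auto intro: hausdorff1_delta_mono)

lemma hausdorff1_empty [simp]: "hausdorff1 {} = 0"
proof -
  have "hausdorff1 ({} :: 'a set) \<le> 0"
  proof (rule hausdorff1_leI)
    fix \<delta> :: real assume "0 < \<delta>"
    then show "hausdorff1_delta \<delta> ({} :: 'a set) \<le> 0"
      using hausdorff1_delta_le_finite[of "{} :: 'a set" "\<lambda>_. {}" 0 \<delta>] by simp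
  qed
  then show ?thesis by simp
qed

lemma suminf_halves: "0 \<le> e \<Longrightarrow> (\<Sum>j. ennreal (e * (1/2)^Suc j)) = ennreal e"
  using sums_mult[OF power_half_series, of e] by (intro suminf_ennreal_eq) auto

text \<open>Each \<open>A j\<close> is covered with an excess of at most
  \<open>e / 2 ^ Suc j\<close>, and the double family of covering sets is enumerated by
  \<open>prod_decode\<close>.\<close>

lemma hausdorff1_delta_countable_Un:
  fixes A :: "nat \<Rightarrow> 'a::metric_space set"
  shows "hausdorff1_delta \<delta> (\<Union>j. A j) \<le> (\<Sum>j. hausdorff1_delta \<delta> (A j))"
proof (rule ennreal_le_epsilon)
  fix e :: real assume fin: "(\<Sum>j. hausdorff1_delta \<delta> (A j)) < top" and e: "0 < e"
  have "\<exists>U :: nat \<Rightarrow> 'a set. A j \<subseteq> (\<Union>i. U i) \<and> (\<forall>i. bounded (U i) \<and> diameter (U i) \<le> \<delta>) \<and>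
      (\<Sum>i. ennreal (diameter (U i))) \<le> hausdorff1_delta \<delta> (A j) + ennreal (e * (1/2)^Suc j)" for j
  proof -
    have "hausdorff1_delta \<delta> (A j) < top"
      using fin by (rule ennreal_suminf_lessD)
    then have "hausdorff1_delta \<delta> (A j) < hausdorff1_delta \<delta> (A j) + ennreal (e * (1/2)^Suc j)"
      using e by (cases "hausdorff1_delta \<delta> (A j)")
        (auto simp del: ennreal_plus power_Suc simp add: ennreal_plus[symmetric]
          intro!: ennreal_lessI add_nonneg_pos mult_pos_pos)
    then show ?thesis
      by (rule hausdorff1_delta_approx) (metis less_imp_le)
  qed
  then obtain U :: "nat \<Rightarrow> nat \<Rightarrow> 'a set" where U: "\<And>j. A j \<subseteq> (\<Union>i. U j i)"
      "\<And>j i. bounded (U j i)" "\<And>j i. diameter (U j i) \<le> \<delta>"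
      "\<And>j. (\<Sum>i. ennreal (diameter (U j i))) \<le> hausdorff1_delta \<delta> (A j) + ennreal (e * (1/2)^Suc j)"
    by metis
  define V where "V k = U (fst (prod_decode k)) (snd (prod_decode k))" for k
  have "(\<Union>j. A j) \<subseteq> (\<Union>k. V k)"
  proof clarify
    fix x j assume "x \<in> A j"
    then obtain i where "x \<in> U j i" using U(1) by blast
    then have "x \<in> V (prod_encode (j, i))" by (simp add: V_def)
    then show "x \<in> (\<Union>k. V k)" by blast
  qed
  then have "hausdorff1_delta \<delta> (\<Union>j. A j) \<le> (\<Sum>k. ennreal (diameter (V k)))"
    by (intro hausdorff1_delta_le) (auto simp: V_def U)
  also have "\<dots> = (\<Sum>j. \<Sum>i. ennreal (diameter (U j i)))"
    using suminf_ennreal_2dimen[of "\<lambda>j. \<Sum>i. ennreal (diameter (U j i))"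
        "\<lambda>(j, i). ennreal (diameter (U j i))"]
    by (simp add: V_def case_prod_beta)
  also have "\<dots> \<le> (\<Sum>j. hausdorff1_delta \<delta> (A j) + ennreal (e * (1/2)^Suc j))"
    by (intro suminf_le U(4)) auto
  also have "\<dots> = (\<Sum>j. hausdorff1_delta \<delta> (A j)) + (\<Sum>j. ennreal (e * (1/2)^Suc j))"
    by (rule suminf_add[symmetric]) auto
  also have "(\<Sum>j. ennreal (e * (1/2)^Suc j)) = ennreal e"
    using e by (intro suminf_halves) simp
  finally show "hausdorff1_delta \<delta> (\<Union>j. A j) \<le> (\<Sum>j. hausdorff1_delta \<delta> (A j)) + ennreal e" .
qed

lemma hausdorff1_countable_Un:
  fixes A :: "nat \<Rightarrow> 'a::metric_space set"
  shows "hausdorff1 (\<Union>j. A j) \<le> (\<Sum>j. hausdorff1 (A j))"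
proof (rule hausdorff1_leI)
  fix \<delta> :: real assume d: "0 < \<delta>"
  have "hausdorff1_delta \<delta> (\<Union>j. A j) \<le> (\<Sum>j. hausdorff1_delta \<delta> (A j))"
    by (rule hausdorff1_delta_countable_Un)
  also have "\<dots> \<le> (\<Sum>j. hausdorff1 (A j))"
    by (intro suminf_le hausdorff1_delta_le_hausdorff1 d) auto
  finally show "hausdorff1_delta \<delta> (\<Union>j. A j) \<le> (\<Sum>j. hausdorff1 (A j))" .
qed

lemma outer_measure_space_hausdorff1: "outer_measure_space UNIV hausdorff1"
  unfolding outer_measure_space_def positive_def increasing_def countably_subadditive_def
  using hausdorff1_mono hausdorff1_countable_Un by auto

lemma hausdorff1_Un: "hausdorff1 (A \<union> B) \<le> hausdorff1 A + hausdorff1 B"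
proof -
  have "hausdorff1 (\<Union>j::nat. if j = 0 then A else if j = 1 then B else {})
      \<le> (\<Sum>j::nat. hausdorff1 (if j = 0 then A else if j = 1 then B else {}))"
    by (rule hausdorff1_countable_Un)
  also have "\<dots> = (\<Sum>j<2::nat. hausdorff1 (if j = 0 then A else if j = 1 then B else {}))"
    by (rule suminf_finite) auto
  also have "\<dots> = hausdorff1 A + hausdorff1 B" by (simp add: numeral_2_eq_2)
  also have "(\<Union>j::nat. if j = 0 then A else if j = 1 then B else {}) = A \<union> B"
    by (auto split: if_splits)
  finally show ?thesis .
qed

lemma diameter_le_dist:
  fixes S :: "'a::metric_space set"
  assumes "0 \<le> d" "\<And>x y. x \<in> S \<Longrightarrow> y \<in> S \<Longrightarrow> dist x y \<le> d"
  shows "diameter S \<le> d"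
  using assms by (auto simp: diameter_def intro: cSUP_least)

lemma hausdorff1_lipschitz_image:
  fixes f :: "'a::metric_space \<Rightarrow> 'b::metric_space"
  assumes f: "C-lipschitz_on S f" and "0 < C"
  shows "hausdorff1 (f ` S) \<le> ennreal C * hausdorff1 S"
proof (rule hausdorff1_leI)
  fix \<delta> :: real assume d: "0 < \<delta>"
  have C: "0 \<le> C" using \<open>0 < C\<close> by simp
  define \<eta> where "\<eta> = \<delta> / (C + 1)"
  have \<eta>: "0 < \<eta>" "C * \<eta> \<le> \<delta>" using d C by (auto simp: \<eta>_def field_simps)
  have dist_le: "dist x y \<le> C * diameter U"
    if "bounded U" "x \<in> f ` (U \<inter> S)" "y \<in> f ` (U \<inter> S)" for x y U
  proof -
    from that obtain a b where ab: "a \<in> U" "a \<in> S" "x = f a" "b \<in> U" "b \<in> S" "y = f b" by auto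
    have "dist (f a) (f b) \<le> C * dist a b"
      using ab f lipschitz_onD by blast
    also have "\<dots> \<le> C * diameter U"
      using that ab C by (intro mult_left_mono diameter_bounded_bound) auto
    finally show "dist x y \<le> C * diameter U" using ab by simp
  qed
  then have diam: "diameter (f ` (U \<inter> S)) \<le> C * diameter U" if "bounded U" for U
    using that C diameter_ge_0[OF that] by (intro diameter_le_dist) auto
  \<comment> \<open>With the constant on the left, the bound obtained for every single cover passes
    to the infimum over covers.\<close>
  have "hausdorff1_delta \<delta> (f ` S) / ennreal C \<le> hausdorff1_delta \<eta> S"
    unfolding hausdorff1_delta_def[of \<eta>]
  proof (rule INF_greatest, clarify)
    fix U :: "nat \<Rightarrow> 'a set"
    assume U: "S \<subseteq> (\<Union>i. U i)" "\<forall>i. bounded (U i) \<and> diameter (U i) \<le> \<eta>"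
    have bd: "bounded (f ` (U i \<inter> S))" for i
      unfolding bounded_two_points
    proof (intro exI ballI)
      fix x y assume "x \<in> f ` (U i \<inter> S)" "y \<in> f ` (U i \<inter> S)"
      then show "dist x y \<le> C * diameter (U i)" using dist_le U(2) by blast
    qed
    have "hausdorff1_delta \<delta> (f ` S) \<le> (\<Sum>i. ennreal (diameter (f ` (U i \<inter> S))))"
    proof (rule hausdorff1_delta_le)
      show "diameter (f ` (U i \<inter> S)) \<le> \<delta>" for i
        using diam[of "U i"] U(2) \<eta>(2) C by (meson order_trans mult_left_mono)
      show "f ` S \<subseteq> (\<Union>i. f ` (U i \<inter> S))"
      proof
        fix y assume "y \<in> f ` S"
        then obtain x where x: "x \<in> S" "y = f x" by blast
        then obtain i where "x \<in> U i" using U(1) by blast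
        then show "y \<in> (\<Union>i. f ` (U i \<inter> S))" using x by blast
      qed
    qed (rule bd)
    also have "\<dots> \<le> (\<Sum>i. ennreal C * ennreal (diameter (U i)))"
      using U(2) diam C
      by (intro suminf_le) (auto simp: ennreal_mult'[symmetric] intro!: ennreal_leI)
    also have "\<dots> = ennreal C * (\<Sum>i. ennreal (diameter (U i)))"
      by simp
    finally show "hausdorff1_delta \<delta> (f ` S) / ennreal C \<le> (\<Sum>i. ennreal (diameter (U i)))"
      using \<open>0 < C\<close> by (intro divide_le_posI_ennreal) auto
  qed
  then have "hausdorff1_delta \<delta> (f ` S) \<le> ennreal C * hausdorff1_delta \<eta> S"
    using mult_left_mono[of "hausdorff1_delta \<delta> (f ` S) / ennreal C" _ "ennreal C"] \<open>0 < C\<close>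
    by (simp add: ennreal_times_divide mult.commute[of "ennreal C"] mult_divide_eq_ennreal)
  also have "\<dots> \<le> ennreal C * hausdorff1 S"
    by (intro mult_left_mono hausdorff1_delta_le_hausdorff1 \<eta>) auto
  finally show "hausdorff1_delta \<delta> (f ` S) \<le> ennreal C * hausdorff1 S" .
qed

lemma hausdorff1_singleton [simp]: "hausdorff1 {x} = 0"
proof -
  have "hausdorff1 {x} \<le> 0"
  proof (rule hausdorff1_leI)
    fix \<delta> :: real assume "0 < \<delta>"
    then show "hausdorff1_delta \<delta> {x} \<le> 0"
      using hausdorff1_delta_le_finite[of "{x}" "\<lambda>_. {x}" 1 \<delta>] by (auto simp: lessThan_Suc)
  qed
  then show ?thesis by simp
qed

lemma diameter_atLeastLessThan_le: "a \<le> b \<Longrightarrow> diameter {a..<b::real} \<le> b - a"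
  by (rule diameter_le_dist) (auto simp: dist_real_def)

lemma hausdorff1_unit_interval: "hausdorff1 {0..<1::real} \<le> 1"
proof (rule hausdorff1_leI)
  fix \<delta> :: real assume d: "0 < \<delta>"
  obtain n :: nat where n: "1 / \<delta> < n" "0 < n" using d
    by (metis reals_Archimedean2 of_nat_0_less_iff divide_pos_pos zero_less_one order_less_trans)
  define U where "U i = {real i / n ..< (real i + 1) / n}" for i
  have diam: "diameter (U i) \<le> 1 / n" for i
    using diameter_atLeastLessThan_le[of "real i / n" "(real i + 1) / n"] n
    by (simp add: U_def diff_divide_distrib[symmetric] divide_right_mono)
  have "hausdorff1_delta \<delta> {0..<1::real} \<le> (\<Sum>i<n. ennreal (diameter (U i)))"
  proof (rule hausdorff1_delta_le_finite)
    show "{0..<1} \<subseteq> (\<Union>i<n. U i)"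
    proof
      fix x :: real assume x: "x \<in> {0..<1}"
      then have "0 \<le> x * n" "x * n < n" using n by auto
      then have "real (nat \<lfloor>x * n\<rfloor>) \<le> x * n" "x * n < real (nat \<lfloor>x * n\<rfloor>) + 1" "nat \<lfloor>x * n\<rfloor> < n"
        by (auto simp: floor_less_iff nat_less_iff)
      then show "x \<in> (\<Union>i<n. U i)"
        using n by (auto simp: U_def field_simps intro!: bexI[of _ "nat \<lfloor>x * n\<rfloor>"])
    qed
    show "diameter (U i) \<le> \<delta>" for i
    proof -
      have "1 / n \<le> \<delta>" using n d by (simp add: field_simps)
      then show ?thesis using diam[of i] by linarith
    qed
  qed (use d in \<open>auto simp: U_def\<close>)
  also have "\<dots> \<le> (\<Sum>i<n. ennreal (1 / n))"
    by (intro sum_mono ennreal_leI diam)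
  also have "\<dots> = 1"
    using n by (simp add: ennreal_of_nat_eq_real_of_nat ennreal_mult[symmetric])
  finally show "hausdorff1_delta \<delta> {0..<1::real} \<le> 1" .
qed

text \<open>Up to its right endpoint, a null set, the interval is an affine image of
  \<open>{0..<1}\<close>, and the Lipschitz constant of that map is the length.\<close>

lemma hausdorff1_atLeastAtMost: "a \<le> b \<Longrightarrow> hausdorff1 {a..b::real} \<le> ennreal (b - a)"
proof (cases "a = b")
  case False
  assume "a \<le> b"
  with False have ab: "a < b" by simp
  have img: "{a..<b} = (\<lambda>t. a + (b - a) * t) ` {0..<1}"
  proof (intro subset_antisym subsetI)
    fix x assume "x \<in> {a..<b}"
    then show "x \<in> (\<lambda>t. a + (b - a) * t) ` {0..<1}"
      using ab by (intro image_eqI[of _ _ "(x - a) / (b - a)"]) (auto simp: field_simps)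
  next
    fix x assume "x \<in> (\<lambda>t. a + (b - a) * t) ` {0..<1}"
    then obtain t where t: "0 \<le> t" "t < 1" "x = a + (b - a) * t" by auto
    then have "0 \<le> (b - a) * t" "(b - a) * t < (b - a) * 1"
      using ab by (auto intro: mult_strict_left_mono simp del: mult_1_right)
    then show "x \<in> {a..<b}" using t by auto
  qed
  have lip: "(b - a)-lipschitz_on {0..<1} (\<lambda>t. a + (b - a) * t)"
    using ab by (intro lipschitz_onI) (auto simp: dist_real_def abs_mult right_diff_distrib[symmetric])
  have "hausdorff1 {a..b} \<le> hausdorff1 {a..<b} + hausdorff1 {b}"
    using hausdorff1_Un[of "{a..<b}" "{b}"] ab by (simp add: ivl_disj_un_singleton(6)[symmetric] less_imp_le del: hausdorff1_singleton insert_is_Un Un_insert_right)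
  also have "\<dots> \<le> ennreal (b - a) * hausdorff1 {0..<1::real}"
    using hausdorff1_lipschitz_image[OF lip] ab by (simp add: img)
  also have "\<dots> \<le> ennreal (b - a) * 1"
    by (intro mult_left_mono hausdorff1_unit_interval) auto
  finally show ?thesis by simp
qed simp

text \<open>Outer regularity of Lebesgue measure: countably many closed intervals with disjoint
  interiors cover \<open>S\<close> and exceed it by little in measure, and on intervals the bound is
  already known. It will make the image of a Lebesgue-small leftover set small.\<close>

lemma hausdorff1_le_measure:
  fixes S :: "real set"
  assumes S: "S \<in> lmeasurable" "S \<subseteq> {a..b}"
  shows "hausdorff1 S \<le> ennreal (measure lebesgue S)"
proof (rule ennreal_le_epsilon)
  fix e :: real assume e: "0 < e"
  have "S \<subseteq> cbox a b" using S by simp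
  from measurable_outer_intervals_bounded[OF S(1) this e]
  obtain D where D: "countable D"
       "\<And>K. K \<in> D \<Longrightarrow> K \<subseteq> cbox a b \<and> K \<noteq> {} \<and> (\<exists>c d. K = cbox c d)"
       "pairwise (\<lambda>A B. interior A \<inter> interior B = {}) D"
       "S \<subseteq> \<Union>D" "\<Union>D \<in> lmeasurable" "measure lebesgue (\<Union>D) \<le> measure lebesgue S + e"
    by metis
  have int: "K \<in> sets lebesgue" "hausdorff1 K \<le> emeasure lebesgue (interior K)" "interior K \<in> sets lebesgue"
    if "K \<in> D" for K
  proof -
    obtain c d where K: "K = {c..d}" "c \<le> d" using D(2)[OF \<open>K \<in> D\<close>] by (metis atLeastatMost_empty_iff cbox_interval)
    then show "K \<in> sets lebesgue" "interior K \<in> sets lebesgue" by auto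
    show "hausdorff1 K \<le> emeasure lebesgue (interior K)"
      using K hausdorff1_atLeastAtMost[of c d] by (simp add: interior_atLeastAtMost_real)
  qed
  have "hausdorff1 S \<le> ennreal (measure lebesgue (\<Union>D))"
  proof (cases "D = {}")
    case False
    define g where "g = from_nat_into D"
    \<comment> \<open>The enumeration of \<open>D\<close> may repeat intervals. Repetitions are
      replaced by the empty set, so that the interiors are disjoint and their measures add
      up.\<close>
    define V where "V n = (if \<exists>m<n. g m = g n then {} else g n)" for n
    have g: "range g = D" unfolding g_def using False D(1) by (rule range_from_nat_into)
    have VD: "V n = {} \<or> V n \<in> D" for n using g by (auto simp: V_def)
    have "S \<subseteq> (\<Union>n. V n)"
    proof
      fix x assume "x \<in> S"
      then obtain n where n: "x \<in> g n" using D(4) g by auto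
      define m where "m = (LEAST m. g m = g n)"
      have "g m = g n" unfolding m_def by (rule LeastI[of _ n]) simp
      moreover have "\<not> (\<exists>k<m. g k = g m)"
        using \<open>g m = g n\<close> not_less_Least unfolding m_def by fastforce
      ultimately have "x \<in> V m" using n by (simp add: V_def)
      then show "x \<in> (\<Union>n. V n)" by blast
    qed
    then have "hausdorff1 S \<le> (\<Sum>n. hausdorff1 (V n))"
      using hausdorff1_mono hausdorff1_countable_Un order_trans by blast
    also have "\<dots> \<le> (\<Sum>n. emeasure lebesgue (interior (V n)))"
    proof (intro suminf_le allI)
      show "hausdorff1 (V n) \<le> emeasure lebesgue (interior (V n))" for n
        using VD[of n] int(2)[of "V n"] by auto
    qed auto
    also have "\<dots> = emeasure lebesgue (\<Union>n. interior (V n))"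
    proof (rule suminf_emeasure)
      have "interior (V n) \<in> sets lebesgue" for n
        using VD[of n] int(3)[of "V n"] by auto
      then show "range (\<lambda>n. interior (V n)) \<subseteq> sets lebesgue" by auto
      have "interior (V m) \<inter> interior (V n) = {}" if "m < n" for m n
      proof (cases "V m = {} \<or> V n = {}")
        case False
        then have "V m = g m" "V n = g n" "g m \<noteq> g n"
          using that by (auto simp: V_def split: if_splits)
        moreover have "g m \<in> D" "g n \<in> D" using g by auto
        ultimately show ?thesis using pairwiseD[OF D(3)] by simp
      qed auto
      then show "disjoint_family (\<lambda>n. interior (V n))"
        unfolding disjoint_family_on_def by (metis Int_commute linorder_neqE_nat)
    qed
    also have "\<dots> \<le> emeasure lebesgue (\<Union>D)"
    proof (rule emeasure_mono)
      show "(\<Union>n. interior (V n)) \<subseteq> \<Union>D"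
        using VD interior_subset by blast
    qed (use D in auto)
    also have "\<dots> = ennreal (measure lebesgue (\<Union>D))"
      using D(5) by (simp add: emeasure_eq_measure2)
    finally show ?thesis .
  qed (use D in auto)
  also have "\<dots> \<le> ennreal (measure lebesgue S + e)"
    using D by (intro ennreal_leI)
  finally show "hausdorff1 S \<le> ennreal (measure lebesgue S) + ennreal e"
    using e by simp
qed

text \<open>A covering set of diameter \<open>d\<close> lies in a closed interval of length at most
  \<open>d\<close>, so that countable subadditivity of Lebesgue measure applies. Any mesh would do;
  1 is chosen.\<close>

lemma hausdorff1_ge_interval:
  fixes S :: "real set"
  assumes "{a<..<b} \<subseteq> S"
  shows "ennreal (b - a) \<le> hausdorff1 S"
proof -
  have "ennreal (b - a) \<le> hausdorff1_delta 1 S"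
    unfolding hausdorff1_delta_def
  proof (rule INF_greatest, clarify)
    fix U :: "nat \<Rightarrow> real set"
    assume U: "S \<subseteq> (\<Union>i. U i)" "\<forall>i. bounded (U i) \<and> diameter (U i) \<le> 1"
    have *: "\<exists>c d. U i \<subseteq> {c..d} \<and> c \<le> d \<and> d - c \<le> diameter (U i)" for i
    proof (cases "U i = {}")
      case True then show ?thesis by (auto intro!: exI[of _ 0])
    next
      case False
      have bd: "bdd_above (U i)" "bdd_below (U i)"
        using U(2) by (auto intro: bounded_imp_bdd_above bounded_imp_bdd_below)
      have "Sup (U i) \<le> x + diameter (U i)" if "x \<in> U i" for x
      proof (rule cSup_least[OF False])
        fix y assume "y \<in> U i"
        then show "y \<le> x + diameter (U i)"
          using diameter_bounded_bound[of "U i" x y] that U(2) by (auto simp: dist_real_def)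
      qed
      then have "Sup (U i) - diameter (U i) \<le> Inf (U i)"
        by (intro cInf_greatest[OF False]) (auto simp: algebra_simps)
      then show ?thesis
        using bd False by (intro exI[of _ "Inf (U i)"] exI[of _ "Sup (U i)"])
          (auto intro: cInf_lower cSup_upper cInf_le_cSup simp: algebra_simps)
    qed
    then obtain c d where cd: "\<And>i. U i \<subseteq> {c i..d i}" "\<And>i. c i \<le> d i" "\<And>i. d i - c i \<le> diameter (U i)"
      by metis
    have "ennreal (b - a) \<le> emeasure lborel {a<..<b}"
      by (cases "a \<le> b") (auto simp: ennreal_neg)
    also have "\<dots> \<le> emeasure lborel (\<Union>i. {c i..d i})"
    proof (rule emeasure_mono)
      show "{a<..<b} \<subseteq> (\<Union>i. {c i..d i})" using assms U(1) cd(1) by blast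
    qed auto
    also have "\<dots> \<le> (\<Sum>i. emeasure lborel {c i..d i})"
      by (intro emeasure_subadditive_countably) auto
    also have "\<dots> \<le> (\<Sum>i. ennreal (diameter (U i)))"
      using cd by (intro suminf_le) (auto intro!: ennreal_leI)
    finally show "ennreal (b - a) \<le> (\<Sum>i. ennreal (diameter (U i)))" .
  qed
  also have "\<dots> \<le> hausdorff1 S"
    by (rule hausdorff1_delta_le_hausdorff1) simp
  finally show ?thesis .
qed

section \<open>Borel sets are Caratheodory measurable\<close>

lemma hausdorff1_Un_separated:
  fixes A B :: "'a::metric_space set"
  assumes "0 < d" and sep: "\<And>x y. x \<in> A \<Longrightarrow> y \<in> B \<Longrightarrow> d \<le> dist x y"
  shows "hausdorff1 A + hausdorff1 B \<le> hausdorff1 (A \<union> B)"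
proof -
  have *: "hausdorff1_delta \<delta> A + hausdorff1_delta \<epsilon> B \<le> hausdorff1 (A \<union> B)"
    if "0 < \<delta>" "0 < \<epsilon>" for \<delta> \<epsilon>
  proof -
    \<comment> \<open>Below \<open>d\<close>, no covering set can meet both \<open>A\<close> and
      \<open>B\<close>, so that every cover of the union splits into a cover of \<open>A\<close> and
      one of \<open>B\<close>. The two meshes are kept apart because the suprema over them are taken
      one after the other.\<close>
    define \<eta> where "\<eta> = min (min \<delta> \<epsilon>) (d / 2)"
    have \<eta>: "0 < \<eta>" "\<eta> \<le> \<delta>" "\<eta> \<le> \<epsilon>" "\<eta> < d" using that assms(1) by (auto simp: \<eta>_def)
    have "hausdorff1_delta \<delta> A + hausdorff1_delta \<epsilon> B \<le> hausdorff1_delta \<eta> (A \<union> B)"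
      unfolding hausdorff1_delta_def[of \<eta>]
    proof (rule INF_greatest, clarify)
      fix U :: "nat \<Rightarrow> 'a set"
      assume U: "A \<union> B \<subseteq> (\<Union>i. U i)" "\<forall>i. bounded (U i) \<and> diameter (U i) \<le> \<eta>"
      define V where "V i = (if U i \<inter> A \<noteq> {} then U i else {})" for i
      define W where "W i = (if U i \<inter> A = {} then U i else {})" for i
      have "hausdorff1_delta \<delta> A \<le> (\<Sum>i. ennreal (diameter (V i)))"
      proof (rule hausdorff1_delta_le)
        show "A \<subseteq> (\<Union>i. V i)" using U(1) by (fastforce simp: V_def)
      qed (use U(2) \<eta> in \<open>auto simp: V_def intro: order_trans\<close>)
      moreover have "hausdorff1_delta \<epsilon> B \<le> (\<Sum>i. ennreal (diameter (W i)))"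
      proof (rule hausdorff1_delta_le)
        show "B \<subseteq> (\<Union>i. W i)"
        proof
          fix y assume y: "y \<in> B"
          then obtain i where i: "y \<in> U i" using U(1) by blast
          have "U i \<inter> A = {}"
          proof (rule ccontr)
            assume "U i \<inter> A \<noteq> {}"
            then obtain x where x: "x \<in> U i" "x \<in> A" by blast
            have "d \<le> dist x y" by (rule sep[OF x(2) y])
            also have "\<dots> \<le> diameter (U i)" using x i U(2) by (intro diameter_bounded_bound) auto
            also have "\<dots> \<le> \<eta>" using U(2) by blast
            finally show False using \<eta> by simp
          qed
          then show "y \<in> (\<Union>i. W i)" using i by (auto simp: W_def)
        qed
      qed (use U(2) \<eta> in \<open>auto simp: W_def intro: order_trans\<close>)
      moreover have "(\<Sum>i. ennreal (diameter (V i))) + (\<Sum>i. ennreal (diameter (W i)))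
          = (\<Sum>i. ennreal (diameter (U i)))"
        by (subst suminf_add) (auto intro!: suminf_cong simp: V_def W_def)
      ultimately show "hausdorff1_delta \<delta> A + hausdorff1_delta \<epsilon> B \<le> (\<Sum>i. ennreal (diameter (U i)))"
        using add_mono by metis
    qed
    also have "\<dots> \<le> hausdorff1 (A \<union> B)"
      by (rule hausdorff1_delta_le_hausdorff1) fact
    finally show ?thesis .
  qed
  have "hausdorff1_delta \<delta> A + hausdorff1 B \<le> hausdorff1 (A \<union> B)" if "0 < \<delta>" for \<delta>
  proof -
    have "hausdorff1_delta \<delta> A + hausdorff1 B = (SUP \<epsilon>\<in>{0<..}. hausdorff1_delta \<delta> A + hausdorff1_delta \<epsilon> B)"
      unfolding hausdorff1_def[of B] by (subst ennreal_SUP_add_right) auto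
    also have "\<dots> \<le> hausdorff1 (A \<union> B)" using *[OF that] by (intro SUP_least) auto
    finally show ?thesis .
  qed
  then have "(SUP \<delta>\<in>{0<..}. hausdorff1_delta \<delta> A + hausdorff1 B) \<le> hausdorff1 (A \<union> B)"
    by (intro SUP_least) auto
  then show ?thesis
    unfolding hausdorff1_def[of A] by (subst ennreal_SUP_add_left[symmetric]) auto
qed

text \<open>The gap may depend on the smaller index, as it does for annuli shrinking towards a
  closed set; among finitely many gaps there is still a smallest one.\<close>

lemma hausdorff1_finite_separated:
  fixes R :: "nat \<Rightarrow> 'a::metric_space set"
  assumes "\<And>j. 0 < d j" "\<And>i j x y. i < j \<Longrightarrow> x \<in> R i \<Longrightarrow> y \<in> R j \<Longrightarrow> d i \<le> dist x y"
  shows "(\<Sum>j<n. hausdorff1 (R j)) \<le> hausdorff1 (\<Union>j<n. R j)"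
proof (induction n)
  case (Suc n)
  define e where "e = Min (insert 1 (d ` {..<n}))"
  have e: "0 < e" "\<And>i. i < n \<Longrightarrow> e \<le> d i"
    using assms(1) by (auto simp: e_def)
  have "(\<Sum>j<Suc n. hausdorff1 (R j)) \<le> hausdorff1 (\<Union>j<n. R j) + hausdorff1 (R n)"
    using Suc by (auto intro: add_right_mono)
  also have "\<dots> \<le> hausdorff1 ((\<Union>j<n. R j) \<union> R n)"
    by (rule hausdorff1_Un_separated[OF e(1)]) (use e(2) assms(2) order_trans in blast)
  also have "(\<Union>j<n. R j) \<union> R n = (\<Union>j<Suc n. R j)" by (auto simp: less_Suc_eq)
  finally show ?case .
qed simp

text \<open>Caratheodory's criterion: the annuli of every other index around \<open>F\<close> are separated, so that
  their measures form a convergent series.\<close>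

lemma closed_in_lambda_system_hausdorff1:
  fixes F :: "'a::metric_space set"
  assumes F: "closed F" "F \<noteq> {}"
  shows "hausdorff1 (X \<inter> F) + hausdorff1 (X - F) \<le> hausdorff1 X"
proof (cases "hausdorff1 X = top")
  case False
  define a :: "nat \<Rightarrow> real" where "a j = 1 / (real j + 1)" for j
  have a: "0 < a j" "a (Suc j) < a j" for j by (auto simp: a_def field_simps)
  have amono: "a j \<le> a i" if "i \<le> j" for i j using that by (auto simp: a_def field_simps)
  define R where "R j = {x \<in> X. a (Suc j) \<le> infdist x F \<and> infdist x F < a j}" for j
  define Y where "Y k = {x \<in> X. a k \<le> infdist x F}" for k
  have sep: "c - e \<le> dist x y" if "c \<le> infdist x F" "infdist y F < e" for x y c e
    using infdist_triangle[of x F y] that by simp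
  \<comment> \<open>The offset \<open>m\<close> selects the annuli of even or of odd index; between
    two annuli of the same parity lies a whole annulus, whose width is the gap.\<close>
  have le: "(\<Sum>j<n. hausdorff1 (R (2 * j + m))) \<le> hausdorff1 X" for n m
  proof -
    have "(\<Sum>j<n. hausdorff1 (R (2 * j + m))) \<le> hausdorff1 (\<Union>j<n. R (2 * j + m))"
    proof (rule hausdorff1_finite_separated)
      show "0 < a (Suc (2 * j + m)) - a (Suc (Suc (2 * j + m)))" for j using a by simp
      fix i j x y assume *: "i < j" "x \<in> R (2 * i + m)" "y \<in> R (2 * j + m)"
      have "infdist y F < a (2 * j + m)" using * by (simp add: R_def)
      also have "\<dots> \<le> a (Suc (Suc (2 * i + m)))" using *(1) by (intro amono) simp
      finally show "a (Suc (2 * i + m)) - a (Suc (Suc (2 * i + m))) \<le> dist x y"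
        using * by (intro sep) (auto simp: R_def)
    qed
    also have "\<dots> \<le> hausdorff1 X" by (intro hausdorff1_mono) (auto simp: R_def)
    finally show ?thesis .
  qed
  have "(\<Sum>j. hausdorff1 (R j)) \<noteq> top"
  proof -
    have "(\<Sum>j<n. hausdorff1 (R j)) \<le> 2 * hausdorff1 X" for n
    proof -
      have "(\<Sum>j<n. hausdorff1 (R j)) \<le> (\<Sum>j<2 * n. hausdorff1 (R j))"
        by (intro sum_mono2) auto
      also have "\<dots> = (\<Sum>j<n. hausdorff1 (R (2 * j + 0))) + (\<Sum>j<n. hausdorff1 (R (2 * j + 1)))"
        by (induction n) (auto simp: ac_simps)
      also have "\<dots> \<le> hausdorff1 X + hausdorff1 X" by (intro add_mono le)
      finally show ?thesis by (simp add: mult_2)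
    qed
    then have "(\<Sum>j. hausdorff1 (R j)) \<le> 2 * hausdorff1 X"
      by (intro suminf_le_const) auto
    then show ?thesis using False by (auto simp: ennreal_mult_eq_top_iff top_unique)
  qed
  \<comment> \<open>The tails bound the measure of the part of \<open>X\<close> that lies outside
    \<open>F\<close> but closer to it than \<open>a k\<close>.\<close>
  then have tail: "(\<lambda>k. \<Sum>j. hausdorff1 (R (j + k))) \<longlonglongrightarrow> 0"
  proof -
    assume fin: "(\<Sum>j. hausdorff1 (R j)) \<noteq> top"
    define r where "r j = enn2real (hausdorff1 (R j))" for j
    have r: "hausdorff1 (R j) = ennreal (r j)" "0 \<le> r j" for j
      using fin ennreal_suminf_lessD[of "\<lambda>j. hausdorff1 (R j)" top j]
      by (auto simp: r_def top.not_eq_extremum)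
    then have sm: "summable r"
      using fin summable_suminf_not_top[of r] by simp
    have "(\<Sum>j. hausdorff1 (R (j + k))) = ennreal (\<Sum>j. r (j + k))" for k
      using sm r by (simp add: suminf_ennreal2 summable_ignore_initial_segment)
    moreover have "(\<lambda>k. ennreal (\<Sum>j. r (j + k))) \<longlonglongrightarrow> ennreal 0"
      by (intro tendsto_ennrealI suminf_exist_split2 sm)
    ultimately show ?thesis by simp
  qed
  have main: "hausdorff1 (X \<inter> F) + hausdorff1 (X - F) \<le> hausdorff1 X + (\<Sum>j. hausdorff1 (R (j + k)))" for k
  proof -
    have "X - F \<subseteq> Y k \<union> (\<Union>j. R (j + k))"
    proof
      fix x assume x: "x \<in> X - F"
      then have pos: "0 < infdist x F" using F by (metis DiffD2 in_closed_iff_infdist_zero infdist_nonneg less_eq_real_def)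
      show "x \<in> Y k \<union> (\<Union>j. R (j + k))"
      proof (cases "a k \<le> infdist x F")
        case False
        obtain n :: nat where "1 / infdist x F < n" using reals_Archimedean2 by blast
        then have n: "a n \<le> infdist x F" using pos by (auto simp: a_def field_simps)
        \<comment> \<open>With the least such index, \<open>x\<close> lies in the annulus of index
          \<open>i - 1\<close>; this index is at least \<open>k\<close> because
          \<open>infdist x F < a k\<close>.\<close>
        define i where "i = (LEAST i. a i \<le> infdist x F)"
        have i: "a i \<le> infdist x F" unfolding i_def by (rule LeastI[of _ n], rule n)
        have "k < i" using False i amono[of i k] by (meson linorder_not_less order_trans)
        moreover have "\<not> a (i - 1) \<le> infdist x F"
          using \<open>k < i\<close> unfolding i_def by (intro not_less_Least) simp
        ultimately have "x \<in> R (i - 1)" using i x by (simp add: R_def)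
        moreover have "i - 1 = (i - 1 - k) + k" using \<open>k < i\<close> by simp
        ultimately show ?thesis by (metis UN_I UNIV_I UnI2)
      qed (use x in \<open>auto simp: Y_def\<close>)
    qed
    then have "hausdorff1 (X - F) \<le> hausdorff1 (Y k) + hausdorff1 (\<Union>j. R (j + k))"
      using hausdorff1_mono hausdorff1_Un order_trans by blast
    also have "\<dots> \<le> hausdorff1 (Y k) + (\<Sum>j. hausdorff1 (R (j + k)))"
      by (intro add_left_mono hausdorff1_countable_Un)
    finally have "hausdorff1 (X \<inter> F) + hausdorff1 (X - F)
        \<le> (hausdorff1 (X \<inter> F) + hausdorff1 (Y k)) + (\<Sum>j. hausdorff1 (R (j + k)))"
      by (simp add: add.assoc add_left_mono)
    also have "hausdorff1 (X \<inter> F) + hausdorff1 (Y k) \<le> hausdorff1 ((X \<inter> F) \<union> Y k)"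
    proof (rule hausdorff1_Un_separated)
      show "0 < a k" by (rule a)
      fix x y assume "x \<in> X \<inter> F" "y \<in> Y k"
      then show "a k \<le> dist x y"
        using infdist_le[of x F y] by (simp add: Y_def dist_commute)
    qed
    also have "\<dots> \<le> hausdorff1 X" by (intro hausdorff1_mono) (auto simp: Y_def)
    finally show ?thesis by (simp add: add_right_mono)
  qed
  show ?thesis
  proof (rule LIMSEQ_le_const)
    show "(\<lambda>k. hausdorff1 X + (\<Sum>j. hausdorff1 (R (j + k)))) \<longlonglongrightarrow> hausdorff1 X"
      using tendsto_add[OF tendsto_const tail, of "hausdorff1 X"] by simp
  qed (use main in blast)
qed simp

lemma lambda_system_hausdorff1_iff:
  "A \<in> lambda_system UNIV UNIV hausdorff1 \<longleftrightarrow>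
    (\<forall>X. hausdorff1 (X \<inter> A) + hausdorff1 (X - A) = hausdorff1 X)"
proof -
  have "(UNIV - A) \<inter> X = X - A" for X by blast
  then show ?thesis by (auto simp: lambda_system_def Int_commute[of A])
qed

lemma measure_space_hausdorff1:
  "measure_space UNIV (lambda_system UNIV UNIV hausdorff1) hausdorff1"
proof -
  interpret sigma_algebra UNIV "UNIV :: 'a set set"
    using sigma_algebra_Pow[of "UNIV :: 'a set"] by simp
  show ?thesis by (rule caratheodory_lemma[OF outer_measure_space_hausdorff1])
qed

lemma sigma_algebra_lambda_system_hausdorff1:
  "sigma_algebra UNIV (lambda_system UNIV UNIV (hausdorff1 :: 'a::metric_space set \<Rightarrow> _))"
  using measure_space_hausdorff1[where 'a='a] by (simp add: measure_space_def)

lemma borel_in_lambda_system_hausdorff1: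
  fixes A :: "'a::metric_space set"
  assumes "A \<in> sets borel"
  shows "A \<in> lambda_system UNIV UNIV hausdorff1"
proof -
  interpret sigma_algebra "UNIV :: 'a set" "lambda_system UNIV UNIV hausdorff1"
    by (rule sigma_algebra_lambda_system_hausdorff1)
  have "F \<in> lambda_system UNIV UNIV hausdorff1" if "closed F" for F :: "'a set"
  proof (cases "F = {}")
    case False
    have "hausdorff1 (X \<inter> F) + hausdorff1 (X - F) = hausdorff1 X" for X
      using closed_in_lambda_system_hausdorff1[OF that False, of X]
        hausdorff1_Un[of "X \<inter> F" "X - F"] by (simp add: Int_Diff_Un)
    then show ?thesis by (simp add: lambda_system_hausdorff1_iff)
  qed simp
  then have "sigma_sets UNIV (Collect closed) \<subseteq> lambda_system UNIV UNIV (hausdorff1 :: 'a set \<Rightarrow> _)"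
    by (intro sigma_sets_subset) auto
  with assms show ?thesis by (auto simp: borel_eq_closed)
qed

lemma hausdorff1_sum:
  fixes A :: "nat \<Rightarrow> 'a::metric_space set"
  assumes "\<And>i. i < n \<Longrightarrow> A i \<in> sets borel" "disjoint_family_on A {..<n}"
  shows "(\<Sum>i<n. hausdorff1 (A i)) = hausdorff1 (\<Union>i<n. A i)"
  using assms
proof (induction n)
  case (Suc n)
  have "A n \<in> lambda_system UNIV UNIV hausdorff1"
    using Suc by (intro borel_in_lambda_system_hausdorff1) auto
  moreover have "A i \<inter> A n = {}" if "i < n" for i
    using Suc(3) that unfolding disjoint_family_on_def by (metis lessThan_iff less_Suc_eq nat_neq_iff)
  then have "(\<Union>i<Suc n. A i) \<inter> A n = A n" "(\<Union>i<Suc n. A i) - A n = (\<Union>i<n. A i)"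
    by (auto simp: less_Suc_eq)
  ultimately have "hausdorff1 (A n) + hausdorff1 (\<Union>i<n. A i) = hausdorff1 (\<Union>i<Suc n. A i)"
    unfolding lambda_system_hausdorff1_iff by metis
  moreover have "(\<Sum>i<n. hausdorff1 (A i)) = hausdorff1 (\<Union>i<n. A i)"
    using Suc.prems by (intro Suc.IH) (auto intro: disjoint_family_on_mono[rotated])
  ultimately show ?case by (simp add: add.commute)
qed simp

section \<open>Borel hulls and kernels\<close>

lemma diameter_closure_metric: "bounded (U :: 'a::metric_space set) \<Longrightarrow> diameter (closure U) \<le> diameter U"
proof (rule diameter_le_dist)
  assume bd: "bounded U"
  then show "0 \<le> diameter U" by (rule diameter_ge_0)
  fix x y assume xy: "x \<in> closure U" "y \<in> closure U"
  have "dist x b \<le> diameter U" if "b \<in> U" for b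
    by (rule continuous_le_on_closure[OF _ xy(1), of "\<lambda>x. dist x b"])
       (use bd that in \<open>auto intro!: continuous_intros diameter_bounded_bound\<close>)
  then show "dist x y \<le> diameter U"
    by (intro continuous_le_on_closure[OF _ xy(2), of "\<lambda>y. dist x y"]) (auto intro!: continuous_intros)
qed

text \<open>Taking closures does not increase the diameters of the sets in a cover. Intersecting
  near-optimal covers by closed sets over all meshes gives a Borel set that each of these covers
  still covers.\<close>

lemma hausdorff1_borel_hull:
  fixes A :: "'a::metric_space set"
  assumes fin: "hausdorff1 A < top"
  obtains G where "G \<in> sets borel" "A \<subseteq> G" "hausdorff1 G = hausdorff1 A"
proof -
  define \<delta> where "\<delta> k = 1 / (real k + 1)" for k :: nat
  have \<delta>: "0 < \<delta> k" for k by (simp add: \<delta>_def)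
  have "\<exists>U :: nat \<Rightarrow> 'a set. A \<subseteq> (\<Union>i. U i) \<and> (\<forall>i. bounded (U i) \<and> diameter (U i) \<le> \<delta> k) \<and>
      (\<Sum>i. ennreal (diameter (U i))) \<le> hausdorff1 A + ennreal (\<delta> k)" for k
  proof -
    have "hausdorff1_delta (\<delta> k) A \<le> hausdorff1 A"
      by (intro hausdorff1_delta_le_hausdorff1 \<delta>)
    also have "\<dots> < hausdorff1 A + ennreal (\<delta> k)"
      using fin \<delta>[of k] by (cases "hausdorff1 A") (auto simp del: ennreal_plus simp add: ennreal_plus[symmetric] ennreal_less_iff)
    finally show ?thesis
      by (rule hausdorff1_delta_approx) (metis less_imp_le)
  qed
  then obtain U :: "nat \<Rightarrow> nat \<Rightarrow> 'a set" where U: "\<And>k. A \<subseteq> (\<Union>i. U k i)"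
      "\<And>k i. bounded (U k i)" "\<And>k i. diameter (U k i) \<le> \<delta> k"
      "\<And>k. (\<Sum>i. ennreal (diameter (U k i))) \<le> hausdorff1 A + ennreal (\<delta> k)"
    by metis
  define G where "G = (\<Inter>k. \<Union>i. closure (U k i))"
  show thesis
  proof
    show "G \<in> sets borel" unfolding G_def by (intro sets.countable_INT sets.countable_UN) auto
    show "A \<subseteq> G" unfolding G_def using U(1) closure_subset by blast
    then have "hausdorff1 A \<le> hausdorff1 G" by (rule hausdorff1_mono)
    moreover have "hausdorff1 G \<le> hausdorff1 A"
    proof (rule hausdorff1_leI)
      fix d :: real assume d: "0 < d"
      have le: "hausdorff1_delta d G \<le> hausdorff1 A + ennreal (\<delta> k)" if "\<delta> k \<le> d" for k
      proof -
        have dc: "diameter (closure (U k i)) \<le> diameter (U k i)" for i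
          by (rule diameter_closure_metric[OF U(2)])
        have "hausdorff1_delta d G \<le> (\<Sum>i. ennreal (diameter (closure (U k i))))"
        proof (rule hausdorff1_delta_le)
          show "G \<subseteq> (\<Union>i. closure (U k i))" unfolding G_def by blast
          show "bounded (closure (U k i))" for i by (rule bounded_closure[OF U(2)])
          show "diameter (closure (U k i)) \<le> d" for i
            using dc U(3) that order_trans by meson
        qed
        also have "\<dots> \<le> (\<Sum>i. ennreal (diameter (U k i)))"
          by (intro suminf_le ennreal_leI dc) auto
        also note U(4)
        finally show ?thesis .
      qed
      have lim: "\<delta> \<longlonglongrightarrow> 0"
        unfolding \<delta>_def using LIMSEQ_inverse_real_of_nat by (simp add: inverse_eq_divide add.commute)
      show "hausdorff1_delta d G \<le> hausdorff1 A"
      proof (rule tendsto_lowerbound)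
        show "(\<lambda>k. hausdorff1 A + ennreal (\<delta> k)) \<longlonglongrightarrow> hausdorff1 A"
          using tendsto_add[OF tendsto_const tendsto_ennrealI[OF lim], of "hausdorff1 A"] by simp
        show "\<forall>\<^sub>F k in sequentially. hausdorff1_delta d G \<le> hausdorff1 A + ennreal (\<delta> k)"
          using order_tendstoD(2)[OF lim d] by eventually_elim (auto intro: le)
      qed simp
    qed
    ultimately show "hausdorff1 G = hausdorff1 A" by (rule antisym[rotated])
  qed
qed

text \<open>For a hull \<open>G\<close> of \<open>A\<close>, measurability and finiteness make
  \<open>G - A\<close> a null set. Removing a Borel null hull of \<open>G - A\<close> from
  \<open>G\<close> leaves a Borel subset of \<open>A\<close>.\<close>

lemma hausdorff1_borel_kernel:
  fixes A :: "'a::metric_space set"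
  assumes A: "A \<in> lambda_system UNIV UNIV hausdorff1" and fin: "hausdorff1 A < top"
  obtains B where "B \<in> sets borel" "B \<subseteq> A" "hausdorff1 (A - B) = 0"
proof -
  obtain G where G: "G \<in> sets borel" "A \<subseteq> G" "hausdorff1 G = hausdorff1 A"
    using hausdorff1_borel_hull[OF fin] .
  have "hausdorff1 (G \<inter> A) + hausdorff1 (G - A) = hausdorff1 G"
    using A by (simp add: lambda_system_hausdorff1_iff)
  moreover have "G \<inter> A = A" using G by blast
  ultimately have "hausdorff1 A + hausdorff1 (G - A) = hausdorff1 A + 0" using G by simp
  then have 0: "hausdorff1 (G - A) = 0"
    using fin by (simp only: ennreal_add_left_cancel) auto
  then obtain N where N: "N \<in> sets borel" "G - A \<subseteq> N" "hausdorff1 N = 0"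
    using hausdorff1_borel_hull[of "G - A"] by auto
  show thesis
  proof
    show "G - N \<in> sets borel" using G N by auto
    show "G - N \<subseteq> A" using N by blast
    have "hausdorff1 (A - (G - N)) \<le> hausdorff1 N" using G by (intro hausdorff1_mono) blast
    then show "hausdorff1 (A - (G - N)) = 0" using N by simp
  qed
qed

section \<open>Integration over lines\<close>

definition dir :: "real \<Rightarrow> real^2" where
  "dir \<phi> = vector [cos \<phi>, sin \<phi>]"

lemma inner_dir: "x \<bullet> dir \<phi> = x $ 1 * cos \<phi> + x $ 2 * sin \<phi>"
  by (simp add: dir_def inner_vec_def sum_2)

lemma continuous_on_dir [continuous_intros]:
  fixes f :: "'a::t2_space \<Rightarrow> real"
  assumes "continuous_on S f"
  shows "continuous_on S (\<lambda>x. dir (f x))"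
proof -
  have eq: "(\<lambda>x. dir (f x)) = (\<lambda>x. \<chi> i. if i = 1 then cos (f x) else sin (f x))"
    by (auto simp: fun_eq_iff vec_eq_iff dir_def forall_2)
  show ?thesis unfolding eq
  proof (rule continuous_on_vec_lambda)
    fix i :: 2
    show "continuous_on S (\<lambda>x. if i = 1 then cos (f x) else sin (f x))"
      using continuous_on_cos[OF assms] continuous_on_sin[OF assms] by (cases "i = 1") simp_all
  qed
qed

lemma norm_dir [simp]: "norm (dir \<phi>) = 1"
  by (simp add: norm_eq_sqrt_inner inner_dir) (simp add: dir_def power2_eq_square[symmetric])

lemma mem_line_of: "x \<in> line_of \<omega> \<longleftrightarrow> x \<bullet> dir (fst \<omega>) = snd \<omega>"
  by (cases \<omega>) (simp add: line_of_def dir_def)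

lemma borel_measurable_line_params [measurable (raw)]:
  assumes "h \<in> borel_measurable borel"
  shows "h \<in> borel_measurable line_params"
  using assms by (intro measurable_restrict_space1 measurable_completion) simp

text \<open>For a Borel integrand the completed measure may be replaced by the product of Borel
  measures, to which Tonelli's theorem applies.\<close>

lemma nn_integral_line_params:
  fixes h :: "real \<times> real \<Rightarrow> ennreal"
  assumes [measurable]: "h \<in> borel_measurable borel"
  shows "(\<integral>\<^sup>+\<omega>. h \<omega> \<partial>line_params) =
    (\<integral>\<^sup>+\<phi>. (\<integral>\<^sup>+p. h (\<phi>, p) \<partial>lborel) * indicator {0..<2*pi} \<phi> \<partial>lborel)"
proof -
  have S: "{0..<2*pi} \<times> (UNIV :: real set) \<in> sets borel"
    by (rule borel_Times) auto
  have [measurable]: "h \<in> borel_measurable (borel \<Otimes>\<^sub>M borel)"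
    using assms by (simp add: borel_prod)
  have "(\<integral>\<^sup>+\<omega>. h \<omega> \<partial>line_params) =
      (\<integral>\<^sup>+\<omega>. h \<omega> * indicator ({0..<2*pi} \<times> UNIV) \<omega> \<partial>lebesgue)"
    using S by (intro nn_integral_restrict_space) auto
  also have "\<dots> = (\<integral>\<^sup>+\<omega>. h \<omega> * indicator ({0..<2*pi} \<times> UNIV) \<omega> \<partial>lborel)"
    by (rule nn_integral_completion)
  also have "\<dots> = (\<integral>\<^sup>+\<omega>. h \<omega> * indicator ({0..<2*pi} \<times> UNIV) \<omega> \<partial>(lborel \<Otimes>\<^sub>M lborel))"
    by (simp add: lborel_prod)
  also have "\<dots> = (\<integral>\<^sup>+\<phi>. \<integral>\<^sup>+p. h (\<phi>, p) * indicator ({0..<2*pi} \<times> UNIV) (\<phi>, p) \<partial>lborel \<partial>lborel)"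
    by (rule lborel.nn_integral_fst[symmetric]) measurable
  also have "\<dots> = (\<integral>\<^sup>+\<phi>. (\<integral>\<^sup>+p. h (\<phi>, p) \<partial>lborel) * indicator {0..<2*pi} \<phi> \<partial>lborel)"
    by (intro nn_integral_cong) (auto simp: nn_integral_multc indicator_times split: split_indicator)
  finally show ?thesis .
qed

lemma AE_line_params:
  assumes [measurable]: "A \<in> sets (borel :: (real \<times> real) measure)"
    and null: "\<And>\<phi>. emeasure lborel {p. (\<phi>, p) \<in> A} = 0"
  shows "AE \<omega> in line_params. \<omega> \<notin> A"
proof -
  have "(\<integral>\<^sup>+\<omega>. indicator A \<omega> \<partial>line_params) =
    (\<integral>\<^sup>+\<phi>. (\<integral>\<^sup>+p. indicator A (\<phi>, p) \<partial>lborel) * indicator {0..<2*pi} \<phi> \<partial>lborel)"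
    by (rule nn_integral_line_params) measurable
  also have "\<dots> = (\<integral>\<^sup>+\<phi>. 0 \<partial>(lborel :: real measure))"
  proof (intro nn_integral_cong)
    fix \<phi> :: real
    have [measurable]: "A \<in> sets (borel \<Otimes>\<^sub>M borel)" by (subst borel_prod) (rule assms)
    have "{p. (\<phi>, p) \<in> A} \<in> sets lborel" by measurable
    then have "(\<integral>\<^sup>+p. indicator {p. (\<phi>, p) \<in> A} p \<partial>lborel) = 0" by (simp add: null)
    then show "(\<integral>\<^sup>+p. indicator A (\<phi>, p) \<partial>lborel) * indicator {0..<2*pi} \<phi> = 0"
      by (simp add: indicator_def)
  qed
  finally have "(\<integral>\<^sup>+\<omega>. indicator A \<omega> \<partial>line_params) = 0" by simp
  then have "AE \<omega> in line_params. indicator A \<omega> = (0::ennreal)"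
    by (subst (asm) nn_integral_0_iff_AE) measurable
  then show ?thesis by (rule AE_mp) (auto simp: indicator_def)
qed

text \<open>Measurability has to be checked on the parameters only, because the lines carry the
  largest sigma-algebra for which \<open>line_of\<close> is measurable.\<close>

lemma nn_integral_kinematic:
  assumes "(\<lambda>\<omega>. F (line_of \<omega>)) \<in> borel_measurable line_params"
  shows "(\<integral>\<^sup>+l. F l \<partial>kinematic_measure) = (\<integral>\<^sup>+\<omega>. F (line_of \<omega>) \<partial>line_params)"
  unfolding kinematic_measure_def
proof (rule nn_integral_distr[OF line_of_measurable])
  have sp: "space (sigma (range line_of) line_sets) = range line_of"
    by (rule space_measure_of) (auto simp: line_sets_def)
  show "F \<in> borel_measurable (distr line_params (sigma (range line_of) line_sets) line_of)"
  proof (rule measurableI)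
    fix A :: "ennreal set" assume A: "A \<in> sets borel"
    have "line_of -` (F -` A \<inter> range line_of) \<inter> space line_params
        = (\<lambda>\<omega>. F (line_of \<omega>)) -` A \<inter> space line_params" by auto
    also have "\<dots> \<in> sets line_params" using assms A by (rule measurable_sets)
    finally have "F -` A \<inter> range line_of \<in> line_sets" by (auto simp: line_sets_def)
    then show "F -` A \<inter> space (distr line_params (sigma (range line_of) line_sets) line_of)
        \<in> sets (distr line_params (sigma (range line_of) line_sets) line_of)"
      by (simp add: sp sigma_algebra.sets_measure_of_eq[OF sigma_algebra_line_sets])
  qed simp
qed

section \<open>The measure of the lines separating two points\<close>

lemma integral_abs_cos: "((\<lambda>x. \<bar>cos x\<bar>) has_integral 4) {0..2*pi}"
proof -
  have 1: "((\<lambda>x. \<bar>cos x\<bar>) has_integral (sin (pi/2) - sin 0)) {0..pi/2}"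
  proof (rule has_integral_eq)
    show "(cos has_integral (sin (pi/2) - sin 0)) {0..pi/2}"
      by (rule fundamental_theorem_of_calculus)
        (auto intro!: derivative_eq_intros simp: has_real_derivative_iff_has_vector_derivative[symmetric])
    fix x assume "x \<in> {0..pi/2}"
    then show "cos x = \<bar>cos x\<bar>" by (simp add: cos_ge_zero)
  qed
  have 2: "((\<lambda>x. \<bar>cos x\<bar>) has_integral (- sin (3*pi/2) - - sin (pi/2))) {pi/2..3*pi/2}"
  proof (rule has_integral_eq)
    show "((\<lambda>x. - cos x) has_integral (- sin (3*pi/2) - - sin (pi/2))) {pi/2..3*pi/2}"
      by (rule fundamental_theorem_of_calculus)
        (auto intro!: derivative_eq_intros simp: has_real_derivative_iff_has_vector_derivative[symmetric])
    fix x assume x: "x \<in> {pi/2..3*pi/2}"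
    have "cos (x - pi) \<ge> 0" using x by (intro cos_ge_zero) auto
    then show "- cos x = \<bar>cos x\<bar>" by simp
  qed
  have 3: "((\<lambda>x. \<bar>cos x\<bar>) has_integral (sin (2*pi) - sin (3*pi/2))) {3*pi/2..2*pi}"
  proof (rule has_integral_eq)
    show "(cos has_integral (sin (2*pi) - sin (3*pi/2))) {3*pi/2..2*pi}"
      by (rule fundamental_theorem_of_calculus)
        (auto intro!: derivative_eq_intros simp: has_real_derivative_iff_has_vector_derivative[symmetric])
    fix x assume x: "x \<in> {3*pi/2..2*pi}"
    have "cos (x - 2*pi) \<ge> 0" using x by (intro cos_ge_zero) auto
    then show "cos x = \<bar>cos x\<bar>" by (simp add: cos_diff)
  qed
  have "sin (3*pi/2) = -1" using sin_3over2_pi by simp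
  then show ?thesis
    using has_integral_combine[OF _ _ has_integral_combine[OF _ _ 1 2] 3] by simp
qed

text \<open>Periodicity by cutting at \<open>\<alpha>\<close>: the two parts of the period trade
  places under the shift.\<close>

lemma integral_abs_cos_shift:
  assumes "0 \<le> \<alpha>" "\<alpha> \<le> 2*pi"
  shows "((\<lambda>x. \<bar>cos (x - \<alpha>)\<bar>) has_integral 4) {0..2*pi}"
proof -
  let ?f = "\<lambda>x. \<bar>cos x\<bar>"
  have int: "?f integrable_on {a..b}" for a b :: real
    by (intro integrable_continuous_real continuous_intros)
  have "(?f has_integral integral {2*pi-\<alpha>..2*pi} ?f) {2*pi-\<alpha>..2*pi}" using int by blast
  from has_integral_affinity[OF this[unfolded cbox_interval[symmetric]], of 1 "2*pi-\<alpha>"]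
  have A: "((\<lambda>x. \<bar>cos (x - \<alpha>)\<bar>) has_integral integral {2*pi-\<alpha>..2*pi} ?f) {0..\<alpha>}"
    using assms image_add_atLeastAtMost'[of "\<alpha> - 2*pi" "2*pi-\<alpha>" "2*pi"]
    by (simp add: algebra_simps cos_add cos_diff sin_add sin_diff)
  have "(?f has_integral integral {0..2*pi-\<alpha>} ?f) {0..2*pi-\<alpha>}" using int by blast
  from has_integral_affinity[OF this[unfolded cbox_interval[symmetric]], of 1 "-\<alpha>"]
  have B: "((\<lambda>x. \<bar>cos (x - \<alpha>)\<bar>) has_integral integral {0..2*pi-\<alpha>} ?f) {\<alpha>..2*pi}"
    using assms by (simp add: algebra_simps)
  have "integral {0..2*pi-\<alpha>} ?f + integral {2*pi-\<alpha>..2*pi} ?f = integral {0..2*pi} ?f"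
    using assms by (intro Henstock_Kurzweil_Integration.integral_combine int) auto
  also have "\<dots> = 4" using integral_abs_cos by (rule integral_unique)
  finally show ?thesis
    using has_integral_combine[OF _ _ A B] assms by (simp add: add.commute)
qed

lemma polar_coordinates:
  fixes v :: "real^2"
  obtains \<alpha> where "\<alpha> \<in> {0..<2*pi}" "v = norm v *\<^sub>R dir \<alpha>"
proof (cases "v = 0")
  case False
  have n: "(norm v)\<^sup>2 = (v $ 1)\<^sup>2 + (v $ 2)\<^sup>2"
    by (simp add: norm_vec_def L2_set_def sum_2)
  have "(v $ 1 / norm v)\<^sup>2 + (v $ 2 / norm v)\<^sup>2 = 1"
    using False by (simp add: power_divide add_divide_distrib[symmetric] n[symmetric])
  then obtain t where "0 \<le> t" "t < 2*pi" "v $ 1 / norm v = cos t" "v $ 2 / norm v = sin t"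
    using sincos_total_2pi by metis
  then have t: "t \<in> {0..<2*pi}" "v $ 1 = norm v * cos t" "v $ 2 = norm v * sin t"
    using False by (auto simp: field_simps)
  have "v = norm v *\<^sub>R dir t"
    unfolding vec_eq_iff forall_2 vector_scaleR_component real_scaleR_def
    using t(2,3) by (simp add: dir_def)
  with t(1) show ?thesis by (rule that)
qed (use that[of 0] in auto)

text \<open>The lengths of the projections of a segment, integrated over all directions. The
  integral of the absolute cosine is the origin of the factor 4 in Crofton's formula.\<close>

lemma nn_integral_abs_inner_dir:
  fixes v :: "real^2"
  shows "(\<integral>\<^sup>+\<phi>. ennreal \<bar>v \<bullet> dir \<phi>\<bar> * indicator {0..<2*pi} \<phi> \<partial>lborel) = ennreal (4 * norm v)"
proof -
  obtain \<alpha> where \<alpha>: "\<alpha> \<in> {0..<2*pi}" "v = norm v *\<^sub>R dir \<alpha>"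
    by (rule polar_coordinates)
  have eq: "\<bar>v \<bullet> dir \<phi>\<bar> = norm v * \<bar>cos (\<phi> - \<alpha>)\<bar>" for \<phi>
  proof -
    have "v \<bullet> dir \<phi> = norm v * (dir \<alpha> \<bullet> dir \<phi>)"
      by (subst \<alpha>(2)) simp
    also have "dir \<alpha> \<bullet> dir \<phi> = cos (\<phi> - \<alpha>)"
      unfolding inner_dir by (simp add: dir_def cos_diff)
    finally have "v \<bullet> dir \<phi> = norm v * cos (\<phi> - \<alpha>)" .
    then show ?thesis by (simp add: abs_mult)
  qed
  have "(\<integral>\<^sup>+\<phi>. ennreal \<bar>v \<bullet> dir \<phi>\<bar> * indicator {0..<2*pi} \<phi> \<partial>lborel)
      = (\<integral>\<^sup>+\<phi>. ennreal \<bar>v \<bullet> dir \<phi>\<bar> * indicator {0..2*pi} \<phi> \<partial>lborel)"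
    using AE_lborel_singleton[of "2*pi"]
    by (intro nn_integral_cong_AE) (auto simp: indicator_def elim!: eventually_mono)
  also have "\<dots> = ennreal (4 * norm v)"
  proof (rule nn_integral_has_integral_lebesgue')
    have "((\<lambda>\<phi>. norm v * \<bar>cos (\<phi> - \<alpha>)\<bar>) has_integral (norm v * 4)) {0..2*pi}"
      by (intro has_integral_mult_right integral_abs_cos_shift) (use \<alpha> in auto)
    then show "((\<lambda>\<phi>. \<bar>v \<bullet> dir \<phi>\<bar>) has_integral (4 * norm v)) {0..2*pi}"
      by (simp add: eq mult.commute)
  qed auto
  finally show ?thesis .
qed

text \<open>In a fixed direction the values of \<open>p\<close> fill the projection of the segment
  from \<open>a\<close> to \<open>b\<close>, so this is Crofton's formula for a single segment. The
  \<open>closed_segment\<close> here is one of real numbers, namely that projection.\<close>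

lemma nn_integral_separating_lines:
  fixes a b :: "real^2"
  defines "A \<equiv> {\<omega>. snd \<omega> \<in> closed_segment (a \<bullet> dir (fst \<omega>)) (b \<bullet> dir (fst \<omega>))}"
  shows "A \<in> sets borel" "(\<integral>\<^sup>+\<omega>. indicator A \<omega> \<partial>line_params) = ennreal (4 * dist a b)"
proof -
  have A: "A = {\<omega>. min (a \<bullet> dir (fst \<omega>)) (b \<bullet> dir (fst \<omega>)) \<le> snd \<omega>}
      \<inter> {\<omega>. snd \<omega> \<le> max (a \<bullet> dir (fst \<omega>)) (b \<bullet> dir (fst \<omega>))}"
    by (auto simp: A_def closed_segment_eq_real_ivl)
  have "closed A" unfolding A
    by (intro closed_Int closed_Collect_le continuous_intros)
  then show [measurable]: "A \<in> sets borel" by simp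
  have sec: "(\<integral>\<^sup>+p. indicator A (\<phi>, p) \<partial>lborel) = ennreal \<bar>(a - b) \<bullet> dir \<phi>\<bar>" for \<phi>
  proof -
    have "(\<integral>\<^sup>+p. indicator A (\<phi>, p) \<partial>lborel) =
       (\<integral>\<^sup>+p. indicator {min (a \<bullet> dir \<phi>) (b \<bullet> dir \<phi>)..max (a \<bullet> dir \<phi>) (b \<bullet> dir \<phi>)} p \<partial>lborel)"
      by (intro nn_integral_cong) (auto simp: A indicator_def)
    also have "\<dots> = ennreal \<bar>(a - b) \<bullet> dir \<phi>\<bar>"
      by (auto simp: inner_diff_left min_def max_def abs_if)
    finally show ?thesis .
  qed
  have "(\<integral>\<^sup>+\<omega>. indicator A \<omega> \<partial>line_params) =
    (\<integral>\<^sup>+\<phi>. (\<integral>\<^sup>+p. indicator A (\<phi>, p) \<partial>lborel) * indicator {0..<2*pi} \<phi> \<partial>lborel)"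
    by (rule nn_integral_line_params) measurable
  also have "\<dots> = ennreal (4 * dist a b)"
    unfolding sec nn_integral_abs_inner_dir by (simp add: dist_norm)
  finally show "(\<integral>\<^sup>+\<omega>. indicator A \<omega> \<partial>line_params) = ennreal (4 * dist a b)" .
qed

section \<open>Counting points by dyadic cells\<close>

definition cell :: "nat \<Rightarrow> nat \<Rightarrow> real set" where
  "cell n i = {real i / 2^n ..< (real i + 1) / 2^n}"

definition cell_index :: "nat \<Rightarrow> real \<Rightarrow> nat" where
  "cell_index n t = nat \<lfloor>2^n * t\<rfloor>"

lemma mem_cell: "0 \<le> t \<Longrightarrow> t \<in> cell n i \<longleftrightarrow> cell_index n t = i"
proof -
  assume "0 \<le> t"
  then have "cell_index n t = i \<longleftrightarrow> \<lfloor>2^n * t\<rfloor> = int i"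
    by (auto simp: cell_index_def)
  also have "\<dots> \<longleftrightarrow> t \<in> cell n i"
    by (auto simp: floor_eq_iff cell_def field_simps)
  finally show ?thesis by simp
qed

lemma cell_index_less: "0 \<le> t \<Longrightarrow> t < 1 \<Longrightarrow> cell_index n t < 2^n"
proof -
  assume "0 \<le> t" "t < 1"
  then have "\<lfloor>2^n * t\<rfloor> < 2^n" by (simp add: floor_less_iff)
  then show ?thesis by (simp add: cell_index_def nat_less_iff \<open>0 \<le> t\<close>)
qed

lemma cell_subset: "i < 2^n \<Longrightarrow> cell n i \<subseteq> {0..<1}"
proof -
  assume "i < 2^n"
  then have "real i + 1 \<le> 2^n" by (metis Suc_leI of_nat_Suc of_nat_le_iff of_nat_numeral of_nat_power add.commute)
  then have "(real i + 1) / 2^n \<le> 1" by simp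
  moreover have "0 \<le> real i / 2^n" by simp
  ultimately show ?thesis unfolding cell_def by (meson atLeastLessThan_iff order_less_le_trans order_trans subsetI)
qed

lemma cell_dist_less: "s \<in> cell n i \<Longrightarrow> t \<in> cell n i \<Longrightarrow> \<bar>s - t\<bar> < 1 / 2^n"
  by (auto simp: cell_def add_divide_distrib)

lemma eventually_cell_index_neq:
  assumes "0 \<le> s" "0 \<le> t" "s \<noteq> (t::real)"
  shows "\<forall>\<^sub>F n in sequentially. cell_index n s \<noteq> cell_index n t"
proof -
  have "(\<lambda>n. (1/2::real)^n) \<longlonglongrightarrow> 0" by (rule LIMSEQ_realpow_zero) auto
  then have "\<forall>\<^sub>F n in sequentially. (1/2::real)^n < \<bar>s - t\<bar>"
    using assms by (intro order_tendstoD) auto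
  then show ?thesis
  proof eventually_elim
    case (elim n)
    show ?case
    proof
      assume "cell_index n s = cell_index n t"
      then have "\<bar>s - t\<bar> < 1 / 2^n"
        using assms mem_cell by (intro cell_dist_less[of s n "cell_index n t"]) auto
      then show False using elim by (simp add: power_one_over)
    qed
  qed
qed

lemma eventually_cell_disjoint_closed:
  assumes "closed K" "t \<notin> K" "0 \<le> t"
  shows "\<forall>\<^sub>F n in sequentially. K \<inter> cell n (cell_index n t) = {}"
proof -
  obtain e where e: "0 < e" "ball t e \<inter> K = {}"
    using assms by (metis ComplI Compl_disjoint2 disjoint_eq_subset_Compl open_Compl open_contains_ball)
  have "(\<lambda>n. (1/2::real)^n) \<longlonglongrightarrow> 0" by (rule LIMSEQ_realpow_zero) auto
  then have "\<forall>\<^sub>F n in sequentially. (1/2::real)^n < e"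
    using e by (intro order_tendstoD) auto
  then show ?thesis
  proof eventually_elim
    case (elim n)
    show ?case
    proof (rule ccontr)
      assume "K \<inter> cell n (cell_index n t) \<noteq> {}"
      then obtain s where s: "s \<in> K" "s \<in> cell n (cell_index n t)" by blast
      have "\<bar>t - s\<bar> < 1 / 2^n"
        using s assms mem_cell by (intro cell_dist_less[of t n "cell_index n t"]) auto
      then have "s \<in> ball t e" using elim by (simp add: power_one_over dist_real_def)
      then show False using e s by blast
    qed
  qed
qed

text \<open>For fine cells, distinct points of \<open>Z\<close> have distinct cells, and a point of
  \<open>Z\<close> outside the closed set \<open>K\<close> has a cell that misses \<open>K\<close>.
  Then \<open>cell_index\<close> is a bijection from \<open>Z \<inter> K\<close> onto the counted
  cells.\<close>

lemma eventually_cell_count: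
  assumes Z: "finite Z" "Z \<subseteq> {0..<1}" and K: "closed K"
  shows "\<forall>\<^sub>F n in sequentially. card {i. i < 2^n \<and> Z \<inter> cell n i \<noteq> {} \<and> K \<inter> cell n i \<noteq> {}} = card (Z \<inter> K)"
proof -
  have Z0: "0 \<le> t" "t < 1" if "t \<in> Z" for t using Z that by auto
  have "\<forall>\<^sub>F n in sequentially. \<forall>s\<in>Z. \<forall>t\<in>Z. s \<noteq> t \<longrightarrow> cell_index n s \<noteq> cell_index n t"
    using Z0 Z(1) by (intro eventually_ball_finite ballI) (auto intro: eventually_cell_index_neq)
  moreover have "\<forall>\<^sub>F n in sequentially. \<forall>t\<in>Z - K. K \<inter> cell n (cell_index n t) = {}"
    using Z0 Z(1) K by (intro eventually_ball_finite ballI eventually_cell_disjoint_closed) auto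
  ultimately show ?thesis
  proof eventually_elim
    case (elim n)
    have "bij_betw (cell_index n) (Z \<inter> K) {i. i < 2^n \<and> Z \<inter> cell n i \<noteq> {} \<and> K \<inter> cell n i \<noteq> {}}"
      unfolding bij_betw_def
    proof (intro conjI subset_antisym subsetI)
      show "inj_on (cell_index n) (Z \<inter> K)" using elim(1) by (auto simp: inj_on_def)
      fix i assume "i \<in> cell_index n ` (Z \<inter> K)"
      then obtain t where t: "t \<in> Z" "t \<in> K" "i = cell_index n t" by auto
      then have "t \<in> cell n i" using mem_cell Z0 by auto
      then show "i \<in> {i. i < 2^n \<and> Z \<inter> cell n i \<noteq> {} \<and> K \<inter> cell n i \<noteq> {}}"
        using t Z0 cell_index_less by auto
    next
      fix i assume "i \<in> {i. i < 2^n \<and> Z \<inter> cell n i \<noteq> {} \<and> K \<inter> cell n i \<noteq> {}}"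
      then obtain t where t: "t \<in> Z" "t \<in> cell n i" "K \<inter> cell n i \<noteq> {}" by auto
      then have i: "i = cell_index n t" using mem_cell Z0 by auto
      then have "t \<in> K" using elim(2) t by auto
      then show "i \<in> cell_index n ` (Z \<inter> K)" using i t by auto
    qed
    then show ?case by (rule bij_betw_same_card[symmetric])
  qed
qed

lemma card_cells_le:
  assumes "finite Z" "Z \<subseteq> {0..<1}"
  shows "card {i. i < 2^n \<and> Z \<inter> cell n i \<noteq> {}} \<le> card Z"
proof -
  have "{i. i < 2^n \<and> Z \<inter> cell n i \<noteq> {}} \<subseteq> cell_index n ` Z"
    using assms(2) mem_cell by fastforce
  then show ?thesis
    using assms(1) by (meson card_image_le card_mono finite_imageI order_trans)
qed

text \<open>An infinite \<open>Z\<close> has finite subsets of every size, and each of them is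
  eventually counted in full, so that the counts exceed every bound.\<close>

lemma tendsto_cell_count:
  assumes "Z \<subseteq> {0..<1}"
  shows "(\<lambda>n. of_nat (card {i. i < 2^n \<and> Z \<inter> cell n i \<noteq> {}}) :: ennreal)
    \<longlonglongrightarrow> emeasure (count_space UNIV) Z"
proof (cases "finite Z")
  case True
  have "cell n i \<noteq> {}" for n i by (simp add: cell_def divide_strict_right_mono)
  then have "\<forall>\<^sub>F n in sequentially. card {i. i < 2^n \<and> Z \<inter> cell n i \<noteq> {}} = card Z"
    using eventually_cell_count[OF True assms closed_UNIV] by simp
  then have "\<forall>\<^sub>F n in sequentially. (of_nat (card {i. i < 2^n \<and> Z \<inter> cell n i \<noteq> {}}) :: ennreal)
      = emeasure (count_space UNIV) Z"
    using True by (auto elim!: eventually_mono)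
  then show ?thesis by (rule tendsto_eventually)
next
  case False
  have "\<forall>\<^sub>F n in sequentially. a < of_nat (card {i. i < 2^n \<and> Z \<inter> cell n i \<noteq> {}})"
    if "a < top" for a :: ennreal
  proof -
    obtain m :: nat where m: "a < of_nat m" using \<open>a < top\<close> ennreal_Ex_less_of_nat by (auto simp: top.not_eq_extremum)
    obtain Y where Y: "Y \<subseteq> Z" "finite Y" "card Y = m"
      using infinite_arbitrarily_large[OF False] by metis
    have "cell n i \<noteq> {}" for n i by (simp add: cell_def divide_strict_right_mono)
    then have "\<forall>\<^sub>F n in sequentially. card {i. i < 2^n \<and> Y \<inter> cell n i \<noteq> {}} = m"
      using eventually_cell_count[OF Y(2) _ closed_UNIV] Y assms by simp
    then show ?thesis
    proof eventually_elim
      case (elim n)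
      have "card {i. i < 2^n \<and> Y \<inter> cell n i \<noteq> {}} \<le> card {i. i < 2^n \<and> Z \<inter> cell n i \<noteq> {}}"
        using Y(1) by (intro card_mono) auto
      then have "(of_nat m :: ennreal) \<le> of_nat (card {i. i < 2^n \<and> Z \<inter> cell n i \<noteq> {}})"
        using elim by simp
      then show ?case using m by (rule less_le_trans[rotated])
    qed
  qed
  then show ?thesis using False by (auto simp: order_tendsto_iff)
qed

section \<open>Lines hitting a set, and crossing counts\<close>

definition lines_hitting :: "(real^2) set \<Rightarrow> (real \<times> real) set" where
  "lines_hitting A = {\<omega>. line_of \<omega> \<inter> A \<noteq> {}}"

lemma mem_lines_hitting: "\<omega> \<in> lines_hitting A \<longleftrightarrow> (\<exists>x\<in>A. x \<bullet> dir (fst \<omega>) = snd \<omega>)"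
  by (auto simp: lines_hitting_def mem_line_of[symmetric])

lemma lines_hitting_Union: "lines_hitting (\<Union>i\<in>I. A i) = (\<Union>i\<in>I. lines_hitting (A i))"
  by (auto simp: lines_hitting_def)

text \<open>With the angle restricted to a compact interval, these parameters form the image of a
  compact set under a continuous map.\<close>

lemma borel_lines_hitting_compact:
  assumes "compact A"
  shows "lines_hitting A \<in> sets borel"
proof -
  define \<Phi> where "\<Phi> = (\<lambda>(\<phi>, x). (\<phi>, x \<bullet> dir \<phi>))"
  have eq: "lines_hitting A = (\<Union>k::nat. \<Phi> ` ({- real k..real k} \<times> A))"
  proof (intro subset_antisym subsetI)
    fix \<omega> assume "\<omega> \<in> lines_hitting A"
    then obtain x where x: "x \<in> A" "x \<bullet> dir (fst \<omega>) = snd \<omega>" by (auto simp: mem_lines_hitting)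
    obtain k :: nat where "\<bar>fst \<omega>\<bar> \<le> k" using real_arch_simple by blast
    then have "\<omega> \<in> \<Phi> ` ({- real k..real k} \<times> A)"
      using x by (intro image_eqI[of _ _ "(fst \<omega>, x)"]) (auto simp: \<Phi>_def)
    then show "\<omega> \<in> (\<Union>k::nat. \<Phi> ` ({- real k..real k} \<times> A))" by blast
  qed (auto simp: mem_lines_hitting \<Phi>_def)
  have "compact (\<Phi> ` ({- real k..real k} \<times> A))" for k :: nat
    unfolding \<Phi>_def case_prod_beta
    by (intro compact_continuous_image compact_Times assms continuous_intros compact_Icc)
  then show ?thesis unfolding eq
    by (intro sets.countable_UN) (auto intro: borel_closed compact_imp_closed)
qed

text \<open>Continuous images of Borel sets need not be Borel. Countable unions of compact sets are
  stable under continuous images, and they include the half-open intervals from which curves are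
  assembled.\<close>

definition sigma_compact :: "'a::topological_space set \<Rightarrow> bool" where
  "sigma_compact S \<longleftrightarrow> (\<exists>F :: nat \<Rightarrow> 'a set. (\<forall>n. compact (F n)) \<and> S = (\<Union>n. F n))"

lemma sigma_compactI: "(\<And>n::nat. compact (F n)) \<Longrightarrow> S = (\<Union>n. F n) \<Longrightarrow> sigma_compact S"
  by (auto simp: sigma_compact_def)

lemma compact_imp_sigma_compact: "compact S \<Longrightarrow> sigma_compact S"
  by (rule sigma_compactI[of "\<lambda>_. S"]) auto

lemma sigma_compact_image:
  assumes "sigma_compact S" "continuous_on UNIV f"
  shows "sigma_compact (f ` S)"
proof -
  obtain F :: "nat \<Rightarrow> _" where F: "\<And>n. compact (F n)" "S = (\<Union>n. F n)"
    using assms(1) by (auto simp: sigma_compact_def)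
  show ?thesis
    by (rule sigma_compactI[of "\<lambda>n. f ` F n"])
       (use F assms in \<open>auto intro: compact_continuous_image continuous_on_subset\<close>)
qed

lemma sigma_compact_Int:
  fixes S T :: "'a::t2_space set"
  assumes "sigma_compact S" "sigma_compact T"
  shows "sigma_compact (S \<inter> T)"
proof -
  obtain F :: "nat \<Rightarrow> _" where F: "\<And>n. compact (F n)" "S = (\<Union>n. F n)"
    using assms(1) by (auto simp: sigma_compact_def)
  obtain G :: "nat \<Rightarrow> _" where G: "\<And>n. compact (G n)" "T = (\<Union>n. G n)"
    using assms(2) by (auto simp: sigma_compact_def)
  have "S \<inter> T = (\<Union>n. F (fst (prod_decode n)) \<inter> G (snd (prod_decode n)))"
  proof (intro subset_antisym subsetI)
    fix x assume "x \<in> S \<inter> T"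
    then obtain i j where "x \<in> F i" "x \<in> G j" using F G by blast
    then have "x \<in> F (fst (prod_decode (prod_encode (i, j)))) \<inter> G (snd (prod_decode (prod_encode (i, j))))"
      by simp
    then show "x \<in> (\<Union>n. F (fst (prod_decode n)) \<inter> G (snd (prod_decode n)))" by blast
  qed (use F G in auto)
  then show ?thesis
    using F(1) G(1) by (intro sigma_compactI[of "\<lambda>n. F (fst (prod_decode n)) \<inter> G (snd (prod_decode n))"])
      (auto intro: compact_Int)
qed

lemma sigma_compact_atLeastLessThan: "sigma_compact {a..<b::real}"
proof (rule sigma_compactI)
  show "compact {a..b - 1 / (real n + 1)}" for n :: nat by (rule compact_Icc)
  show "{a..<b} = (\<Union>n::nat. {a..b - 1 / (real n + 1)})"
  proof (intro subset_antisym subsetI)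
    fix x assume x: "x \<in> {a..<b}"
    then obtain n :: nat where "1 / (b - x) < n" using reals_Archimedean2 by blast
    then have "1 / (real n + 1) \<le> b - x" using x by (simp add: field_simps)
    then have "x \<in> {a..b - 1 / (real n + 1)}" using x by simp
    then show "x \<in> (\<Union>n::nat. {a..b - 1 / (real n + 1)})" by blast
  next
    fix x assume "x \<in> (\<Union>n::nat. {a..b - 1 / (real n + 1)})"
    then obtain n :: nat where "a \<le> x" "x \<le> b - 1 / (real n + 1)" by auto
    moreover have "0 < 1 / (real n + 1)" by simp
    ultimately have "a \<le> x \<and> x < b" by linarith
    then show "x \<in> {a..<b}" by simp
  qed
qed

lemma borel_sigma_compact:
  fixes S :: "'a::t2_space set"
  assumes "sigma_compact S"
  shows "S \<in> sets borel"
proof -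
  obtain F :: "nat \<Rightarrow> _" where F: "\<And>n. compact (F n)" "S = (\<Union>n. F n)"
    using assms by (auto simp: sigma_compact_def)
  have "F n \<in> sets borel" for n using F(1) by (intro borel_closed compact_imp_closed)
  then show ?thesis unfolding F(2) by auto
qed

lemma borel_lines_hitting:
  assumes "sigma_compact A"
  shows "lines_hitting A \<in> sets borel"
proof -
  obtain F :: "nat \<Rightarrow> _" where F: "\<And>n. compact (F n)" "A = (\<Union>n. F n)"
    using assms by (auto simp: sigma_compact_def)
  show ?thesis unfolding F(2) lines_hitting_Union
    using F(1) borel_lines_hitting_compact by auto
qed

text \<open>Parameters are counted instead of points of the image, so that the counts over disjoint
  parameter sets add up. Where \<open>f\<close> is injective both counts agree.\<close>

definition crossing_count :: "(real \<Rightarrow> real^2) \<Rightarrow> real set \<Rightarrow> real \<times> real \<Rightarrow> ennreal" where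
  "crossing_count f S \<omega> = emeasure (count_space UNIV) {t \<in> S. f t \<in> line_of \<omega>}"

lemma sum_indicator_lines_hitting:
  "(\<Sum>i<2^n. indicator (lines_hitting (f ` (S \<inter> cell n i))) \<omega> :: ennreal)
    = of_nat (card {i. i < 2^n \<and> {t \<in> S. f t \<in> line_of \<omega>} \<inter> cell n i \<noteq> {}})"
proof -
  have "(\<Sum>i<2^n. indicator (lines_hitting (f ` (S \<inter> cell n i))) \<omega> :: ennreal)
    = (\<Sum>i<2^n. indicator {i. {t \<in> S. f t \<in> line_of \<omega>} \<inter> cell n i \<noteq> {}} i)"
    by (intro sum.cong refl) (auto simp: indicator_def lines_hitting_def)
  also have "\<dots> = of_nat (card ({..<2^n} \<inter> {i. {t \<in> S. f t \<in> line_of \<omega>} \<inter> cell n i \<noteq> {}}))"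
    by (simp add: indicator_def sum.If_cases)
  also have "{..<2^n} \<inter> {i. {t \<in> S. f t \<in> line_of \<omega>} \<inter> cell n i \<noteq> {}}
      = {i. i < 2^n \<and> {t \<in> S. f t \<in> line_of \<omega>} \<inter> cell n i \<noteq> {}}" by auto
  finally show ?thesis .
qed

lemma tendsto_crossing_count:
  assumes "S \<subseteq> {0..<1}"
  shows "(\<lambda>n. \<Sum>i<2^n. indicator (lines_hitting (f ` (S \<inter> cell n i))) \<omega>) \<longlonglongrightarrow> crossing_count f S \<omega>"
  unfolding sum_indicator_lines_hitting crossing_count_def
  using assms by (intro tendsto_cell_count) auto

text \<open>The count is the pointwise limit of the number of dyadic pieces of the curve that the
  line hits.\<close>

lemma borel_measurable_crossing_count:
  assumes "continuous_on UNIV f" "sigma_compact S" "S \<subseteq> {0..<1}"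
  shows "crossing_count f S \<in> borel_measurable borel"
proof (rule borel_measurable_LIMSEQ_order)
  show "(\<lambda>n. \<Sum>i<2^n. indicator (lines_hitting (f ` (S \<inter> cell n i))) \<omega>) \<longlonglongrightarrow> crossing_count f S \<omega>" for \<omega>
    using assms(3) by (rule tendsto_crossing_count)
  show "(\<lambda>\<omega>. \<Sum>i<2^n. indicator (lines_hitting (f ` (S \<inter> cell n i))) \<omega> :: ennreal) \<in> borel_measurable borel" for n
    using assms(1,2) by (intro borel_measurable_sum borel_measurable_indicator borel_lines_hitting
      sigma_compact_image sigma_compact_Int) (auto simp: cell_def sigma_compact_atLeastLessThan)
qed

text \<open>In every direction the projection has length at most \<open>2 * r\<close>, and the
  directions have total measure \<open>2 * pi\<close>. The bound is crude, but it serves only to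
  show finiteness.\<close>

lemma nn_integral_lines_hitting_le:
  assumes "sigma_compact A" "A \<subseteq> cball x r" "0 \<le> r"
  shows "(\<integral>\<^sup>+\<omega>. indicator (lines_hitting A) \<omega> \<partial>line_params) \<le> ennreal (4 * pi * r)"
proof -
  have [measurable]: "lines_hitting A \<in> sets borel" by (rule borel_lines_hitting) fact
  have "(\<integral>\<^sup>+\<omega>. indicator (lines_hitting A) \<omega> \<partial>line_params) =
    (\<integral>\<^sup>+\<phi>. (\<integral>\<^sup>+p. indicator (lines_hitting A) (\<phi>, p) \<partial>lborel) * indicator {0..<2*pi} \<phi> \<partial>lborel)"
    by (rule nn_integral_line_params) measurable
  also have "\<dots> \<le> (\<integral>\<^sup>+\<phi>. ennreal (2 * r) * indicator {0..<2*pi} \<phi> \<partial>lborel)"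
  proof (intro nn_integral_mono mult_right_mono)
    fix \<phi> :: real
    have "(\<integral>\<^sup>+p. indicator (lines_hitting A) (\<phi>, p) \<partial>lborel)
        \<le> (\<integral>\<^sup>+p. indicator {x \<bullet> dir \<phi> - r..x \<bullet> dir \<phi> + r} p \<partial>lborel)"
    proof (intro nn_integral_mono)
      fix p :: real
      have "p \<in> {x \<bullet> dir \<phi> - r..x \<bullet> dir \<phi> + r}" if hit: "(\<phi>, p) \<in> lines_hitting A"
      proof -
        obtain y where y: "y \<in> A" "y \<bullet> dir \<phi> = p" using hit by (auto simp: mem_lines_hitting)
        then have "norm (y - x) \<le> r" using assms(2) by (auto simp: dist_norm norm_minus_commute)
        then have "\<bar>(y - x) \<bullet> dir \<phi>\<bar> \<le> r"
          using Cauchy_Schwarz_ineq2[of "y - x" "dir \<phi>"] by simp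
        then show ?thesis using y by (auto simp: inner_diff_left)
      qed
      then show "indicator (lines_hitting A) (\<phi>, p) \<le> (indicator {x \<bullet> dir \<phi> - r..x \<bullet> dir \<phi> + r} p :: ennreal)"
        by (auto split: split_indicator)
    qed
    also have "\<dots> = ennreal (2 * r)" using assms(3) by simp
    finally show "(\<integral>\<^sup>+p. indicator (lines_hitting A) (\<phi>, p) \<partial>lborel) \<le> ennreal (2 * r)" .
  qed simp
  also have "\<dots> = ennreal (4 * pi * r)"
    using assms(3) by (simp add: nn_integral_cmult ennreal_mult[symmetric] mult_ac)
  finally show ?thesis .
qed

text \<open>At level \<open>n\<close> there are \<open>2 ^ n\<close> pieces, each in a ball of
  radius \<open>C / 2 ^ n\<close>, so that the measures of lines hitting them sum to at most
  \<open>4 * pi * C\<close>; Fatou's lemma passes to the limit. The count then serves as an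
  integrable majorant and is finite for almost every line.\<close>

lemma nn_integral_crossing_count_finite:
  assumes f: "C-lipschitz_on UNIV f"
  shows "(\<integral>\<^sup>+\<omega>. crossing_count f {0..<1} \<omega> \<partial>line_params) < top"
proof -
  have C: "0 \<le> C" using f by (rule lipschitz_on_nonneg)
  have cont: "continuous_on UNIV f" using f by (rule lipschitz_on_continuous_on)
  have cell: "sigma_compact (cell n i)" for n i unfolding cell_def by (rule sigma_compact_atLeastLessThan)
  have cellsub: "{0..<1} \<inter> cell n i = cell n i" if "i < 2^n" for n i using cell_subset[OF that] by blast
  define D where "D n \<omega> = (\<Sum>i<2^n. indicator (lines_hitting (f ` (cell n i))) \<omega> :: ennreal)" for n \<omega>
  have hit[measurable]: "lines_hitting (f ` (cell n i)) \<in> sets borel" for n i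
    by (intro borel_lines_hitting sigma_compact_image cont cell)
  have D[measurable]: "D n \<in> borel_measurable borel" for n
    unfolding D_def by measurable
  have lim: "(\<lambda>n. D n \<omega>) \<longlonglongrightarrow> crossing_count f {0..<1} \<omega>" for \<omega>
    using tendsto_crossing_count[of "{0..<1}" f \<omega>] by (simp add: D_def cellsub)
  have "(\<integral>\<^sup>+\<omega>. crossing_count f {0..<1} \<omega> \<partial>line_params) = (\<integral>\<^sup>+\<omega>. liminf (\<lambda>n. D n \<omega>) \<partial>line_params)"
    by (intro nn_integral_cong lim_imp_Liminf[OF _ lim, symmetric]) simp
  also have "\<dots> \<le> liminf (\<lambda>n. \<integral>\<^sup>+\<omega>. D n \<omega> \<partial>line_params)"
    by (intro nn_integral_liminf) measurable
  also have "\<dots> \<le> liminf (\<lambda>n. ennreal (4 * pi * C))"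
  proof (intro Liminf_mono always_eventually allI)
    fix n
    have "(\<integral>\<^sup>+\<omega>. D n \<omega> \<partial>line_params) = (\<Sum>i<2^n. \<integral>\<^sup>+\<omega>. indicator (lines_hitting (f ` (cell n i))) \<omega> \<partial>line_params)"
      unfolding D_def by (intro nn_integral_sum) measurable
    also have "\<dots> \<le> (\<Sum>i<(2::nat)^n. ennreal (4 * pi * (C / 2^n)))"
    proof (intro sum_mono nn_integral_lines_hitting_le)
      fix i :: nat
      have mem: "real i / 2^n \<in> cell n i" by (simp add: cell_def divide_strict_right_mono)
      show "f ` cell n i \<subseteq> cball (f (real i / 2^n)) (C / 2^n)"
      proof clarify
        fix t assume "t \<in> cell n i"
        then have "\<bar>real i / 2^n - t\<bar> \<le> 1 / 2^n" using cell_dist_less[OF mem] by (simp add: less_imp_le)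
        moreover have "dist (f (real i / 2^n)) (f t) \<le> C * \<bar>real i / 2^n - t\<bar>"
          using lipschitz_onD[OF f] by (simp add: dist_real_def)
        ultimately show "f t \<in> cball (f (real i / 2^n)) (C / 2^n)"
          using C mult_left_mono[of "\<bar>real i / 2^n - t\<bar>" "1 / 2^n" C] by (simp add: mem_cball)
      qed
    qed (use C in \<open>auto intro!: sigma_compact_image cont cell\<close>)
    also have "\<dots> = ennreal (real (2^n) * (4 * pi * (C / 2^n)))"
      using C by (simp add: ennreal_of_nat_eq_real_of_nat ennreal_mult[symmetric] del: of_nat_power)
    also have "\<dots> = ennreal (4 * pi * C)" by simp
    finally show "(\<integral>\<^sup>+\<omega>. D n \<omega> \<partial>line_params) \<le> ennreal (4 * pi * C)" .
  qed
  also have "\<dots> = ennreal (4 * pi * C)" by (simp add: Liminf_const)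
  finally show ?thesis by (simp add: le_less_trans)
qed

lemma dist_le_nn_integral_lines_hitting:
  assumes f: "continuous_on UNIV f" and S: "is_interval S" "sigma_compact S" "s \<in> S" "t \<in> S"
  shows "ennreal (4 * dist (f s) (f t)) \<le> (\<integral>\<^sup>+\<omega>. indicator (lines_hitting (f ` S)) \<omega> \<partial>line_params)"
proof -
  let ?A = "{\<omega>. snd \<omega> \<in> closed_segment (f s \<bullet> dir (fst \<omega>)) (f t \<bullet> dir (fst \<omega>))}"
  have "?A \<subseteq> lines_hitting (f ` S)"
  proof clarify
    fix \<phi> p assume "snd (\<phi>, p) \<in> closed_segment (f s \<bullet> dir (fst (\<phi>, p))) (f t \<bullet> dir (fst (\<phi>, p)))"
    then have p: "p \<in> closed_segment (f s \<bullet> dir \<phi>) (f t \<bullet> dir \<phi>)" by simp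
    have "connected ((\<lambda>t. f t \<bullet> dir \<phi>) ` S)"
      by (intro connected_continuous_image is_interval_connected S(1) continuous_intros
          continuous_on_subset[OF f]) auto
    then have "is_interval ((\<lambda>t. f t \<bullet> dir \<phi>) ` S)" by (simp add: is_interval_connected_1)
    then have "closed_segment (f s \<bullet> dir \<phi>) (f t \<bullet> dir \<phi>) \<subseteq> (\<lambda>t. f t \<bullet> dir \<phi>) ` S"
      using S by (intro closed_segment_subset is_interval_convex) auto
    then show "(\<phi>, p) \<in> lines_hitting (f ` S)" using p by (auto simp: mem_lines_hitting)
  qed
  then have "(\<integral>\<^sup>+\<omega>. indicator ?A \<omega> \<partial>line_params) \<le> (\<integral>\<^sup>+\<omega>. indicator (lines_hitting (f ` S)) \<omega> \<partial>line_params)"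
    by (intro nn_integral_mono) (auto split: split_indicator)
  then show ?thesis using nn_integral_separating_lines(2)[of "f s" "f t"] by simp
qed

text \<open>The dyadic cells meeting \<open>K\<close> cover it with total diameter at most a quarter of the measure of
  the lines hitting their images, counted with multiplicity. Almost every line crosses the curve
  finitely often, so in the limit only its crossings inside \<open>K\<close> are counted.\<close>

lemma hausdorff1_image_le_crossing_count:
  assumes f: "C-lipschitz_on UNIV f" and K: "compact K" "K \<subseteq> {0..<1}"
  shows "4 * hausdorff1 (f ` K) \<le> (\<integral>\<^sup>+\<omega>. crossing_count f K \<omega> \<partial>line_params)"
proof -
  have C: "0 \<le> C" using f by (rule lipschitz_on_nonneg)
  have cont: "continuous_on UNIV f" using f by (rule lipschitz_on_continuous_on)
  have cell: "sigma_compact (cell n i)" for n i unfolding cell_def by (rule sigma_compact_atLeastLessThan)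
  have hit[measurable]: "lines_hitting (f ` (cell n i)) \<in> sets borel" for n i
    by (intro borel_lines_hitting sigma_compact_image cont cell)
  define I where "I n = {i. i < 2^n \<and> K \<inter> cell n i \<noteq> {}}" for n
  have finI: "finite (I n)" for n unfolding I_def by simp
  \<comment> \<open>The images of whole cells are used, even though only cells meeting
    \<open>K\<close> are selected: a connected image is hit by every line separating two of its
    points, whereas its part over \<open>K\<close> need not be.\<close>
  define D where "D n \<omega> = (\<Sum>i\<in>I n. indicator (lines_hitting (f ` (cell n i))) \<omega> :: ennreal)" for n \<omega>
  have D[measurable]: "D n \<in> borel_measurable borel" for n
    unfolding D_def by measurable
  have N[measurable]: "crossing_count f {0..<1} \<in> borel_measurable borel"
    by (intro borel_measurable_crossing_count cont sigma_compact_atLeastLessThan) auto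
  have NK[measurable]: "crossing_count f K \<in> borel_measurable borel"
    by (intro borel_measurable_crossing_count cont compact_imp_sigma_compact K)
  have Dcard: "D n \<omega> = of_nat (card {i. i < 2^n \<and> {t \<in> {0..<1}. f t \<in> line_of \<omega>} \<inter> cell n i \<noteq> {} \<and> K \<inter> cell n i \<noteq> {}})"
    for n \<omega>
  proof -
    have "D n \<omega> = (\<Sum>i\<in>I n. indicator {i. {t \<in> {0..<1}. f t \<in> line_of \<omega>} \<inter> cell n i \<noteq> {}} i)"
      unfolding D_def
    proof (intro sum.cong refl)
      fix i assume "i \<in> I n"
      then have "cell n i \<subseteq> {0..<1}" using cell_subset by (auto simp: I_def)
      then have "{t \<in> {0..<1}. f t \<in> line_of \<omega>} \<inter> cell n i = {t \<in> cell n i. f t \<in> line_of \<omega>}" by blast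
      then have "\<omega> \<in> lines_hitting (f ` cell n i) \<longleftrightarrow> {t \<in> {0..<1}. f t \<in> line_of \<omega>} \<inter> cell n i \<noteq> {}"
        by (auto simp: lines_hitting_def)
      then show "indicator (lines_hitting (f ` cell n i)) \<omega> =
        (indicator {i. {t \<in> {0..<1}. f t \<in> line_of \<omega>} \<inter> cell n i \<noteq> {}} i :: ennreal)"
        by (simp add: indicator_def)
    qed
    also have "\<dots> = of_nat (card (I n \<inter> {i. {t \<in> {0..<1}. f t \<in> line_of \<omega>} \<inter> cell n i \<noteq> {}}))"
      using finI by (simp add: indicator_def sum.If_cases)
    finally show ?thesis by (simp add: I_def Int_def conj_commute conj_left_commute)
  qed
  have Dle: "D n \<omega> \<le> crossing_count f {0..<1} \<omega>" for n \<omega>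
  proof (cases "finite {t \<in> {0..<1}. f t \<in> line_of \<omega>}")
    case True
    have "card {i. i < 2^n \<and> {t \<in> {0..<1}. f t \<in> line_of \<omega>} \<inter> cell n i \<noteq> {} \<and> K \<inter> cell n i \<noteq> {}}
        \<le> card {i. i < 2^n \<and> {t \<in> {0..<1}. f t \<in> line_of \<omega>} \<inter> cell n i \<noteq> {}}"
      by (intro card_mono) auto
    also have "\<dots> \<le> card {t \<in> {0..<1}. f t \<in> line_of \<omega>}"
      by (intro card_cells_le True) auto
    finally show ?thesis using True by (simp add: Dcard crossing_count_def)
  qed (simp add: crossing_count_def)
  have "AE \<omega> in line_params. crossing_count f {0..<1} \<omega> \<noteq> \<infinity>"
    using nn_integral_crossing_count_finite[OF f]
    by (intro nn_integral_PInf_AE borel_measurable_line_params N) simp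
  then have lim: "AE \<omega> in line_params. (\<lambda>n. D n \<omega>) \<longlonglongrightarrow> crossing_count f K \<omega>"
  proof (rule AE_mp, intro AE_I2 impI)
    fix \<omega> assume "crossing_count f {0..<1} \<omega> \<noteq> \<infinity>"
    then have fin: "finite {t \<in> {0..<1}. f t \<in> line_of \<omega>}"
      unfolding crossing_count_def by (metis emeasure_count_space_infinite infinity_ennreal_def subset_UNIV)
    have eq: "{t \<in> K. f t \<in> line_of \<omega>} = {t \<in> {0..<1}. f t \<in> line_of \<omega>} \<inter> K" using K(2) by auto
    have sub: "{t \<in> {0..<1}. f t \<in> line_of \<omega>} \<subseteq> {0..<1}" by auto
    have "\<forall>\<^sub>F n in sequentially. D n \<omega> = crossing_count f K \<omega>"
      using eventually_cell_count[OF fin sub compact_imp_closed[OF K(1)]] fin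
      by (auto simp: Dcard crossing_count_def eq elim!: eventually_mono)
    then show "(\<lambda>n. D n \<omega>) \<longlonglongrightarrow> crossing_count f K \<omega>" by (rule tendsto_eventually)
  qed
  \<comment> \<open>The count over the whole curve dominates and is integrable; convergence of the
    integrals, not just an inequality as in Fatou's lemma, is what the upper estimate of the covers
    needs.\<close>
  have lim_int: "(\<lambda>n. \<integral>\<^sup>+\<omega>. D n \<omega> \<partial>line_params) \<longlonglongrightarrow> (\<integral>\<^sup>+\<omega>. crossing_count f K \<omega> \<partial>line_params)"
    by (rule nn_integral_dominated_convergence[where w="crossing_count f {0..<1}"])
      (use lim Dle nn_integral_crossing_count_finite[OF f] in auto)
  have diam: "ennreal (4 * diameter (f ` cell n i)) \<le> (\<integral>\<^sup>+\<omega>. indicator (lines_hitting (f ` cell n i)) \<omega> \<partial>line_params)"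
    (is "_ \<le> ?c") for n i
  proof (cases "?c = top")
    case False
    then obtain c where c: "?c = ennreal c" "0 \<le> c" by (metis ennreal_cases infinity_ennreal_def)
    have "diameter (f ` cell n i) \<le> c / 4"
    proof (rule diameter_le_dist)
      fix x y assume "x \<in> f ` cell n i" "y \<in> f ` cell n i"
      then obtain s t where st: "s \<in> cell n i" "t \<in> cell n i" "x = f s" "y = f t" by auto
      have "ennreal (4 * dist x y) \<le> ennreal c"
        unfolding c(1)[symmetric] st(3,4)
        by (intro dist_le_nn_integral_lines_hitting cont cell st(1,2)) (simp add: cell_def is_interval_co)
      then show "dist x y \<le> c / 4" using c by (simp add: ennreal_le_iff)
    qed (use c in auto)
    then show ?thesis unfolding c(1) by (intro ennreal_leI) simp
  qed simp
  have "4 * hausdorff1_delta \<delta> (f ` K) \<le> (\<integral>\<^sup>+\<omega>. crossing_count f K \<omega> \<partial>line_params)" if \<delta>: "0 < \<delta>" for \<delta>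
  proof (rule tendsto_lowerbound[OF lim_int])
    have "(\<lambda>n. C * (1/2::real)^n) \<longlonglongrightarrow> C * 0"
      by (intro tendsto_intros LIMSEQ_realpow_zero) auto
    then have "\<forall>\<^sub>F n in sequentially. C * (1/2)^n < \<delta>" using \<delta> by (intro order_tendstoD) auto
    then show "\<forall>\<^sub>F n in sequentially. 4 * hausdorff1_delta \<delta> (f ` K) \<le> (\<integral>\<^sup>+\<omega>. D n \<omega> \<partial>line_params)"
    proof eventually_elim
      case (elim n)
      have dd: "dist (f s) (f t) \<le> C * (1/2)^n" if "s \<in> cell n i" "t \<in> cell n i" for s t i
      proof -
        have "dist (f s) (f t) \<le> C * \<bar>s - t\<bar>" using lipschitz_onD[OF f] by (simp add: dist_real_def)
        also have "\<dots> \<le> C * (1/2)^n"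
          using C cell_dist_less[OF that] by (intro mult_left_mono) (auto simp: power_one_over)
        finally show ?thesis .
      qed
      define U where "U i = (if i \<in> I n then f ` cell n i else {})" for i
      have "hausdorff1_delta \<delta> (f ` K) \<le> (\<Sum>i<2^n. ennreal (diameter (U i)))"
      proof (rule hausdorff1_delta_le_finite)
        show "f ` K \<subseteq> (\<Union>i<2^n. U i)"
        proof clarify
          fix t assume t: "t \<in> K"
          then have t01: "0 \<le> t" "t < 1" using K by auto
          have "t \<in> cell n (cell_index n t)" "cell_index n t < 2^n"
            using mem_cell t01 cell_index_less by auto
          then show "f t \<in> (\<Union>i<2^n. U i)"
            using t by (auto simp: U_def I_def intro!: bexI[of _ "cell_index n t"])
        qed
        fix i :: nat
        have dU: "dist x y \<le> C * (1/2)^n" if "x \<in> U i" "y \<in> U i" for x y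
          using that dd by (auto simp: U_def split: if_splits)
        then show "bounded (U i)" unfolding bounded_two_points by blast
        have "diameter (U i) \<le> C * (1/2)^n" using dU C by (intro diameter_le_dist) auto
        then show "diameter (U i) \<le> \<delta>" using elim by simp
      qed (use \<delta> in simp)
      also have "\<dots> = (\<Sum>i\<in>I n. ennreal (diameter (f ` cell n i)))"
        by (intro sum.mono_neutral_cong_right) (auto simp: U_def I_def)
      finally have "4 * hausdorff1_delta \<delta> (f ` K) \<le> 4 * (\<Sum>i\<in>I n. ennreal (diameter (f ` cell n i)))"
        by (intro mult_left_mono) auto
      also have "\<dots> = (\<Sum>i\<in>I n. ennreal (4 * diameter (f ` cell n i)))"
        by (simp add: sum_distrib_left ennreal_mult')
      also have "\<dots> \<le> (\<Sum>i\<in>I n. \<integral>\<^sup>+\<omega>. indicator (lines_hitting (f ` cell n i)) \<omega> \<partial>line_params)"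
        by (intro sum_mono diam)
      also have "\<dots> = (\<integral>\<^sup>+\<omega>. D n \<omega> \<partial>line_params)"
        unfolding D_def by (intro nn_integral_sum[symmetric]) measurable
      finally show ?case .
    qed
  qed simp
  then show ?thesis
    unfolding hausdorff1_def SUP_mult_left_ennreal by (intro SUP_least) auto
qed

section \<open>Crofton's inequality for rectifiable sets\<close>

text \<open>\<open>E\<close> keeps the first parameter of every fibre. The discarded parameters form
  a countable union of projections of compact sets of pairs, which makes \<open>E\<close>
  Borel.\<close>

lemma injective_borel_section:
  fixes f :: "real \<Rightarrow> 'a::t2_space"
  assumes f: "continuous_on UNIV f"
  obtains E where "E \<in> sets borel" "E \<subseteq> {0..<1}" "inj_on f E" "f ` E = f ` {0..<1}"
proof -
  \<comment> \<open>The gap \<open>1 / (real n + 1)\<close> replaces the open condition that one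
    parameter precedes the other by countably many closed conditions.\<close>
  define P where "P n = ({0..1} \<times> {0..1}) \<inter> {z. fst z \<le> snd z - 1 / (real n + 1)} \<inter> {z. f (fst z) = f (snd z)}" for n
  have cont: "continuous_on UNIV (\<lambda>z::real\<times>real. f (fst z))" "continuous_on UNIV (\<lambda>z::real\<times>real. f (snd z))"
    by (intro continuous_on_compose2[OF f] continuous_intros; simp)+
  have "compact (P n)" for n
    unfolding P_def
    by (intro compact_Int_closed compact_Times compact_Icc closed_Collect_le closed_Collect_eq continuous_intros cont)
  then have comp: "compact (snd ` P n)" for n
    by (intro compact_continuous_image continuous_intros)
  define E where "E = {0..<1} - (\<Union>n. snd ` P n)"
  have E: "t \<in> E \<longleftrightarrow> 0 \<le> t \<and> t < 1 \<and> (\<forall>s. 0 \<le> s \<and> s < t \<longrightarrow> f s \<noteq> f t)" for t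
  proof -
    have "t \<in> (\<Union>n. snd ` P n) \<longleftrightarrow> (\<exists>s. 0 \<le> s \<and> s < t \<and> f s = f t)" if t: "0 \<le> t" "t < 1"
    proof
      assume "t \<in> (\<Union>n. snd ` P n)"
      then obtain n s where "(s, t) \<in> P n" by auto
      then have "0 \<le> s" "s \<le> t - 1 / (real n + 1)" "f s = f t" by (auto simp: P_def)
      moreover have "0 < 1 / (real n + 1)" by simp
      ultimately show "\<exists>s. 0 \<le> s \<and> s < t \<and> f s = f t" by (metis diff_gt_0_iff_gt diff_strict_left_mono diff_zero order_le_less_trans)
    next
      assume "\<exists>s. 0 \<le> s \<and> s < t \<and> f s = f t"
      then obtain s where s: "0 \<le> s" "s < t" "f s = f t" by blast
      obtain n :: nat where "1 / (t - s) < n" using reals_Archimedean2 by blast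
      then have "1 / (real n + 1) \<le> t - s" using s by (simp add: field_simps)
      then have "(s, t) \<in> P n" using s t by (simp add: P_def)
      then show "t \<in> (\<Union>n. snd ` P n)" by force
    qed
    then show ?thesis by (auto simp: E_def)
  qed
  show thesis
  proof
    show "E \<in> sets borel"
      unfolding E_def using comp by (intro sets.Diff sets.countable_UN) (auto intro: borel_closed compact_imp_closed)
    show "E \<subseteq> {0..<1}" by (auto simp: E_def)
    show "inj_on f E"
      by (intro linorder_inj_onI') (use E in fastforce)
    show "f ` E = f ` {0..<1}"
    proof
      show "f ` E \<subseteq> f ` {0..<1}" by (auto simp: E_def)
      show "f ` {0..<1} \<subseteq> f ` E"
      proof clarify
        fix u :: real assume u: "u \<in> {0..<1}"
        let ?S = "{0..u} \<inter> {s. f s = f u}"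
        have "compact ?S"
          by (intro compact_Int_closed compact_Icc closed_Collect_eq f continuous_on_const)
        moreover have "?S \<noteq> {}" using u by auto
        ultimately obtain t where t: "t \<in> ?S" "\<And>s. s \<in> ?S \<Longrightarrow> t \<le> s"
          by (metis compact_attains_inf)
        have "t \<in> E" unfolding E
        proof (intro conjI allI impI)
          fix s assume s: "0 \<le> s \<and> s < t"
          show "f s \<noteq> f t"
          proof
            assume "f s = f t"
            then have "s \<in> ?S" using s t(1) by auto
            then show False using t(2) s by fastforce
          qed
        qed (use t u in auto)
        moreover have "f u = f t" using t(1) by auto
        ultimately show "f u \<in> f ` E" by blast
      qed
    qed
  qed
qed

lemma crossing_count_inj:
  assumes "inj_on f S"
  shows "crossing_count f S \<omega> = emeasure (count_space UNIV) (line_of \<omega> \<inter> f ` S)"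
proof -
  let ?Z = "{t \<in> S. f t \<in> line_of \<omega>}"
  have im: "f ` ?Z = line_of \<omega> \<inter> f ` S" by auto
  have inj: "inj_on f ?Z" using assms by (rule inj_on_subset) auto
  show ?thesis
  proof (cases "finite ?Z")
    case True
    then show ?thesis
      using card_image[OF inj] by (simp add: crossing_count_def im[symmetric])
  next
    case False
    then have "infinite (line_of \<omega> \<inter> f ` S)" using inj finite_image_iff im by metis
    then show ?thesis using False by (simp add: crossing_count_def)
  qed
qed

text \<open>Passing to the subset \<open>D\<close> avoids having to prove that the crossing number of
  \<open>\<Gamma>\<close> itself is a measurable function of the line.\<close>

lemma crofton_rectifiable_ge:
  fixes \<Gamma> :: "(real^2) set"
  assumes rect: "one_rectifiable \<Gamma>" and fin: "hausdorff1 \<Gamma> < top" and e: "0 < e"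
  obtains D where "D \<subseteq> \<Gamma>" "(\<lambda>\<omega>. emeasure (count_space UNIV) (line_of \<omega> \<inter> D)) \<in> borel_measurable borel"
    "4 * hausdorff1 \<Gamma> \<le> (\<integral>\<^sup>+\<omega>. emeasure (count_space UNIV) (line_of \<omega> \<inter> D) \<partial>line_params) + ennreal e"
proof -
  obtain f0 :: "nat \<Rightarrow> real \<Rightarrow> real^2" where f0: "\<And>i. \<exists>C. C-lipschitz_on UNIV (f0 i)"
      "hausdorff1 (\<Gamma> - (\<Union>i. range (f0 i))) = 0"
    and meas: "\<Gamma> \<in> lambda_system UNIV UNIV hausdorff1"
    using rect unfolding one_rectifiable_def by blast
  obtain B where B: "B \<in> sets borel" "B \<subseteq> \<Gamma>" "hausdorff1 (\<Gamma> - B) = 0"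
    using hausdorff1_borel_kernel[OF meas fin] .
  \<comment> \<open>Every curve is cut at the integers and each piece is shifted to the parameter
    interval \<open>{0..<1}\<close>, on which crossing counts are studied.\<close>
  define g where "g m t = f0 (fst (prod_decode m)) (t + of_int (int_decode (snd (prod_decode m))))" for m t
  have "\<exists>C. C-lipschitz_on UNIV (g m) \<and> 0 < C" for m
  proof -
    obtain C where C: "C-lipschitz_on UNIV (f0 (fst (prod_decode m)))" using f0(1) by blast
    have "(C + 1)-lipschitz_on UNIV (g m)"
    proof (rule lipschitz_onI)
      show "0 \<le> C + 1" using lipschitz_on_nonneg[OF C] by simp
      fix s t :: real
      have "dist (g m s) (g m t) \<le> C * dist s t"
        using lipschitz_onD[OF C, of "s + of_int (int_decode (snd (prod_decode m)))"
            "t + of_int (int_decode (snd (prod_decode m)))"]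
        by (simp add: g_def dist_real_def)
      also have "\<dots> \<le> (C + 1) * dist s t" by (intro mult_right_mono) auto
      finally show "dist (g m s) (g m t) \<le> (C + 1) * dist s t" .
    qed
    moreover have "0 < C + 1" using lipschitz_on_nonneg[OF C] by simp
    ultimately show ?thesis by blast
  qed
  then obtain C where C: "\<And>m. (C m)-lipschitz_on UNIV (g m)" "\<And>m. 0 < C m" by metis
  have cont: "continuous_on UNIV (g m)" for m using C(1) by (rule lipschitz_on_continuous_on)
  define R where "R m = g m ` {0..<1}" for m
  have R: "R m \<in> sets borel" for m
    unfolding R_def by (intro borel_sigma_compact sigma_compact_image cont sigma_compact_atLeastLessThan)
  have cover: "(\<Union>i. range (f0 i)) \<subseteq> (\<Union>m. R m)"
  proof clarify
    fix i and t :: real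
    define m where "m = prod_encode (i, int_encode \<lfloor>t\<rfloor>)"
    have "f0 i t = g m (t - of_int \<lfloor>t\<rfloor>)" by (simp add: g_def m_def)
    moreover have "t - of_int \<lfloor>t\<rfloor> \<in> {0..<1}" by (simp; linarith)
    ultimately show "f0 i t \<in> (\<Union>m. R m)" unfolding R_def by blast
  qed
  \<comment> \<open>Disjointness of the pieces lets the crossing numbers of the compact sets chosen
    inside them add up to the crossing number of their union \<open>D\<close>.\<close>
  define A where "A m = B \<inter> disjointed R m" for m
  have A: "A m \<in> sets borel" for m
    unfolding A_def disjointed_def using B R by (intro sets.Int sets.Diff sets.finite_UN) auto
  have AR: "A m \<subseteq> R m" "A m \<subseteq> B" for m unfolding A_def disjointed_def by auto
  have Adisj: "disjoint_family A"
    using disjoint_family_disjointed[of R] unfolding A_def disjoint_family_on_def by auto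
  have UA: "(\<Union>m. A m) = B \<inter> (\<Union>m. R m)"
    unfolding A_def using UN_disjointed_eq[of R] by blast
  have "\<exists>K. compact K \<and> K \<subseteq> {0..<1} \<and> inj_on (g m) K \<and> g m ` K \<subseteq> A m \<and>
      hausdorff1 (A m) \<le> hausdorff1 (g m ` K) + ennreal (e / 4 * (1/2)^Suc m)" for m
  proof -
    obtain E where E: "E \<in> sets borel" "E \<subseteq> {0..<1}" "inj_on (g m) E" "g m ` E = R m"
      unfolding R_def using injective_borel_section[OF cont] .
    define S where "S = E \<inter> (g m -` A m)"
    have gm: "g m \<in> borel_measurable borel" by (rule borel_measurable_continuous_onI[OF cont])
    have S: "S \<in> sets borel" unfolding S_def
      by (rule sets.Int[OF E(1) measurable_sets_borel[OF gm A]])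
    \<comment> \<open>After the \<open>C m\<close>-Lipschitz map and Crofton's factor 4, the
      leftovers \<open>S - K\<close> of all pieces together contribute at most
      \<open>e\<close>.\<close>
    define \<epsilon> where "\<epsilon> = e / 4 * (1/2)^Suc m / C m"
    have \<epsilon>: "0 < \<epsilon>" using e C(2)[of m] by (simp add: \<epsilon>_def)
    obtain K where K: "closed K" "K \<subseteq> S" "S - K \<in> lmeasurable" "emeasure lebesgue (S - K) < ennreal \<epsilon>"
      using sets_lebesgue_inner_closed[of S \<epsilon>] S \<epsilon> by auto
    have K01: "K \<subseteq> {0..<1}" using K(2) E(2) by (auto simp: S_def)
    have "hausdorff1 (S - K) \<le> ennreal (measure lebesgue (S - K))"
    proof (rule hausdorff1_le_measure)
      show "S - K \<subseteq> {0..1}" using E(2) by (auto simp: S_def)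
    qed (rule K)
    also have "\<dots> \<le> ennreal \<epsilon>"
      using K(3,4) by (simp add: emeasure_eq_measure2)
    finally have "ennreal (C m) * hausdorff1 (S - K) \<le> ennreal (C m) * ennreal \<epsilon>"
      by (intro mult_left_mono) auto
    also have "\<dots> = ennreal (e / 4 * (1/2)^Suc m)"
      using C(2)[of m] \<epsilon> by (simp add: ennreal_mult[symmetric] \<epsilon>_def)
    finally have small: "hausdorff1 (g m ` (S - K)) \<le> ennreal (e / 4 * (1/2)^Suc m)"
      using hausdorff1_lipschitz_image[OF lipschitz_on_subset[OF C(1)[of m]] C(2)[of m], of "S - K"] by auto
    have "A m = g m ` K \<union> g m ` (S - K)"
    proof -
      have "g m ` S = g m ` E \<inter> A m" by (auto simp: S_def)
      then have "g m ` S = A m" using E(4) AR(1)[of m] by auto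
      then show ?thesis using K(2) by blast
    qed
    then have "hausdorff1 (A m) \<le> hausdorff1 (g m ` K) + hausdorff1 (g m ` (S - K))"
      using hausdorff1_Un by metis
    also have "\<dots> \<le> hausdorff1 (g m ` K) + ennreal (e / 4 * (1/2)^Suc m)"
      by (intro add_left_mono small)
    finally have le: "hausdorff1 (A m) \<le> hausdorff1 (g m ` K) + ennreal (e / 4 * (1/2)^Suc m)" .
    have "bounded K" using K01 bounded_subset[of "{0..<1::real}" K] by simp
    then have "compact K" using K(1) compact_eq_bounded_closed by blast
    moreover have "inj_on (g m) K" using E(3) K(2) by (auto simp: S_def intro: inj_on_subset)
    moreover have "g m ` K \<subseteq> A m" using K(2) by (auto simp: S_def)
    ultimately show ?thesis using le K01 by blast
  qed
  then obtain K where K: "\<And>m. compact (K m)" "\<And>m. K m \<subseteq> {0..<1}" "\<And>m. inj_on (g m) (K m)" "\<And>m. g m ` K m \<subseteq> A m"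
      "\<And>m. hausdorff1 (A m) \<le> hausdorff1 (g m ` K m) + ennreal (e / 4 * (1/2)^Suc m)"
    by metis
  define D where "D = (\<Union>m. g m ` K m)"
  have count: "emeasure (count_space UNIV) (line_of \<omega> \<inter> D) = (\<Sum>m. crossing_count (g m) (K m) \<omega>)" for \<omega>
  proof -
    have "(\<Sum>m. crossing_count (g m) (K m) \<omega>) = (\<Sum>m. emeasure (count_space UNIV) (line_of \<omega> \<inter> g m ` K m))"
      by (intro suminf_cong crossing_count_inj K)
    also have "\<dots> = emeasure (count_space UNIV) (\<Union>m. line_of \<omega> \<inter> g m ` K m)"
    proof (rule suminf_emeasure)
      show "disjoint_family (\<lambda>m. line_of \<omega> \<inter> g m ` K m)"
        using Adisj K(4) unfolding disjoint_family_on_def by blast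
    qed auto
    also have "(\<Union>m. line_of \<omega> \<inter> g m ` K m) = line_of \<omega> \<inter> D" by (auto simp: D_def)
    finally show ?thesis by simp
  qed
  have N[measurable]: "crossing_count (g m) (K m) \<in> borel_measurable borel" for m
    by (intro borel_measurable_crossing_count cont compact_imp_sigma_compact K)
  show thesis
  proof
    show "D \<subseteq> \<Gamma>" using K(4) AR(2) B(2) unfolding D_def by blast
    show "(\<lambda>\<omega>. emeasure (count_space UNIV) (line_of \<omega> \<inter> D)) \<in> borel_measurable borel"
      unfolding count by measurable
    have "hausdorff1 \<Gamma> \<le> hausdorff1 ((\<Union>m. A m) \<union> ((\<Gamma> - B) \<union> (\<Gamma> - (\<Union>i. range (f0 i)))))"
      using cover by (intro hausdorff1_mono) (auto simp: UA)
    also have "\<dots> \<le> hausdorff1 (\<Union>m. A m) + (hausdorff1 (\<Gamma> - B) + hausdorff1 (\<Gamma> - (\<Union>i. range (f0 i))))"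
      by (rule order_trans[OF hausdorff1_Un add_left_mono[OF hausdorff1_Un]])
    also have "\<dots> = hausdorff1 (\<Union>m. A m)" using B(3) f0(2) by simp
    also have "\<dots> \<le> (\<Sum>m. hausdorff1 (A m))" by (rule hausdorff1_countable_Un)
    finally have "4 * hausdorff1 \<Gamma> \<le> 4 * (\<Sum>m. hausdorff1 (A m))" by (rule mult_left_mono) simp
    also have "\<dots> = (\<Sum>m. 4 * hausdorff1 (A m))" by simp
    also have "\<dots> \<le> (\<Sum>m. (\<integral>\<^sup>+\<omega>. crossing_count (g m) (K m) \<omega> \<partial>line_params) + ennreal (e * (1/2)^Suc m))"
    proof (intro suminf_le allI)
      fix m
      have "4 * hausdorff1 (A m) \<le> 4 * (hausdorff1 (g m ` K m) + ennreal (e / 4 * (1/2)^Suc m))"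
        by (intro mult_left_mono K(5)) simp
      also have "\<dots> = 4 * hausdorff1 (g m ` K m) + ennreal (e * (1/2)^Suc m)"
        using e by (simp add: distrib_left ennreal_mult'[symmetric] flip: ennreal_numeral)
      also have "\<dots> \<le> (\<integral>\<^sup>+\<omega>. crossing_count (g m) (K m) \<omega> \<partial>line_params) + ennreal (e * (1/2)^Suc m)"
        by (intro add_right_mono hausdorff1_image_le_crossing_count[OF C(1)] K)
      finally show "4 * hausdorff1 (A m) \<le> (\<integral>\<^sup>+\<omega>. crossing_count (g m) (K m) \<omega> \<partial>line_params) + ennreal (e * (1/2)^Suc m)" .
    qed auto
    also have "\<dots> = (\<Sum>m. \<integral>\<^sup>+\<omega>. crossing_count (g m) (K m) \<omega> \<partial>line_params) + (\<Sum>m. ennreal (e * (1/2)^Suc m))"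
      by (rule suminf_add[symmetric]) auto
    also have "(\<Sum>m. ennreal (e * (1/2)^Suc m)) = ennreal e"
      using e by (intro suminf_halves) simp
    also have "(\<Sum>m. \<integral>\<^sup>+\<omega>. crossing_count (g m) (K m) \<omega> \<partial>line_params)
        = (\<integral>\<^sup>+\<omega>. (\<Sum>m. crossing_count (g m) (K m) \<omega>) \<partial>line_params)"
      by (intro nn_integral_suminf[symmetric]) measurable
    finally show "4 * hausdorff1 \<Gamma> \<le> (\<integral>\<^sup>+\<omega>. emeasure (count_space UNIV) (line_of \<omega> \<inter> D) \<partial>line_params) + ennreal e"
      unfolding count .
  qed
qed

section \<open>Convex curves\<close>

lemma inner_dir_perp: "x \<bullet> dir (\<phi> + pi/2) = - (x $ 1) * sin \<phi> + x $ 2 * cos \<phi>"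
  by (simp add: inner_dir cos_add sin_add)

lemma dir_decompose: "x = (x \<bullet> dir \<phi>) *\<^sub>R dir \<phi> + (x \<bullet> dir (\<phi> + pi/2)) *\<^sub>R dir (\<phi> + pi/2)"
proof -
  have sc: "(sin \<phi>)\<^sup>2 + (cos \<phi>)\<^sup>2 = 1" by simp
  have "(x \<bullet> dir \<phi>) * cos \<phi> + (x \<bullet> dir (\<phi> + pi/2)) * (- sin \<phi>) = x $ 1"
    unfolding inner_dir_perp unfolding inner_dir using sc by algebra
  moreover have "(x \<bullet> dir \<phi>) * sin \<phi> + (x \<bullet> dir (\<phi> + pi/2)) * cos \<phi> = x $ 2"
    unfolding inner_dir_perp unfolding inner_dir using sc by algebra
  moreover have "dir (\<phi> + pi/2) $ 1 = - sin \<phi>" "dir (\<phi> + pi/2) $ 2 = cos \<phi>"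
      "dir \<phi> $ 1 = cos \<phi>" "dir \<phi> $ 2 = sin \<phi>"
    by (simp_all add: dir_def cos_add sin_add)
  ultimately show ?thesis
    unfolding vec_eq_iff forall_2 vector_add_component vector_scaleR_component real_scaleR_def by metis
qed

lemma dir_orthogonal [simp]: "dir \<phi> \<bullet> dir (\<phi> + pi/2) = 0" "dir (\<phi> + pi/2) \<bullet> dir \<phi> = 0"
  unfolding inner_commute[of "dir (\<phi> + pi/2)"] by (simp_all add: inner_dir_perp) (simp_all add: dir_def)

lemma dir_inner_self [simp]: "dir \<phi> \<bullet> dir \<phi> = 1"
  by (simp add: dot_square_norm)

lemma dir_nonzero [simp]: "dir \<phi> \<noteq> 0"
  by (metis norm_dir norm_zero zero_neq_one)

lemma dir_periodic [simp]: "dir (\<phi> + 2*pi) = dir \<phi>"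
  by (simp add: dir_def)

lemma dir_eq_iff:
  assumes "\<phi> \<in> {0..<2*pi}" "\<psi> \<in> {0..<2*pi}" "dir \<phi> = dir \<psi>"
  shows "\<phi> = \<psi>"
proof -
  have "cos \<phi> = cos \<psi>" "sin \<phi> = sin \<psi>"
    using arg_cong[OF assms(3), of "\<lambda>x. x $ 1"] arg_cong[OF assms(3), of "\<lambda>x. x $ 2"]
    by (auto simp: dir_def)
  then obtain n :: int where n: "\<phi> = \<psi> + 2 * pi * n" using sin_cos_eq_iff by metis
  have "\<bar>2 * pi * real_of_int n\<bar> < 2 * pi * 1" using n assms by auto
  then have "\<bar>real_of_int n\<bar> < 1" by (simp add: abs_mult)
  then have "n = 0" by linarith
  then show ?thesis using n by simp
qed

lemma dir_lipschitz: "norm (dir \<phi> - dir \<psi>) \<le> \<bar>\<phi> - \<psi>\<bar>"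
proof -
  have "(norm (dir \<phi> - dir \<psi>))\<^sup>2 = 2 - 2 * cos (\<phi> - \<psi>)"
  proof -
    have "(norm (dir \<phi> - dir \<psi>))\<^sup>2 = dir \<phi> \<bullet> dir \<phi> - 2 * (dir \<phi> \<bullet> dir \<psi>) + dir \<psi> \<bullet> dir \<psi>"
      by (simp add: power2_norm_eq_inner inner_diff_left inner_diff_right inner_commute)
    moreover have "dir \<phi> \<bullet> dir \<psi> = cos (\<phi> - \<psi>)"
      unfolding inner_dir by (simp add: dir_def cos_diff)
    ultimately show ?thesis by simp
  qed
  also have "\<dots> = (2 * sin ((\<phi> - \<psi>) / 2))\<^sup>2"
  proof -
    have "cos (2 * ((\<phi> - \<psi>) / 2)) = 1 - 2 * (sin ((\<phi> - \<psi>) / 2))\<^sup>2"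
      by (rule cos_double_sin)
    moreover have "2 * ((\<phi> - \<psi>) / 2) = \<phi> - \<psi>" by simp
    ultimately have "cos (\<phi> - \<psi>) = 1 - 2 * (sin ((\<phi> - \<psi>) / 2))\<^sup>2" by metis
    then show ?thesis by (simp add: power_mult_distrib)
  qed
  finally have "norm (dir \<phi> - dir \<psi>) = \<bar>2 * sin ((\<phi> - \<psi>) / 2)\<bar>"
    by (metis abs_norm_cancel real_sqrt_abs)
  also have "\<dots> \<le> \<bar>\<phi> - \<psi>\<bar>"
    using abs_sin_x_le_abs_x[of "(\<phi> - \<psi>) / 2"] by (simp add: abs_mult)
  finally show ?thesis .
qed

text \<open>The projection onto the direction from \<open>f a\<close> to \<open>f b\<close> does not
  increase distances, and by the intermediate value theorem the projected curve covers the interval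
  between the projected endpoints. Omitting the parameter \<open>b\<close> loses only an
  endpoint.\<close>

lemma dist_le_hausdorff1_image:
  fixes f :: "real \<Rightarrow> 'a::real_inner"
  assumes f: "continuous_on UNIV f" and ab: "a < b"
  shows "ennreal (dist (f a) (f b)) \<le> hausdorff1 (f ` {a..<b})"
proof (cases "f a = f b")
  case False
  define w where "w = (f b - f a) /\<^sub>R norm (f b - f a)"
  define h where "h x = x \<bullet> w" for x
  have w: "norm w = 1" using False by (simp add: w_def)
  have "f b \<bullet> w - f a \<bullet> w = (f b - f a) \<bullet> (f b - f a) / norm (f b - f a)"
    by (simp add: w_def inner_diff_left divide_inverse mult.commute right_diff_distrib)
  then have hd: "h (f b) - h (f a) = dist (f a) (f b)"
    using False by (simp add: h_def dist_norm norm_minus_commute power2_norm_eq_inner[symmetric] power2_eq_square)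
  have lip: "1-lipschitz_on (f ` {a..<b}) h"
  proof (rule lipschitz_onI)
    fix x y :: 'a
    show "dist (h x) (h y) \<le> 1 * dist x y"
      using Cauchy_Schwarz_ineq2[of "x - y" w] w by (simp add: h_def dist_norm inner_diff_left)
  qed simp
  have "{h (f a)<..<h (f b)} \<subseteq> h ` f ` {a..<b}"
  proof
    fix y assume y: "y \<in> {h (f a)<..<h (f b)}"
    have "\<exists>t\<ge>a. t \<le> b \<and> h (f t) = y"
      using y ab by (intro IVT') (auto simp: h_def intro!: continuous_intros continuous_on_subset[OF f])
    then obtain t where t: "a \<le> t" "t \<le> b" "h (f t) = y" by blast
    then have "t \<noteq> b" using y by auto
    then show "y \<in> h ` f ` {a..<b}" using t by auto
  qed
  then have "ennreal (h (f b) - h (f a)) \<le> hausdorff1 (h ` f ` {a..<b})"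
    by (rule hausdorff1_ge_interval)
  also have "\<dots> \<le> ennreal 1 * hausdorff1 (f ` {a..<b})"
    by (rule hausdorff1_lipschitz_image[OF lip]) simp
  finally show ?thesis by (simp add: hd)
qed simp

section \<open>Polar parametrization of the boundary\<close>

locale planar_convex_body =
  fixes \<Omega> :: "(real^2) set"
  assumes open_body: "open \<Omega>" and nonempty_body: "\<Omega> \<noteq> {}"
    and bounded_body: "bounded \<Omega>" and convex_body: "convex \<Omega>"
begin

lemma interior_body [simp]: "interior \<Omega> = \<Omega>"
  using open_body by (rule interior_open)

text \<open>An open segment from an interior point to a point of the closure lies in the interior.
  If the ray returned to the closure after its first boundary point, that point would therefore be
  interior.\<close>

lemma ray_exit:
  assumes z: "z \<in> \<Omega>" and v: "v \<noteq> 0"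
  obtains d where "0 < d" "z + d *\<^sub>R v \<in> frontier \<Omega>" "\<forall>e\<ge>0. z + e *\<^sub>R v \<in> closure \<Omega> \<longleftrightarrow> e \<le> d"
    "\<forall>e\<ge>0. z + e *\<^sub>R v \<in> frontier \<Omega> \<longleftrightarrow> e = d"
proof -
  obtain d where d: "0 < d" "z + d *\<^sub>R v \<in> frontier \<Omega>" "\<And>e. 0 \<le> e \<Longrightarrow> e < d \<Longrightarrow> z + e *\<^sub>R v \<in> interior \<Omega>"
    using ray_to_frontier[of \<Omega> z v] bounded_body z v by auto
  have out: "z + e *\<^sub>R v \<notin> closure \<Omega>" if "d < e" for e
  proof
    assume "z + e *\<^sub>R v \<in> closure \<Omega>"
    then have "open_segment z (z + e *\<^sub>R v) \<subseteq> interior \<Omega>"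
      using z by (intro in_interior_closure_convex_segment convex_body) auto
    moreover have "z + d *\<^sub>R v \<in> open_segment z (z + e *\<^sub>R v)"
      using d(1) that v unfolding in_segment
      by (auto intro!: exI[of _ "d / e"] simp: algebra_simps)
    ultimately show False using d(2) by (auto simp: frontier_def)
  qed
  show thesis
  proof
    have "z + e *\<^sub>R v \<in> closure \<Omega> \<longleftrightarrow> e \<le> d" if "0 \<le> e" for e
      using d out that closure_subset frontier_def
      by (metis DiffD1 interior_body linorder_not_less order_le_less subsetD)
    then show "\<forall>e\<ge>0. z + e *\<^sub>R v \<in> closure \<Omega> \<longleftrightarrow> e \<le> d" by blast
    have "z + e *\<^sub>R v \<in> frontier \<Omega> \<longleftrightarrow> e = d" if "0 \<le> e" for e
      using d out that unfolding frontier_def by (metis DiffD1 DiffD2 linorder_neqE_linordered_idom)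
    then show "\<forall>e\<ge>0. z + e *\<^sub>R v \<in> frontier \<Omega> \<longleftrightarrow> e = d" by blast
  qed (use d in auto)
qed

definition center :: "real^2" where
  "center = (SOME z. z \<in> \<Omega>)"

lemma center_in: "center \<in> \<Omega>"
  unfolding center_def using nonempty_body by (simp add: some_in_eq)

definition radius :: "real \<Rightarrow> real" where
  "radius \<phi> = (THE d. 0 \<le> d \<and> center + d *\<^sub>R dir \<phi> \<in> frontier \<Omega>)"

lemma radius:
  shows radius_pos: "0 < radius \<phi>" and radius_frontier: "center + radius \<phi> *\<^sub>R dir \<phi> \<in> frontier \<Omega>"
    and radius_closure: "0 \<le> e \<Longrightarrow> center + e *\<^sub>R dir \<phi> \<in> closure \<Omega> \<longleftrightarrow> e \<le> radius \<phi>"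
    and radius_unique: "0 \<le> e \<Longrightarrow> center + e *\<^sub>R dir \<phi> \<in> frontier \<Omega> \<longleftrightarrow> e = radius \<phi>"
proof -
  obtain d where d: "0 < d" "center + d *\<^sub>R dir \<phi> \<in> frontier \<Omega>"
      "\<forall>e\<ge>0. center + e *\<^sub>R dir \<phi> \<in> closure \<Omega> \<longleftrightarrow> e \<le> d"
      "\<forall>e\<ge>0. center + e *\<^sub>R dir \<phi> \<in> frontier \<Omega> \<longleftrightarrow> e = d"
    using ray_exit[OF center_in dir_nonzero[of \<phi>]] .
  have eq: "radius \<phi> = d"
    unfolding radius_def
  proof (rule the_equality)
    show "0 \<le> d \<and> center + d *\<^sub>R dir \<phi> \<in> frontier \<Omega>" using d(1,2) by simp
    fix e assume "0 \<le> e \<and> center + e *\<^sub>R dir \<phi> \<in> frontier \<Omega>"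
    then show "e = d" using d(4) by blast
  qed
  show "0 < radius \<phi>" "center + radius \<phi> *\<^sub>R dir \<phi> \<in> frontier \<Omega>"
    unfolding eq by (rule d)+
  show "center + e *\<^sub>R dir \<phi> \<in> closure \<Omega> \<longleftrightarrow> e \<le> radius \<phi>" if "0 \<le> e"
    unfolding eq using that d(3) by blast
  show "center + e *\<^sub>R dir \<phi> \<in> frontier \<Omega> \<longleftrightarrow> e = radius \<phi>" if "0 \<le> e"
    unfolding eq using that d(4) by blast
qed

text \<open>The angle is scaled so that the period is 1 and the dyadic cells subdivide the curve.
  Periodicity lets arcs run across the parameter 0.\<close>

definition curve :: "real \<Rightarrow> real^2" where
  "curve t = center + radius (2 * pi * t) *\<^sub>R dir (2 * pi * t)"

lemma radius_periodic: "radius (\<phi> + 2*pi) = radius \<phi>"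
  by (simp add: radius_def)

lemma curve_periodic: "curve (t + 1) = curve t"
proof -
  have "2*pi*(t+1) = 2 * pi * t + 2*pi" by (simp add: algebra_simps)
  then show ?thesis by (simp only: curve_def dir_periodic radius_periodic)
qed

lemma curve_in_frontier: "curve t \<in> frontier \<Omega>"
  unfolding curve_def by (rule radius_frontier)

lemma inj_on_curve: "inj_on curve {0..<1}"
proof (rule inj_onI)
  fix s t :: real assume st: "s \<in> {0..<1}" "t \<in> {0..<1}" "curve s = curve t"
  have eq: "radius (2 * pi * s) *\<^sub>R dir (2 * pi * s) = radius (2 * pi * t) *\<^sub>R dir (2 * pi * t)"
    using st(3) by (simp add: curve_def)
  have "radius (2 * pi * s) = radius (2 * pi * t)"
    using arg_cong[OF eq, of norm] radius_pos by (simp add: less_imp_le)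
  then have "dir (2 * pi * s) = dir (2 * pi * t)" using eq radius_pos[of "2 * pi * t"] by simp
  then have "2 * pi * s = 2 * pi * t" using st by (intro dir_eq_iff) auto
  then show "s = t" by simp
qed

lemma curve_image: "curve ` {0..<1} = frontier \<Omega>"
proof
  show "curve ` {0..<1} \<subseteq> frontier \<Omega>" using curve_in_frontier by auto
  show "frontier \<Omega> \<subseteq> curve ` {0..<1}"
  proof
    fix x assume x: "x \<in> frontier \<Omega>"
    obtain \<alpha> where \<alpha>: "\<alpha> \<in> {0..<2*pi}" "x - center = norm (x - center) *\<^sub>R dir \<alpha>"
      by (rule polar_coordinates)
    have eq: "x = center + norm (x - center) *\<^sub>R dir \<alpha>" using \<alpha>(2) by (metis add.commute diff_add_cancel)
    then have "norm (x - center) = radius \<alpha>" using x radius_unique[of "norm (x - center)" \<alpha>] by auto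
    then have "x = curve (\<alpha> / (2*pi))" using eq by (simp add: curve_def)
    moreover have "\<alpha> / (2*pi) \<in> {0..<1}" using \<alpha>(1) by auto
    ultimately show "x \<in> curve ` {0..<1}" by blast
  qed
qed

text \<open>On unit vectors, \<open>1 / radius\<close> is the Minkowski gauge of the body about
  \<open>center\<close>. A ball of radius \<open>r\<close> inside the body makes the gauge Lipschitz
  with constant \<open>1 / r\<close>, and boundedness of the radius transfers this to
  \<open>radius\<close> itself.\<close>

lemma curve_lipschitz: "\<exists>C. 0 < C \<and> C-lipschitz_on UNIV curve"
proof -
  obtain r where r: "0 < r" "cball center r \<subseteq> \<Omega>"
    using open_body center_in open_contains_cball by blast
  obtain R0 where R0: "\<And>x. x \<in> closure \<Omega> \<Longrightarrow> dist center x \<le> R0"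
    using bounded_closure[OF bounded_body] bounded_any_center by blast
  define R where "R = max R0 1"
  have R: "0 < R" "radius \<phi> \<le> R" for \<phi>
  proof -
    have "dist center (center + radius \<phi> *\<^sub>R dir \<phi>) \<le> R0"
      using radius_frontier by (intro R0) (auto simp: frontier_def)
    then show "radius \<phi> \<le> R" using radius_pos[of \<phi>] by (simp add: R_def dist_norm)
  qed (simp add: R_def)
  \<comment> \<open>Subadditivity of the gauge, applied to \<open>dir \<psi>\<close> written as
    \<open>dir \<phi>\<close> plus the difference of the two.\<close>
  have inv: "1 / radius \<psi> \<le> 1 / radius \<phi> + norm (dir \<psi> - dir \<phi>) / r" for \<phi> \<psi>
  proof (cases "dir \<psi> = dir \<phi>")
    case True then show ?thesis by (simp add: radius_def)
  next
    case False
    define \<delta> where "\<delta> = norm (dir \<psi> - dir \<phi>)"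
    have \<delta>: "0 < \<delta>" using False by (simp add: \<delta>_def)
    define d where "d = radius \<phi>"
    have d: "0 < d" unfolding d_def by (rule radius_pos)
    \<comment> \<open>This \<open>s\<close> makes \<open>s / d\<close> and
      \<open>s * \<delta> / r\<close> sum to 1, so that
      \<open>center + s *\<^sub>R dir \<psi>\<close> is a convex combination of the boundary point
      in direction \<open>\<phi>\<close> and a point of the ball.\<close>
    define s where "s = 1 / (1 / d + \<delta> / r)"
    have den: "0 < 1 / d + \<delta> / r" using d \<delta> r by (simp add: add_pos_pos)
    have "s * (1 / d + \<delta> / r) = 1" using den by (simp add: s_def)
    then have s: "0 < s" "s / d + s * \<delta> / r = 1"
      using den by (simp_all add: s_def distrib_left)
    have "(s / d) *\<^sub>R (center + d *\<^sub>R dir \<phi>) + (s * \<delta> / r) *\<^sub>R (center + (r / \<delta>) *\<^sub>R (dir \<psi> - dir \<phi>))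
        = (s / d + s * \<delta> / r) *\<^sub>R center + s *\<^sub>R dir \<psi>"
      using d \<delta> r s(1) by (simp add: scaleR_add_right scaleR_add_left scaleR_diff_right algebra_simps)
    also have "\<dots> = center + s *\<^sub>R dir \<psi>" by (simp add: s(2))
    finally have comb: "center + s *\<^sub>R dir \<psi> = (s / d) *\<^sub>R (center + d *\<^sub>R dir \<phi>) + (s * \<delta> / r) *\<^sub>R (center + (r / \<delta>) *\<^sub>R (dir \<psi> - dir \<phi>))"
      by simp
    have "center + (r / \<delta>) *\<^sub>R (dir \<psi> - dir \<phi>) \<in> cball center r"
      using r \<delta> by (simp add: dist_norm \<delta>_def)
    then have "center + (r / \<delta>) *\<^sub>R (dir \<psi> - dir \<phi>) \<in> closure \<Omega>" using r(2) closure_subset by blast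
    moreover have "center + d *\<^sub>R dir \<phi> \<in> closure \<Omega>"
      using radius_frontier by (simp add: d_def frontier_def)
    ultimately have "center + s *\<^sub>R dir \<psi> \<in> closure \<Omega>"
      unfolding comb using s d \<delta> r by (intro convexD convex_closure convex_body) auto
    then have "s \<le> radius \<psi>" using radius_closure s(1) by simp
    then have "1 / radius \<psi> \<le> 1 / s" using s(1) by (simp add: frac_le)
    then show ?thesis by (simp add: s_def d_def \<delta>_def)
  qed
  have rad: "\<bar>radius \<phi> - radius \<psi>\<bar> \<le> R * R / r * \<bar>\<phi> - \<psi>\<bar>" for \<phi> \<psi>
  proof -
    have "\<bar>1 / radius \<psi> - 1 / radius \<phi>\<bar> \<le> norm (dir \<psi> - dir \<phi>) / r"
      using inv[of \<psi> \<phi>] inv[of \<phi> \<psi>] by (simp add: norm_minus_commute)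
    also have "\<dots> \<le> \<bar>\<phi> - \<psi>\<bar> / r"
      using dir_lipschitz[of \<psi> \<phi>] r by (intro divide_right_mono) (auto simp: abs_minus_commute)
    finally have le: "\<bar>1 / radius \<psi> - 1 / radius \<phi>\<bar> \<le> \<bar>\<phi> - \<psi>\<bar> / r" .
    have "radius \<phi> - radius \<psi> = radius \<phi> * radius \<psi> * (1 / radius \<psi> - 1 / radius \<phi>)"
      using radius_pos[of \<phi>] radius_pos[of \<psi>] by (simp add: field_simps)
    then have "\<bar>radius \<phi> - radius \<psi>\<bar> = (radius \<phi> * radius \<psi>) * \<bar>1 / radius \<psi> - 1 / radius \<phi>\<bar>"
      using radius_pos[of \<phi>] radius_pos[of \<psi>] by (simp add: abs_mult)
    also have "\<dots> \<le> (R * R) * (\<bar>\<phi> - \<psi>\<bar> / r)"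
      using radius_pos R r le by (intro mult_mono) (auto simp: less_imp_le)
    finally show ?thesis by simp
  qed
  define C where "C = (R * R / r + R) * (2*pi)"
  have C: "0 < C" using R(1) r(1) by (simp add: C_def add_pos_pos)
  have "C-lipschitz_on UNIV curve"
  proof (rule lipschitz_onI)
    fix s t :: real
    let ?\<phi> = "2 * pi * s" and ?\<psi> = "2 * pi * t"
    have "curve s - curve t = (radius ?\<phi> - radius ?\<psi>) *\<^sub>R dir ?\<phi> + radius ?\<psi> *\<^sub>R (dir ?\<phi> - dir ?\<psi>)"
      by (simp add: curve_def algebra_simps)
    then have "norm (curve s - curve t) \<le> \<bar>radius ?\<phi> - radius ?\<psi>\<bar> + radius ?\<psi> * norm (dir ?\<phi> - dir ?\<psi>)"
      using norm_triangle_ineq[of "(radius ?\<phi> - radius ?\<psi>) *\<^sub>R dir ?\<phi>" "radius ?\<psi> *\<^sub>R (dir ?\<phi> - dir ?\<psi>)"]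
        radius_pos[of ?\<psi>] by simp
    also have "\<dots> \<le> R * R / r * \<bar>?\<phi> - ?\<psi>\<bar> + R * \<bar>?\<phi> - ?\<psi>\<bar>"
      using R radius_pos[of ?\<psi>] by (intro add_mono rad mult_mono dir_lipschitz) auto
    also have "\<dots> = (R * R / r + R) * \<bar>?\<phi> - ?\<psi>\<bar>" by (simp add: algebra_simps)
    also have "\<bar>?\<phi> - ?\<psi>\<bar> = 2*pi * \<bar>s - t\<bar>" by (simp add: right_diff_distrib[symmetric] abs_mult)
    finally show "dist (curve s) (curve t) \<le> C * dist s t"
      by (simp only: dist_norm C_def real_norm_def mult.assoc)
  qed (use C in simp)
  then show ?thesis using C by blast
qed

lemma continuous_curve: "continuous_on UNIV curve"
  using curve_lipschitz lipschitz_on_continuous_on by blast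

end

text \<open>Monotonicity of the integral in the set suffices to pass from \<open>D\<close> to
  \<open>\<Gamma>\<close>, whatever the measurability of the integrand on the right.\<close>

lemma crofton_rectifiable_measurable_ge:
  fixes \<Gamma> :: "(real^2) set"
  assumes rect: "one_rectifiable \<Gamma>" and fin: "hausdorff1 \<Gamma> < top"
  shows "4 * hausdorff1 \<Gamma> \<le> (\<integral>\<^sup>+\<omega>. emeasure (count_space UNIV) (line_of \<omega> \<inter> \<Gamma>) \<partial>line_params)"
proof (rule ennreal_le_epsilon)
  fix e :: real assume e: "0 < e"
  obtain D where D: "D \<subseteq> \<Gamma>"
    "4 * hausdorff1 \<Gamma> \<le> (\<integral>\<^sup>+\<omega>. emeasure (count_space UNIV) (line_of \<omega> \<inter> D) \<partial>line_params) + ennreal e"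
    using crofton_rectifiable_ge[OF rect fin e] by metis
  note D(2)
  also have "(\<integral>\<^sup>+\<omega>. emeasure (count_space UNIV) (line_of \<omega> \<inter> D) \<partial>line_params)
      \<le> (\<integral>\<^sup>+\<omega>. emeasure (count_space UNIV) (line_of \<omega> \<inter> \<Gamma>) \<partial>line_params)"
    using D(1) by (intro nn_integral_mono emeasure_mono) auto
  finally show "4 * hausdorff1 \<Gamma> \<le> (\<integral>\<^sup>+\<omega>. emeasure (count_space UNIV) (line_of \<omega> \<inter> \<Gamma>) \<partial>line_params) + ennreal e"
    by (simp add: add_right_mono)
qed

lemma sigma_compact_Un:
  assumes "sigma_compact S" "sigma_compact T"
  shows "sigma_compact (S \<union> T)"
proof -
  obtain F :: "nat \<Rightarrow> _" where F: "\<And>n. compact (F n)" "S = (\<Union>n. F n)"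
    using assms(1) by (auto simp: sigma_compact_def)
  obtain G :: "nat \<Rightarrow> _" where G: "\<And>n. compact (G n)" "T = (\<Union>n. G n)"
    using assms(2) by (auto simp: sigma_compact_def)
  show ?thesis
    by (rule sigma_compactI[of "\<lambda>n. F n \<union> G n"]) (use F G in auto)
qed

lemma open_imp_sigma_compact:
  fixes S :: "'a::euclidean_space set"
  assumes "open S"
  shows "sigma_compact S"
  by (metis assms open_Union_compact_subsets sigma_compactI)

lemma one_rectifiable_lipschitz_image:
  fixes f :: "real \<Rightarrow> 'a::metric_space"
  assumes "C-lipschitz_on UNIV f" "sigma_compact S"
  shows "one_rectifiable (f ` S)"
proof -
  have "f ` S \<in> lambda_system UNIV UNIV hausdorff1"
    using assms lipschitz_on_continuous_on
    by (intro borel_in_lambda_system_hausdorff1 borel_sigma_compact sigma_compact_image) blast+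
  moreover have "f ` S - (\<Union>i::nat. range f) = {}" by auto
  then have "hausdorff1 (f ` S - (\<Union>i::nat. range f)) = 0" by (simp only: hausdorff1_empty)
  then have "\<exists>g :: nat \<Rightarrow> real \<Rightarrow> 'a. (\<forall>i. \<exists>C. C-lipschitz_on UNIV (g i)) \<and>
      hausdorff1 (f ` S - (\<Union>i. range (g i))) = 0"
    using assms(1) by (intro exI[of _ "\<lambda>_. f"]) blast
  ultimately show ?thesis unfolding one_rectifiable_def by blast
qed

section \<open>Lines meeting a convex body\<close>

context planar_convex_body
begin

text \<open>The line passes through a point of the open body, and each of its two rays from there
  meets the boundary exactly once.\<close>

lemma perpendicular_exits:
  assumes hit: "\<omega> \<in> lines_hitting \<Omega>"
  obtains x y where "x \<noteq> y" "line_of \<omega> \<inter> frontier \<Omega> = {x, y}"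
proof -
  obtain \<phi> p where \<omega>: "\<omega> = (\<phi>, p)" by (cases \<omega>)
  obtain z where z: "z \<in> \<Omega>" "z \<bullet> dir \<phi> = p" using hit by (auto simp: mem_lines_hitting \<omega>)
  define w where "w = dir (\<phi> + pi/2)"
  have w: "w \<noteq> 0" "- w \<noteq> 0" by (auto simp: w_def)
  obtain d1 where d1: "0 < d1" "z + d1 *\<^sub>R w \<in> frontier \<Omega>"
      "\<forall>e\<ge>0. z + e *\<^sub>R w \<in> frontier \<Omega> \<longleftrightarrow> e = d1"
    by (rule ray_exit[OF z(1) w(1)])
  obtain d2 where d2: "0 < d2" "z + d2 *\<^sub>R (- w) \<in> frontier \<Omega>"
      "\<forall>e\<ge>0. z + e *\<^sub>R (- w) \<in> frontier \<Omega> \<longleftrightarrow> e = d2"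
    by (rule ray_exit[OF z(1) w(2)])
  have onl: "z + s *\<^sub>R w \<in> line_of \<omega>" for s
    using z(2) by (simp add: mem_line_of \<omega> w_def inner_add_left)
  show thesis
  proof
    show "z + d1 *\<^sub>R w \<noteq> z + (- d2) *\<^sub>R w"
    proof
      assume "z + d1 *\<^sub>R w = z + (- d2) *\<^sub>R w"
      then have "(d1 + d2) *\<^sub>R w = 0" by (simp add: scaleR_add_left)
      then show False using d1(1) d2(1) w(1) by simp
    qed
    show "line_of \<omega> \<inter> frontier \<Omega> = {z + d1 *\<^sub>R w, z + (- d2) *\<^sub>R w}"
    proof (intro subset_antisym subsetI)
      fix x assume x: "x \<in> line_of \<omega> \<inter> frontier \<Omega>"
      define s where "s = (x - z) \<bullet> w"
      have "(x - z) \<bullet> dir \<phi> = 0" using x z(2) by (simp add: mem_line_of \<omega> inner_diff_left)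
      then have "x - z = s *\<^sub>R w" using dir_decompose[of "x - z" \<phi>] by (simp add: s_def w_def)
      then have xs: "x = z + s *\<^sub>R w" by (metis add.commute diff_add_cancel)
      show "x \<in> {z + d1 *\<^sub>R w, z + (- d2) *\<^sub>R w}"
      proof (cases "0 \<le> s")
        case True
        then show ?thesis using d1(3) x xs by auto
      next
        case False
        have "x = z + (- s) *\<^sub>R (- w)" using xs by simp
        then have "- s = d2" using d2(3) x False by (metis IntD2 less_eq_real_def linorder_not_le neg_0_le_iff_le)
        then show ?thesis using xs by auto
      qed
    next
      fix x assume "x \<in> {z + d1 *\<^sub>R w, z + (- d2) *\<^sub>R w}"
      then show "x \<in> line_of \<omega> \<inter> frontier \<Omega>" using d1(2) d2(2) onl[of d1] onl[of "- d2"] by auto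
    qed
  qed
qed

text \<open>The two rays normal to the line, from a point of the body on the line, reach the
  boundary on either side.\<close>

lemma frontier_both_sides:
  assumes hit: "\<omega> \<in> lines_hitting \<Omega>"
  obtains x y where "x \<in> frontier \<Omega>" "x \<bullet> dir (fst \<omega>) < snd \<omega>" "y \<in> frontier \<Omega>" "snd \<omega> < y \<bullet> dir (fst \<omega>)"
proof -
  obtain z where z: "z \<in> \<Omega>" "z \<bullet> dir (fst \<omega>) = snd \<omega>" using hit by (auto simp: mem_lines_hitting)
  have w: "dir (fst \<omega>) \<noteq> 0" "- dir (fst \<omega>) \<noteq> 0" by auto
  obtain d1 where d1: "0 < d1" "z + d1 *\<^sub>R dir (fst \<omega>) \<in> frontier \<Omega>"
    by (rule ray_exit[OF z(1) w(1)])
  obtain d2 where d2: "0 < d2" "z + d2 *\<^sub>R (- dir (fst \<omega>)) \<in> frontier \<Omega>"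
    by (rule ray_exit[OF z(1) w(2)])
  show thesis
    by (rule that[OF d2(2) _ d1(2)]) (use d1(1) d2(1) z(2) in \<open>auto simp: inner_add_left inner_diff_left\<close>)
qed

lemma borel_lines_hitting_body: "lines_hitting \<Omega> \<in> sets borel"
  by (intro borel_lines_hitting open_imp_sigma_compact open_body)

lemma borel_lines_hitting_closure: "lines_hitting (closure \<Omega>) \<in> sets borel"
  using bounded_body by (intro borel_lines_hitting_compact) simp

text \<open>The exceptional lines are support lines: for a fixed direction their \<open>p\<close>
  lies in the frontier of the interval onto which the body projects, a null set.\<close>

lemma AE_lines_hitting_closure:
  "AE \<omega> in line_params. \<omega> \<in> lines_hitting (closure \<Omega>) \<longleftrightarrow> \<omega> \<in> lines_hitting \<Omega>"
proof -
  have [measurable]: "lines_hitting (closure \<Omega>) - lines_hitting \<Omega> \<in> sets borel"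
    using borel_lines_hitting_body borel_lines_hitting_closure by auto
  have "AE \<omega> in line_params. \<omega> \<notin> lines_hitting (closure \<Omega>) - lines_hitting \<Omega>"
  proof (rule AE_line_params)
    fix \<phi> :: real
    define I where "I = (\<lambda>x. x \<bullet> dir \<phi>) ` \<Omega>"
    have "convex I" unfolding I_def
      by (intro convex_linear_image convex_body bounded_linear.linear bounded_linear_inner_left)
    then have "negligible (frontier I)" by (rule negligible_convex_frontier)
    moreover have sub: "{p. (\<phi>, p) \<in> lines_hitting (closure \<Omega>) - lines_hitting \<Omega>} \<subseteq> frontier I"
    proof clarify
      fix p assume p: "(\<phi>, p) \<in> lines_hitting (closure \<Omega>)" "(\<phi>, p) \<notin> lines_hitting \<Omega>"
      then obtain x where x: "x \<in> closure \<Omega>" "x \<bullet> dir \<phi> = p" by (auto simp: mem_lines_hitting)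
      have "(\<lambda>x. x \<bullet> dir \<phi>) ` closure \<Omega> \<subseteq> closure I" unfolding I_def
        by (intro image_closure_subset continuous_intros closed_closure closure_subset)
      then have "p \<in> closure I" using x by auto
      moreover have "p \<notin> I" using p(2) by (auto simp: I_def mem_lines_hitting)
      ultimately show "p \<in> frontier I" using interior_subset by (auto simp: frontier_def)
    qed
    ultimately have "negligible {p. (\<phi>, p) \<in> lines_hitting (closure \<Omega>) - lines_hitting \<Omega>}"
      by (rule negligible_subset)
    then have 0: "emeasure lebesgue {p. (\<phi>, p) \<in> lines_hitting (closure \<Omega>) - lines_hitting \<Omega>} = 0"
      by (metis negligible_iff_null_sets null_setsD1)
    have "lines_hitting (closure \<Omega>) - lines_hitting \<Omega> \<in> sets (borel \<Otimes>\<^sub>M borel)"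
      unfolding borel_prod by measurable
    then have "Pair \<phi> -` (lines_hitting (closure \<Omega>) - lines_hitting \<Omega>) \<in> sets borel"
      by (rule sets_Pair1)
    then have X: "{p. (\<phi>, p) \<in> lines_hitting (closure \<Omega>) - lines_hitting \<Omega>} \<in> sets lborel"
      by (simp add: vimage_def)
    show "emeasure lborel {p. (\<phi>, p) \<in> lines_hitting (closure \<Omega>) - lines_hitting \<Omega>} = 0"
      using 0 by (simp only: emeasure_completion[OF sets_completionI_sets[OF X]] main_part[OF X])
  qed measurable
  then show ?thesis
    by (rule AE_mp) (use closure_subset in \<open>auto simp: lines_hitting_def\<close>)
qed

lemma borel_crossing_count_curve:
  "sigma_compact S \<Longrightarrow> S \<subseteq> {0..<1} \<Longrightarrow> crossing_count curve S \<in> borel_measurable borel"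
  by (intro borel_measurable_crossing_count continuous_curve)

lemma crossing_count_curve:
  "S \<subseteq> {0..<1} \<Longrightarrow> crossing_count curve S \<omega> = emeasure (count_space UNIV) (line_of \<omega> \<inter> curve ` S)"
  by (intro crossing_count_inj inj_on_subset[OF inj_on_curve])

lemma crossing_count_frontier:
  assumes "\<omega> \<in> lines_hitting \<Omega>"
  shows "emeasure (count_space UNIV) (line_of \<omega> \<inter> frontier \<Omega>) = 2"
proof -
  obtain x y where "x \<noteq> y" "line_of \<omega> \<inter> frontier \<Omega> = {x, y}"
    using perpendicular_exits[OF assms] .
  then show ?thesis by simp
qed

lemma AE_crossing_count_frontier:
  "AE \<omega> in line_params. emeasure (count_space UNIV) (line_of \<omega> \<inter> frontier \<Omega>) = 2 * indicator (lines_hitting \<Omega>) \<omega>"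
  using AE_lines_hitting_closure
proof (rule AE_mp, intro AE_I2 impI)
  fix \<omega> assume *: "\<omega> \<in> lines_hitting (closure \<Omega>) \<longleftrightarrow> \<omega> \<in> lines_hitting \<Omega>"
  show "emeasure (count_space UNIV) (line_of \<omega> \<inter> frontier \<Omega>) = 2 * indicator (lines_hitting \<Omega>) \<omega>"
  proof (cases "\<omega> \<in> lines_hitting \<Omega>")
    case False
    then have "line_of \<omega> \<inter> frontier \<Omega> = {}" using * by (auto simp: lines_hitting_def frontier_def)
    then show ?thesis using False by simp
  qed (simp add: crossing_count_frontier)
qed

lemma crossings_curve_parameters:
  assumes hit: "\<omega> \<in> lines_hitting \<Omega>"
  obtains \<alpha> \<beta> where "0 \<le> \<alpha>" "\<alpha> < \<beta>" "\<beta> < 1" "{t \<in> {0..<1}. curve t \<in> line_of \<omega>} = {\<alpha>, \<beta>}"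
proof -
  obtain x y where xy: "x \<noteq> y" "line_of \<omega> \<inter> frontier \<Omega> = {x, y}"
    using perpendicular_exits[OF hit] .
  then have "x \<in> curve ` {0..<1}" "y \<in> curve ` {0..<1}" unfolding curve_image by auto
  then obtain s t where st: "s \<in> {0..<1}" "x = curve s" "t \<in> {0..<1}" "y = curve t" by auto
  have Z: "{t \<in> {0..<1}. curve t \<in> line_of \<omega>} = {s, t}"
  proof (intro subset_antisym subsetI)
    fix u assume "u \<in> {t \<in> {0..<1}. curve t \<in> line_of \<omega>}"
    then have "u \<in> {0..<1}" "curve u \<in> {x, y}" using xy(2) curve_in_frontier by auto
    then show "u \<in> {s, t}" using st inj_onD[OF inj_on_curve] by auto
  qed (use st xy(2) in auto)
  have "s \<noteq> t" using xy(1) st by auto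
  then show thesis
    using that[of "min s t" "max s t"] st Z by (auto simp: min_def max_def insert_commute)
qed

end

text \<open>Written with \<open>Suc i\<close>, the right end of a cell is visibly the left end of
  the next one, as the inscribed polygon requires.\<close>

lemma cell_bounds: "cell n i = {real i / 2^n ..< real (Suc i) / 2^n}"
  by (simp add: cell_def add.commute)

section \<open>Crofton's formula for the boundary and its arcs\<close>

context planar_convex_body
begin

lemma hausdorff1_curve_finite: "hausdorff1 (curve ` S) < top" if "S \<subseteq> {0..<1}"
proof -
  obtain C where C: "0 < C" "C-lipschitz_on UNIV curve" using curve_lipschitz by blast
  have "hausdorff1 (curve ` S) \<le> ennreal C * hausdorff1 S"
    using C by (intro hausdorff1_lipschitz_image lipschitz_on_subset[OF C(2)]) auto
  also have "\<dots> \<le> ennreal C * hausdorff1 {0..<1::real}"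
    by (intro mult_left_mono hausdorff1_mono that) simp
  also have "\<dots> \<le> ennreal C * 1" by (intro mult_left_mono hausdorff1_unit_interval) simp
  finally show ?thesis by (simp add: le_less_trans)
qed

lemma one_rectifiable_curve: "sigma_compact S \<Longrightarrow> one_rectifiable (curve ` S)"
  using curve_lipschitz one_rectifiable_lipschitz_image by blast

text \<open>The two parameters at which a line crosses the curve cut it into two arcs lying on opposite
  sides of the line. Once the two parameters lie in different cells, the chords over these two cells
  are therefore crossed by the line.\<close>

lemma chords_crossed:
  assumes hit: "\<omega> \<in> lines_hitting \<Omega>"
  shows "\<forall>\<^sub>F n in sequentially. (2::ennreal) \<le> (\<Sum>i<2^n. indicator {\<omega>. snd \<omega> \<in>
    closed_segment (curve (real i / 2^n) \<bullet> dir (fst \<omega>)) (curve (real (Suc i) / 2^n) \<bullet> dir (fst \<omega>))} \<omega>)"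
proof -
  obtain \<alpha> \<beta> where ab: "0 \<le> \<alpha>" "\<alpha> < \<beta>" "\<beta> < 1" and Z: "{t \<in> {0..<1}. curve t \<in> line_of \<omega>} = {\<alpha>, \<beta>}"
    using crossings_curve_parameters[OF hit] .
  define h where "h t = curve t \<bullet> dir (fst \<omega>) - snd \<omega>" for t
  have cont: "continuous_on UNIV h" unfolding h_def by (intro continuous_intros continuous_curve)
  have per: "h (t + 1) = h t" for t by (simp add: h_def curve_periodic)
  have zero: "h t = 0 \<longleftrightarrow> t = \<alpha> \<or> t = \<beta>" if "0 \<le> t" "t < 1" for t
  proof -
    have "h t = 0 \<longleftrightarrow> t \<in> {t \<in> {0..<1}. curve t \<in> line_of \<omega>}" using that by (auto simp: h_def mem_line_of)
    then show ?thesis unfolding Z by simp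
  qed
  have nz1: "h t \<noteq> 0" if "t \<in> {\<alpha><..<\<beta>}" for t using zero[of t] that ab by auto
  have nz2: "h t \<noteq> 0" if "t \<in> {\<beta><..<\<alpha>+1}" for t
  proof (cases "t < 1")
    case True then show ?thesis using zero[of t] that ab by auto
  next
    case False
    have "h (t - 1) \<noteq> 0" using zero[of "t - 1"] that ab False by auto
    then show ?thesis using per[of "t - 1"] by simp
  qed
  have const_sign: "(\<forall>t\<in>I. 0 < h t) \<or> (\<forall>t\<in>I. h t < 0)"
    if "is_interval I" "\<And>t. t \<in> I \<Longrightarrow> h t \<noteq> 0" for I
  proof (rule ccontr)
    assume "\<not> ?thesis"
    then obtain s t where st: "s \<in> I" "h s \<le> 0" "t \<in> I" "0 \<le> h t" by (meson linorder_not_less)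
    have "connected (h ` I)"
      by (intro connected_continuous_image is_interval_connected that(1) continuous_on_subset[OF cont]) auto
    then have "0 \<in> h ` I" using st connectedD_interval[of "h ` I" "h s" "h t" 0] by blast
    then show False using that(2) by auto
  qed
  obtain x y where xy: "x \<in> frontier \<Omega>" "x \<bullet> dir (fst \<omega>) < snd \<omega>" "y \<in> frontier \<Omega>" "snd \<omega> < y \<bullet> dir (fst \<omega>)"
    using frontier_both_sides[OF hit] .
  obtain s where s: "s \<in> {0..<1}" "x = curve s" using xy(1) unfolding curve_image[symmetric] by blast
  obtain t where t: "t \<in> {0..<1}" "y = curve t" using xy(3) unfolding curve_image[symmetric] by blast
  have hs: "h s < 0" and ht: "0 < h t" using xy s t by (auto simp: h_def)
  have cases: "u \<in> {\<alpha><..<\<beta>} \<or> u \<in> {\<beta><..<\<alpha>+1} \<or> u + 1 \<in> {\<beta><..<\<alpha>+1}" if "u \<in> {0..<1}" "h u \<noteq> 0" for u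
    using that zero[of u] ab by auto
  \<comment> \<open>Each arc has a constant sign. The boundary has points on both sides of the line,
    so the two signs differ.\<close>
  have "(\<forall>u\<in>{\<alpha><..<\<beta>}. 0 < h u) \<and> (\<forall>u\<in>{\<beta><..<\<alpha>+1}. h u < 0) \<or>
        (\<forall>u\<in>{\<alpha><..<\<beta>}. h u < 0) \<and> (\<forall>u\<in>{\<beta><..<\<alpha>+1}. 0 < h u)"
    using const_sign[of "{\<alpha><..<\<beta>}"] const_sign[of "{\<beta><..<\<alpha>+1}"] nz1 nz2 cases[OF s(1)] cases[OF t(1)] hs ht per[of s] per[of t]
    by (smt (verit, ccfv_threshold) is_interval_oo)
  moreover have "h \<alpha> = 0" "h \<beta> = 0" "h (\<alpha> + 1) = 0" using zero[of \<alpha>] zero[of \<beta>] per[of \<alpha>] ab by auto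
  \<comment> \<open>The sign \<open>\<sigma>\<close> orients the line so that the first arc is on
    the nonnegative side, which merges the two cases.\<close>
  ultimately obtain \<sigma> :: real where sg: "\<sigma> = 1 \<or> \<sigma> = -1"
      "\<And>u. u \<in> {\<alpha>..\<beta>} \<Longrightarrow> 0 \<le> \<sigma> * h u" "\<And>u. u \<in> {\<beta>..\<alpha>+1} \<Longrightarrow> \<sigma> * h u \<le> 0"
  proof (elim disjE)
    assume *: "(\<forall>u\<in>{\<alpha><..<\<beta>}. 0 < h u) \<and> (\<forall>u\<in>{\<beta><..<\<alpha>+1}. h u < 0)"
    show ?thesis
      by (rule that[of 1]) (use * \<open>h \<alpha> = 0\<close> \<open>h \<beta> = 0\<close> \<open>h (\<alpha> + 1) = 0\<close> in \<open>force simp: less_eq_real_def\<close>)+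
  next
    assume *: "(\<forall>u\<in>{\<alpha><..<\<beta>}. h u < 0) \<and> (\<forall>u\<in>{\<beta><..<\<alpha>+1}. 0 < h u)"
    show ?thesis
      by (rule that[of "-1"]) (use * \<open>h \<alpha> = 0\<close> \<open>h \<beta> = 0\<close> \<open>h (\<alpha> + 1) = 0\<close> in \<open>force simp: less_eq_real_def\<close>)+
  qed
  have seg: "snd \<omega> \<in> closed_segment (curve c \<bullet> dir (fst \<omega>)) (curve d \<bullet> dir (fst \<omega>))"
    if "\<sigma> * h c * (\<sigma> * h d) \<le> 0" for c d
  proof -
    have "h c * h d \<le> 0" using that sg(1) by auto
    then have "h c \<le> 0 \<and> 0 \<le> h d \<or> 0 \<le> h c \<and> h d \<le> 0" by (auto simp: mult_le_0_iff)
    then show ?thesis by (auto simp: h_def closed_segment_eq_real_ivl)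
  qed
  have "\<forall>\<^sub>F n in sequentially. cell_index n \<alpha> \<noteq> cell_index n \<beta>"
    using ab by (intro eventually_cell_index_neq) auto
  then show ?thesis
  proof eventually_elim
    case (elim n)
    define i where "i = cell_index n \<alpha>"
    define j where "j = cell_index n \<beta>"
    have ij: "\<alpha> \<in> cell n i" "\<beta> \<in> cell n j" "i < 2^n" "j < 2^n" "i \<noteq> j"
      using ab mem_cell cell_index_less elim by (auto simp: i_def j_def)
    then have ic: "real i / 2^n \<le> \<alpha>" "\<alpha> < real (Suc i) / 2^n" and jc: "real j / 2^n \<le> \<beta>" "\<beta> < real (Suc j) / 2^n"
      by (auto simp: cell_bounds)
    have "real i / 2^n < real (Suc j) / 2^n" using ic jc ab by linarith
    then have "i < Suc j" by (simp add: divide_less_cancel)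
    \<comment> \<open>The cell of \<open>\<alpha>\<close> thus ends no later than the cell of
      \<open>\<beta>\<close> begins: the right end of the one and the left end of the other belong
      to the first arc, the outer ends to the second.\<close>
    then have "Suc i \<le> j" using ij by simp
    then have sij: "real (Suc i) / 2^n \<le> real j / 2^n" by (intro divide_right_mono) auto
    have "real (Suc j) \<le> 2^n" using ij(4) by (metis Suc_leI of_nat_le_iff of_nat_numeral of_nat_power)
    then have j1: "real (Suc j) / 2^n \<le> 1" by simp
    have "0 \<le> \<sigma> * h (real (Suc i) / 2^n)" using ic jc sij by (intro sg) auto
    moreover have "\<sigma> * h (real i / 2^n) \<le> 0"
    proof -
      have "0 \<le> real i / 2^n" by simp
      \<comment> \<open>The left end of the cell does not exceed \<open>\<alpha>\<close>; adding a
        period moves it to the second arc.\<close>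
      then have "real i / 2^n + 1 \<in> {\<beta>..\<alpha>+1}" unfolding atLeastAtMost_iff using ic ab by linarith
      then have "\<sigma> * h (real i / 2^n + 1) \<le> 0" by (rule sg(3))
      then show ?thesis by (simp only: per)
    qed
    ultimately have 1: "snd \<omega> \<in> closed_segment (curve (real i / 2^n) \<bullet> dir (fst \<omega>)) (curve (real (Suc i) / 2^n) \<bullet> dir (fst \<omega>))"
      using seg mult_nonpos_nonneg by blast
    have "0 \<le> \<sigma> * h (real j / 2^n)" using ic jc sij by (intro sg) auto
    moreover have "real (Suc j) / 2^n \<in> {\<beta>..\<alpha>+1}" unfolding atLeastAtMost_iff using jc j1 ab by linarith
    then have "\<sigma> * h (real (Suc j) / 2^n) \<le> 0" by (rule sg(3))
    ultimately have 2: "snd \<omega> \<in> closed_segment (curve (real j / 2^n) \<bullet> dir (fst \<omega>)) (curve (real (Suc j) / 2^n) \<bullet> dir (fst \<omega>))"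
      using seg mult_nonneg_nonpos by blast
    let ?I = "\<lambda>i. indicator {\<omega>. snd \<omega> \<in>
      closed_segment (curve (real i / 2^n) \<bullet> dir (fst \<omega>)) (curve (real (Suc i) / 2^n) \<bullet> dir (fst \<omega>))} \<omega> :: ennreal"
    have "(2::ennreal) = (\<Sum>k\<in>{i, j}. ?I k)" using 1 2 ij(5) by simp
    also have "\<dots> \<le> (\<Sum>k<2^n. ?I k)" using ij by (intro sum_mono2) auto
    finally show ?case .
  qed
qed

text \<open>Each chord is at most as long as the arc over its cell, and these arcs are disjoint
  Borel sets, so that their measures add up.\<close>

lemma sum_chords_le: "(\<Sum>i<2^n. ennreal (dist (curve (real i / 2^n)) (curve (real (Suc i) / 2^n)))) \<le> hausdorff1 (frontier \<Omega>)"
proof -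
  have "(\<Sum>i<(2::nat)^n. ennreal (dist (curve (real i / 2^n)) (curve (real (Suc i) / 2^n))))
      \<le> (\<Sum>i<(2::nat)^n. hausdorff1 (curve ` cell n i))"
    unfolding cell_bounds
    by (intro sum_mono dist_le_hausdorff1_image continuous_curve divide_strict_right_mono) auto
  also have "\<dots> = hausdorff1 (\<Union>i<(2::nat)^n. curve ` cell n i)"
  proof (rule hausdorff1_sum)
    show "curve ` cell n i \<in> sets borel" for i
      unfolding cell_bounds
      by (intro borel_sigma_compact sigma_compact_image continuous_curve sigma_compact_atLeastLessThan)
    show "disjoint_family_on (\<lambda>i. curve ` cell n i) {..<2^n}"
    proof (unfold disjoint_family_on_def, intro ballI impI)
      fix i j :: nat assume ij: "i \<in> {..<2^n}" "j \<in> {..<2^n}" "i \<noteq> j"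
      have "cell n i \<subseteq> {0..<1}" "cell n j \<subseteq> {0..<1}" using ij cell_subset by auto
      moreover then have "cell n i \<inter> cell n j = {}"
        using ij(3) mem_cell by fastforce
      ultimately show "curve ` cell n i \<inter> curve ` cell n j = {}"
        using inj_on_image_Int[OF inj_on_curve, of "cell n i" "cell n j"] by simp
    qed
  qed
  also have "\<dots> \<le> hausdorff1 (frontier \<Omega>)"
    by (intro hausdorff1_mono) (use curve_in_frontier in auto)
  finally show ?thesis .
qed

text \<open>Every line through the body crosses two sides of each sufficiently fine inscribed
  polygon. The integrated number of crossed sides is four times the length of the polygon, and
  Fatou's lemma compares the two.\<close>

lemma measure_lines_hitting_le:
  "2 * (\<integral>\<^sup>+\<omega>. indicator (lines_hitting \<Omega>) \<omega> \<partial>line_params) \<le> 4 * hausdorff1 (frontier \<Omega>)"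
proof -
  define A where "A n i = {\<omega>. snd \<omega> \<in>
    closed_segment (curve (real i / 2^n) \<bullet> dir (fst \<omega>)) (curve (real (Suc i) / 2^n) \<bullet> dir (fst \<omega>))}" for n i :: nat
  have A[measurable]: "A n i \<in> sets borel" and intA: "(\<integral>\<^sup>+\<omega>. indicator (A n i) \<omega> \<partial>line_params)
      = ennreal (4 * dist (curve (real i / 2^n)) (curve (real (Suc i) / 2^n)))" for n i
    unfolding A_def by (rule nn_integral_separating_lines)+
  have [measurable]: "lines_hitting \<Omega> \<in> sets borel" by (rule borel_lines_hitting_body)
  have "2 * (\<integral>\<^sup>+\<omega>. indicator (lines_hitting \<Omega>) \<omega> \<partial>line_params) = (\<integral>\<^sup>+\<omega>. 2 * indicator (lines_hitting \<Omega>) \<omega> \<partial>line_params)"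
    by (rule nn_integral_cmult[symmetric]) measurable
  also have "\<dots> \<le> (\<integral>\<^sup>+\<omega>. liminf (\<lambda>n. \<Sum>i<2^n. indicator (A n i) \<omega>) \<partial>line_params)"
  proof (intro nn_integral_mono)
    fix \<omega>
    show "2 * indicator (lines_hitting \<Omega>) \<omega> \<le> liminf (\<lambda>n. \<Sum>i<2^n. indicator (A n i) \<omega> :: ennreal)"
      using chords_crossed[of \<omega>] unfolding A_def[symmetric]
      by (cases "\<omega> \<in> lines_hitting \<Omega>") (auto intro: Liminf_bounded)
  qed
  also have "\<dots> \<le> liminf (\<lambda>n. \<integral>\<^sup>+\<omega>. (\<Sum>i<2^n. indicator (A n i) \<omega>) \<partial>line_params)"
    by (intro nn_integral_liminf) measurable
  also have "\<dots> \<le> liminf (\<lambda>n. 4 * hausdorff1 (frontier \<Omega>))"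
  proof (intro Liminf_mono always_eventually allI)
    fix n
    have "(\<integral>\<^sup>+\<omega>. (\<Sum>i<(2::nat)^n. indicator (A n i) \<omega>) \<partial>line_params)
        = (\<Sum>i<(2::nat)^n. \<integral>\<^sup>+\<omega>. indicator (A n i) \<omega> \<partial>line_params)"
      by (intro nn_integral_sum) measurable
    also have "\<dots> = 4 * (\<Sum>i<(2::nat)^n. ennreal (dist (curve (real i / 2^n)) (curve (real (Suc i) / 2^n))))"
      unfolding intA by (simp add: sum_distrib_left ennreal_mult' del: sum_ennreal)
    also have "\<dots> \<le> 4 * hausdorff1 (frontier \<Omega>)"
      by (intro mult_left_mono sum_chords_le) simp
    finally show "(\<integral>\<^sup>+\<omega>. (\<Sum>i<(2::nat)^n. indicator (A n i) \<omega>) \<partial>line_params) \<le> 4 * hausdorff1 (frontier \<Omega>)" .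
  qed
  also have "\<dots> = 4 * hausdorff1 (frontier \<Omega>)" by (simp add: Liminf_const)
  finally show ?thesis .
qed

lemma hausdorff1_frontier: "hausdorff1 (frontier \<Omega>) = ennreal (perimeter \<Omega>)"
  using hausdorff1_curve_finite[of "{0..<1}"] by (simp add: perimeter_def curve_image top.not_eq_extremum)

lemma one_rectifiable_frontier: "one_rectifiable (frontier \<Omega>)"
  unfolding curve_image[symmetric] by (intro one_rectifiable_curve sigma_compact_atLeastLessThan)

lemma nn_integral_frontier:
  "(\<integral>\<^sup>+\<omega>. emeasure (count_space UNIV) (line_of \<omega> \<inter> frontier \<Omega>) \<partial>line_params)
    = 2 * (\<integral>\<^sup>+\<omega>. indicator (lines_hitting \<Omega>) \<omega> \<partial>line_params)"
proof -
  have [measurable]: "lines_hitting \<Omega> \<in> sets borel" by (rule borel_lines_hitting_body)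
  have "(\<integral>\<^sup>+\<omega>. emeasure (count_space UNIV) (line_of \<omega> \<inter> frontier \<Omega>) \<partial>line_params)
    = (\<integral>\<^sup>+\<omega>. 2 * indicator (lines_hitting \<Omega>) \<omega> \<partial>line_params)"
    by (intro nn_integral_cong_AE AE_crossing_count_frontier)
  also have "\<dots> = 2 * (\<integral>\<^sup>+\<omega>. indicator (lines_hitting \<Omega>) \<omega> \<partial>line_params)"
    by (rule nn_integral_cmult) measurable
  finally show ?thesis .
qed

lemma crofton_frontier:
  "(\<integral>\<^sup>+\<omega>. emeasure (count_space UNIV) (line_of \<omega> \<inter> frontier \<Omega>) \<partial>line_params) = 4 * hausdorff1 (frontier \<Omega>)"
proof (rule antisym)
  show "4 * hausdorff1 (frontier \<Omega>) \<le> (\<integral>\<^sup>+\<omega>. emeasure (count_space UNIV) (line_of \<omega> \<inter> frontier \<Omega>) \<partial>line_params)"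
    by (rule crofton_rectifiable_measurable_ge[OF one_rectifiable_frontier]) (simp add: hausdorff1_frontier)
qed (use measure_lines_hitting_le in \<open>simp add: nn_integral_frontier\<close>)

lemma measure_lines_hitting_body:
  "(\<integral>\<^sup>+\<omega>. indicator (lines_hitting \<Omega>) \<omega> \<partial>line_params) = ennreal (2 * perimeter \<Omega>)"
proof -
  have "2 * (\<integral>\<^sup>+\<omega>. indicator (lines_hitting \<Omega>) \<omega> \<partial>line_params) = 4 * ennreal (perimeter \<Omega>)"
    using crofton_frontier nn_integral_frontier by (simp add: hausdorff1_frontier)
  also have "\<dots> = 2 * ennreal (2 * perimeter \<Omega>)"
    by (simp add: ennreal_mult' perimeter_def mult.assoc[symmetric])
  finally show ?thesis by (simp add: ennreal_mult_cancel_left)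
qed

lemma perimeter_pos: "0 < perimeter \<Omega>"
proof -
  have "curve 0 \<noteq> curve (1/2)" using inj_onD[OF inj_on_curve, of 0 "1/2"] by auto
  then have "0 < ennreal (dist (curve 0) (curve (1/2)))" by simp
  also have "\<dots> \<le> hausdorff1 (curve ` {0..<1/2})"
    by (intro dist_le_hausdorff1_image continuous_curve) simp
  also have "\<dots> \<le> hausdorff1 (frontier \<Omega>)"
    by (intro hausdorff1_mono) (use curve_in_frontier in auto)
  finally show ?thesis by (simp add: hausdorff1_frontier)
qed

text \<open>The inequality \<open>\<ge>\<close> is available for the arc and for the rest of the
  boundary. Since together they attain equality, each of them does.\<close>

lemma crofton_arc:
  assumes ab: "0 \<le> a" "a \<le> b" "b \<le> 1"
  shows "(\<integral>\<^sup>+\<omega>. crossing_count curve {a..<b} \<omega> \<partial>line_params) = 4 * hausdorff1 (curve ` {a..<b})"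
proof -
  define S where "S = {a..<b}"
  define T where "T = {0..<a} \<union> {b..<1::real}"
  have ST: "S \<union> T = {0..<1}" "S \<inter> T = {}" "S \<subseteq> {0..<1}" "T \<subseteq> {0..<1}" using ab by (auto simp: S_def T_def)
  have sc: "sigma_compact S" "sigma_compact T"
    unfolding S_def T_def by (intro sigma_compact_Un sigma_compact_atLeastLessThan)+
  have ge: "4 * hausdorff1 (curve ` R) \<le> (\<integral>\<^sup>+\<omega>. crossing_count curve R \<omega> \<partial>line_params)"
    if "sigma_compact R" "R \<subseteq> {0..<1}" for R
    unfolding crossing_count_curve[OF that(2)]
    using that by (intro crofton_rectifiable_measurable_ge one_rectifiable_curve hausdorff1_curve_finite)
  have [measurable]: "crossing_count curve S \<in> borel_measurable borel" "crossing_count curve T \<in> borel_measurable borel"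
    using sc ST by (auto intro: borel_crossing_count_curve)
  have "(\<integral>\<^sup>+\<omega>. crossing_count curve S \<omega> \<partial>line_params) + (\<integral>\<^sup>+\<omega>. crossing_count curve T \<omega> \<partial>line_params)
      = (\<integral>\<^sup>+\<omega>. crossing_count curve S \<omega> + crossing_count curve T \<omega> \<partial>line_params)"
    by (rule nn_integral_add[symmetric]) measurable
  also have "\<dots> = (\<integral>\<^sup>+\<omega>. crossing_count curve {0..<1} \<omega> \<partial>line_params)"
  proof (intro nn_integral_cong)
    fix \<omega>
    have "{t \<in> {0..<1}. curve t \<in> line_of \<omega>} = {t \<in> S. curve t \<in> line_of \<omega>} \<union> {t \<in> T. curve t \<in> line_of \<omega>}"
      using ST(1) by blast
    then show "crossing_count curve S \<omega> + crossing_count curve T \<omega> = crossing_count curve {0..<1} \<omega>"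
      unfolding crossing_count_def using ST(2) by (simp only:) (rule plus_emeasure, auto)
  qed
  also have "\<dots> = 4 * hausdorff1 (frontier \<Omega>)"
    using crofton_frontier by (simp add: crossing_count_curve curve_image)
  also have "\<dots> \<le> 4 * (hausdorff1 (curve ` S) + hausdorff1 (curve ` T))"
    unfolding curve_image[symmetric] ST(1)[symmetric] image_Un by (intro mult_left_mono hausdorff1_Un) simp
  also have "\<dots> \<le> 4 * hausdorff1 (curve ` S) + (\<integral>\<^sup>+\<omega>. crossing_count curve T \<omega> \<partial>line_params)"
    unfolding distrib_left by (intro add_left_mono ge sc ST)
  finally have le: "(\<integral>\<^sup>+\<omega>. crossing_count curve S \<omega> \<partial>line_params) + (\<integral>\<^sup>+\<omega>. crossing_count curve T \<omega> \<partial>line_params)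
     \<le> 4 * hausdorff1 (curve ` S) + (\<integral>\<^sup>+\<omega>. crossing_count curve T \<omega> \<partial>line_params)" .
  \<comment> \<open>The contribution of the rest of the boundary has to be finite to be
    cancelled.\<close>
  obtain C where C: "C-lipschitz_on UNIV curve" using curve_lipschitz by blast
  have "(\<integral>\<^sup>+\<omega>. crossing_count curve T \<omega> \<partial>line_params) \<le> (\<integral>\<^sup>+\<omega>. crossing_count curve {0..<1} \<omega> \<partial>line_params)"
    using ST unfolding crossing_count_def by (intro nn_integral_mono emeasure_mono) auto
  also have "\<dots> < top" by (rule nn_integral_crossing_count_finite[OF C])
  finally have "(\<integral>\<^sup>+\<omega>. crossing_count curve S \<omega> \<partial>line_params) \<le> 4 * hausdorff1 (curve ` S)"
    using le by (auto simp: add.commute[of _ "\<integral>\<^sup>+\<omega>. crossing_count curve T \<omega> \<partial>line_params"] ennreal_add_left_cancel_le)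
  then show ?thesis
    using ge[OF sc(1) ST(3)] unfolding S_def by (rule antisym)
qed

end

section \<open>The lower bound\<close>

text \<open>For a natural number \<open>c\<close> this is
  \<open>(c - k) * (c - k - 1) \<ge> 0\<close>, with the terms arranged so that no subtraction of
  extended reals occurs; an infinite count makes the right side infinite.\<close>

lemma consecutive_square_bound:
  fixes c :: ennreal
  assumes "c \<in> range of_nat \<union> {top}"
  shows "of_nat (2 * k + 1) * c \<le> c\<^sup>2 + of_nat (k * (k + 1))"
proof (cases "c = top")
  case False
  then obtain m where m: "c = of_nat m" using assms by auto
  have "0 \<le> (int m - int k) * (int m - int k - 1)"
    by (cases "m \<le> k") (auto intro: mult_nonpos_nonpos mult_nonneg_nonneg)
  then have "int ((2 * k + 1) * m) \<le> int (m\<^sup>2 + k * (k + 1))"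
    by (simp add: algebra_simps power2_eq_square)
  then have "(2 * k + 1) * m \<le> m\<^sup>2 + k * (k + 1)" by (simp only: of_nat_le_iff)
  then have "(of_nat ((2 * k + 1) * m) :: ennreal) \<le> of_nat (m\<^sup>2 + k * (k + 1))" by (simp only: of_nat_le_iff)
  then show ?thesis by (simp only: m of_nat_mult of_nat_add of_nat_power)
qed (simp add: power2_eq_square ennreal_top_mult)

lemma sum_count_range: "(\<Sum>i<(n::nat). emeasure (count_space UNIV) (A i)) \<in> range of_nat \<union> {top :: ennreal}"
proof (cases "\<forall>i<n. finite (A i)")
  case True
  then have "(\<Sum>i<n. emeasure (count_space UNIV) (A i)) = of_nat (\<Sum>i<n. card (A i))" by simp
  then show ?thesis by blast
next
  case False
  then obtain i where "i < n" "infinite (A i)" by blast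
  then have "emeasure (count_space UNIV) (A i) = top" by simp
  moreover have "emeasure (count_space UNIV) (A i) \<le> (\<Sum>i<n. emeasure (count_space UNIV) (A i))"
    using \<open>i < n\<close> by (intro member_le_sum) auto
  ultimately have "(\<Sum>i<n. emeasure (count_space UNIV) (A i)) = top" by (simp add: top_unique)
  then show ?thesis by simp
qed

context planar_convex_body
begin

text \<open>\<open>consecutive_square_bound\<close> is integrated over the lines and divided by 4:
  Crofton's inequality bounds the linear term from below by \<open>(2 * k + 1) * (4 * L)\<close> up
  to an error, and the constant term contributes \<open>k * (k + 1)\<close> times the measure
  \<open>2 * P\<close>.\<close>

lemma energy_lower_bound:
  assumes adm: "admissible \<Omega> \<Gamma>s" and len: "total_length \<Gamma>s = ennreal L" and L: "0 \<le> L"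
  shows "ennreal ((2 * real k + 1) * L) \<le> energy \<Gamma>s + ennreal (real k * (real k + 1) * perimeter \<Omega> / 2)"
proof (cases "energy \<Gamma>s")
  case (real E)
  note E = real
  define n where "n = length \<Gamma>s"
  define P where "P = perimeter \<Omega>"
  have P: "0 < P" unfolding P_def by (rule perimeter_pos)
  have "(2 * real k + 1) * L \<le> E + real k * (real k + 1) * P / 2"
  proof (rule field_le_epsilon)
    fix \<epsilon> :: real assume \<epsilon>: "0 < \<epsilon>"
    \<comment> \<open>One error \<open>e\<close> for each of the \<open>n\<close> sets, multiplied
      by \<open>2 * k + 1\<close>, amounts to at most \<open>4 * \<epsilon>\<close>. The
      \<open>n + 1\<close> covers the empty family.\<close>
    define e where "e = 4 * \<epsilon> / ((2 * real k + 1) * (real n + 1))"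
    have e: "0 < e" using \<epsilon> by (simp add: e_def)
    have "\<forall>i<n. \<exists>D. D \<subseteq> \<Gamma>s ! i \<and> (\<lambda>\<omega>. emeasure (count_space UNIV) (line_of \<omega> \<inter> D)) \<in> borel_measurable borel \<and>
      4 * hausdorff1 (\<Gamma>s ! i) \<le> (\<integral>\<^sup>+\<omega>. emeasure (count_space UNIV) (line_of \<omega> \<inter> D) \<partial>line_params) + ennreal e"
    proof (intro allI impI)
      fix i assume "i < n"
      then have "one_rectifiable (\<Gamma>s ! i)" "hausdorff1 (\<Gamma>s ! i) < top"
        using adm by (auto simp: admissible_def n_def)
      from crofton_rectifiable_ge[OF this e] show "\<exists>D. D \<subseteq> \<Gamma>s ! i \<and> (\<lambda>\<omega>. emeasure (count_space UNIV) (line_of \<omega> \<inter> D)) \<in> borel_measurable borel \<and>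
      4 * hausdorff1 (\<Gamma>s ! i) \<le> (\<integral>\<^sup>+\<omega>. emeasure (count_space UNIV) (line_of \<omega> \<inter> D) \<partial>line_params) + ennreal e"
        by metis
    qed
    then obtain D where D: "\<And>i. i < n \<Longrightarrow> D i \<subseteq> \<Gamma>s ! i"
      "\<And>i. i < n \<Longrightarrow> (\<lambda>\<omega>. emeasure (count_space UNIV) (line_of \<omega> \<inter> D i)) \<in> borel_measurable borel"
      "\<And>i. i < n \<Longrightarrow> 4 * hausdorff1 (\<Gamma>s ! i) \<le> (\<integral>\<^sup>+\<omega>. emeasure (count_space UNIV) (line_of \<omega> \<inter> D i) \<partial>line_params) + ennreal e"
      by metis
    \<comment> \<open>A Borel minorant of the crossing number that is still a natural number or
      infinite. Its square is compared with the energy by monotonicity alone.\<close>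
    define H where "H l = (\<Sum>i<n. emeasure (count_space UNIV) (l \<inter> D i))" for l
    have Hm[measurable]: "(\<lambda>\<omega>. H (line_of \<omega>)) \<in> borel_measurable borel"
      unfolding H_def by (intro borel_measurable_sum D(2)) auto
    have Hle: "H l \<le> crossings l \<Gamma>s" for l
    proof -
      have "H l \<le> (\<Sum>i<n. emeasure (count_space UNIV) (l \<inter> \<Gamma>s ! i))"
        unfolding H_def using D(1) by (intro sum_mono emeasure_mono) auto
      also have "\<dots> = crossings l \<Gamma>s"
        unfolding crossings_def n_def by (simp add: sum_list_sum_nth atLeast0LessThan)
      finally show ?thesis .
    qed
    have sq: "(\<integral>\<^sup>+\<omega>. (H (line_of \<omega>))\<^sup>2 \<partial>line_params) \<le> ennreal (4 * E)"
    proof -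
      have "(\<integral>\<^sup>+\<omega>. (H (line_of \<omega>))\<^sup>2 \<partial>line_params) = (\<integral>\<^sup>+l. (H l)\<^sup>2 \<partial>kinematic_measure)"
        by (rule nn_integral_kinematic[symmetric], rule borel_measurable_line_params) measurable
      also have "\<dots> \<le> (\<integral>\<^sup>+l. (crossings l \<Gamma>s)\<^sup>2 \<partial>kinematic_measure)"
        using Hle by (intro nn_integral_mono power_mono) auto
      also have "\<dots> = 4 * energy \<Gamma>s"
        unfolding energy_def by (simp add: ennreal_times_divide mult.commute[of 4] mult_divide_eq_ennreal)
      also have "\<dots> = ennreal (4 * E)" using E by (simp add: ennreal_mult')
      finally show ?thesis .
    qed
    then obtain Q where Q: "(\<integral>\<^sup>+\<omega>. (H (line_of \<omega>))\<^sup>2 \<partial>line_params) = ennreal Q" "0 \<le> Q" "Q \<le> 4 * E"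
      using E by (cases "\<integral>\<^sup>+\<omega>. (H (line_of \<omega>))\<^sup>2 \<partial>line_params") (auto simp: top_unique)
    \<comment> \<open>The sets of the family lie in the closure. Only lines hitting the closure need
      the constant term, since on all others \<open>H\<close> vanishes.\<close>
    have W[measurable]: "lines_hitting (closure \<Omega>) \<in> sets borel" by (rule borel_lines_hitting_closure)
    have muW: "(\<integral>\<^sup>+\<omega>. indicator (lines_hitting (closure \<Omega>)) \<omega> \<partial>line_params) = ennreal (2 * P)"
    proof -
      have "(\<integral>\<^sup>+\<omega>. indicator (lines_hitting (closure \<Omega>)) \<omega> \<partial>line_params)
        = (\<integral>\<^sup>+\<omega>. indicator (lines_hitting \<Omega>) \<omega> \<partial>line_params)"
        using AE_lines_hitting_closure by (intro nn_integral_cong_AE) (auto simp: indicator_def elim!: eventually_mono)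
      then show ?thesis by (simp add: measure_lines_hitting_body P_def)
    qed
    have "of_nat (2 * k + 1) * (\<integral>\<^sup>+\<omega>. H (line_of \<omega>) \<partial>line_params)
        = (\<integral>\<^sup>+\<omega>. of_nat (2 * k + 1) * H (line_of \<omega>) \<partial>line_params)"
      by (rule nn_integral_cmult[symmetric], rule borel_measurable_line_params) measurable
    also have "\<dots> \<le> (\<integral>\<^sup>+\<omega>. (H (line_of \<omega>))\<^sup>2 + of_nat (k * (k + 1)) * indicator (lines_hitting (closure \<Omega>)) \<omega> \<partial>line_params)"
    proof (intro nn_integral_mono)
      fix \<omega>
      show "of_nat (2 * k + 1) * H (line_of \<omega>)
        \<le> (H (line_of \<omega>))\<^sup>2 + of_nat (k * (k + 1)) * indicator (lines_hitting (closure \<Omega>)) \<omega>"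
      proof (cases "\<omega> \<in> lines_hitting (closure \<Omega>)")
        case True
        have "H (line_of \<omega>) \<in> range of_nat \<union> {top}" unfolding H_def by (rule sum_count_range)
        from consecutive_square_bound[OF this] show ?thesis using True by simp
      next
        case False
        have "line_of \<omega> \<inter> D i = {}" if "i < n" for i
        proof -
          have "\<Gamma>s ! i \<subseteq> closure \<Omega>" using adm that by (auto simp: admissible_def n_def)
          then show ?thesis using D(1)[OF that] False by (auto simp: lines_hitting_def)
        qed
        then have "H (line_of \<omega>) = 0" by (simp add: H_def)
        then show ?thesis by simp
      qed
    qed
    also have "\<dots> = (\<integral>\<^sup>+\<omega>. (H (line_of \<omega>))\<^sup>2 \<partial>line_params) + of_nat (k * (k + 1)) * (\<integral>\<^sup>+\<omega>. indicator (lines_hitting (closure \<Omega>)) \<omega> \<partial>line_params)"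
      by (subst nn_integral_add, measurable, subst nn_integral_cmult, measurable)
    also have "\<dots> = ennreal (Q + real (k * (k + 1)) * (2 * P))"
      unfolding Q(1) muW using Q(2) P by (simp add: ennreal_of_nat_eq_real_of_nat ennreal_mult[symmetric] del: of_nat_mult of_nat_add)
    finally have int: "of_nat (2 * k + 1) * (\<integral>\<^sup>+\<omega>. H (line_of \<omega>) \<partial>line_params) \<le> ennreal (Q + real (k * (k + 1)) * (2 * P))" .
    obtain h where h: "(\<integral>\<^sup>+\<omega>. H (line_of \<omega>) \<partial>line_params) = ennreal h" "0 \<le> h"
      using int by (cases "\<integral>\<^sup>+\<omega>. H (line_of \<omega>) \<partial>line_params") (auto simp: ennreal_mult_top top_unique)
    have i1: "real (2 * k + 1) * h \<le> Q + real (k * (k + 1)) * (2 * P)"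
    proof -
      have "ennreal (real (2 * k + 1) * h) = of_nat (2 * k + 1) * ennreal h"
        by (simp only: ennreal_mult'' ennreal_of_nat_eq_real_of_nat h(2))
      also have "\<dots> \<le> ennreal (Q + real (k * (k + 1)) * (2 * P))" using int h(1) by simp
      finally show ?thesis using Q(2) P by (subst (asm) ennreal_le_iff) auto
    qed
    have "ennreal (4 * L) = (\<Sum>i<n. 4 * hausdorff1 (\<Gamma>s ! i))"
    proof -
      have "ennreal (4 * L) = 4 * total_length \<Gamma>s" by (simp add: len ennreal_mult')
      also have "total_length \<Gamma>s = (\<Sum>i<n. hausdorff1 (\<Gamma>s ! i))"
        unfolding total_length_def n_def by (simp add: sum_list_sum_nth atLeast0LessThan)
      finally show ?thesis by (simp add: sum_distrib_left)
    qed
    also have "\<dots> \<le> (\<Sum>i<n. (\<integral>\<^sup>+\<omega>. emeasure (count_space UNIV) (line_of \<omega> \<inter> D i) \<partial>line_params) + ennreal e)"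
      by (intro sum_mono D(3)) auto
    also have "\<dots> = (\<integral>\<^sup>+\<omega>. H (line_of \<omega>) \<partial>line_params) + ennreal (real n * e)"
    proof -
      have "(\<integral>\<^sup>+\<omega>. H (line_of \<omega>) \<partial>line_params) = (\<Sum>i<n. \<integral>\<^sup>+\<omega>. emeasure (count_space UNIV) (line_of \<omega> \<inter> D i) \<partial>line_params)"
        unfolding H_def by (intro nn_integral_sum borel_measurable_line_params D(2)) auto
      then show ?thesis using e
        by (simp add: sum.distrib ennreal_of_nat_eq_real_of_nat ennreal_mult[symmetric])
    qed
    also have "\<dots> = ennreal (h + real n * e)" using h e by simp
    finally have i2: "4 * L \<le> h + real n * e" using h e by (subst (asm) ennreal_le_iff) auto
    have "(2 * real k + 1) * (4 * L) \<le> (2 * real k + 1) * (h + real n * e)"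
      by (intro mult_left_mono i2) simp
    also have "\<dots> = real (2 * k + 1) * h + (2 * real k + 1) * (real n * e)" by (simp add: algebra_simps)
    also have "(2 * real k + 1) * (real n * e) \<le> 4 * \<epsilon>"
    proof -
      have "(2 * real k + 1) * (real n * e) = 4 * \<epsilon> * (real n / (real n + 1))"
        by (simp add: e_def)
      also have "\<dots> \<le> 4 * \<epsilon> * 1" using \<epsilon> by (intro mult_left_mono) auto
      finally show ?thesis by simp
    qed
    finally have "(2 * real k + 1) * (4 * L) \<le> real (2 * k + 1) * h + 4 * \<epsilon>" by simp
    then show "(2 * real k + 1) * L \<le> E + real k * (real k + 1) * P / 2 + \<epsilon>"
    proof -
      have "real (k * (k + 1)) * (2 * P) = 2 * (real k * (real k + 1) * P)"
        "(2 * real k + 1) * (4 * L) = 4 * ((2 * real k + 1) * L)" by (simp_all add: distrib_left)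
      then show ?thesis
        using i1 Q(3) \<open>(2 * real k + 1) * (4 * L) \<le> real (2 * k + 1) * h + 4 * \<epsilon>\<close> by linarith
    qed
  qed
  then show ?thesis using E P by (simp add: P_def ennreal_plus[symmetric] ennreal_leI del: ennreal_plus)
qed simp

lemma min_energy_lower_bound:
  assumes L: "0 \<le> L"
  shows "ennreal ((2 * real k + 1) * L) \<le> min_energy \<Omega> L + ennreal (real k * (real k + 1) * perimeter \<Omega> / 2)"
proof (cases "min_energy \<Omega> L = top")
  case False
  show ?thesis
  proof (rule ennreal_le_epsilon)
    fix e :: real assume e: "0 < e"
    have "min_energy \<Omega> L < min_energy \<Omega> L + ennreal e"
      using False e by (cases "min_energy \<Omega> L") (auto simp: ennreal_plus[symmetric] ennreal_less_iff simp del: ennreal_plus)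
    then obtain \<Gamma>s where \<Gamma>s: "admissible \<Omega> \<Gamma>s" "total_length \<Gamma>s = ennreal L" "energy \<Gamma>s < min_energy \<Omega> L + ennreal e"
      unfolding min_energy_def INF_less_iff by blast
    have "ennreal ((2 * real k + 1) * L) \<le> energy \<Gamma>s + ennreal (real k * (real k + 1) * perimeter \<Omega> / 2)"
      by (rule energy_lower_bound[OF \<Gamma>s(1,2) L])
    also have "\<dots> \<le> min_energy \<Omega> L + ennreal e + ennreal (real k * (real k + 1) * perimeter \<Omega> / 2)"
      using \<Gamma>s(3) by (intro add_right_mono) simp
    finally show "ennreal ((2 * real k + 1) * L) \<le> min_energy \<Omega> L + ennreal (real k * (real k + 1) * perimeter \<Omega> / 2) + ennreal e"
      by (simp add: ac_simps)
  qed
qed simp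

lemma excess_ge:
  assumes L: "0 \<le> L"
  shows "ereal ((2 * real k + 1) * L - real k * (real k + 1) * perimeter \<Omega> / 2 - 2 * L\<^sup>2 / perimeter \<Omega>) \<le> excess \<Omega> L"
proof (cases "min_energy \<Omega> L")
  case (real m)
  have "(2 * real k + 1) * L \<le> m + real k * (real k + 1) * perimeter \<Omega> / 2"
    using min_energy_lower_bound[OF L, of k] real perimeter_pos
    by (simp add: ennreal_plus[symmetric] del: ennreal_plus)
  then show ?thesis using real by (simp add: excess_def enn2ereal_ennreal)
qed (simp add: excess_def)

text \<open>With \<open>x = 2 * L / P\<close>, both sides are
  \<open>P / 2 * (x - k) * (k + 1 - x)\<close>.\<close>

lemma frac_excess_eq:
  assumes "real_of_int \<lfloor>2 * L / perimeter \<Omega>\<rfloor> = real k"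
  shows "perimeter \<Omega> / 2 * frac (2 * L / perimeter \<Omega>) * (1 - frac (2 * L / perimeter \<Omega>))
    = (2 * real k + 1) * L - real k * (real k + 1) * perimeter \<Omega> / 2 - 2 * L\<^sup>2 / perimeter \<Omega>"
  using perimeter_pos assms by (simp add: frac_def field_simps power2_eq_square)

lemma excess_lower_bound:
  assumes L: "0 \<le> L"
  shows "ereal (perimeter \<Omega> / 2 * frac (2 * L / perimeter \<Omega>) * (1 - frac (2 * L / perimeter \<Omega>))) \<le> excess \<Omega> L"
proof -
  have "0 \<le> 2 * L / perimeter \<Omega>" using L perimeter_pos by simp
  then have "real_of_int \<lfloor>2 * L / perimeter \<Omega>\<rfloor> = real (nat \<lfloor>2 * L / perimeter \<Omega>\<rfloor>)" by simp
  from frac_excess_eq[OF this] show ?thesis using excess_ge[OF L] by metis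
qed

end

section \<open>The sharp case\<close>

lemma closed_segment_affine_image:
  fixes a b :: "'a::real_vector"
  shows "closed_segment a b = (\<lambda>t. a + t *\<^sub>R (b - a)) ` {0..1}"
  unfolding closed_segment_image_interval by (simp add: algebra_simps)

lemma hausdorff1_closed_segment:
  fixes a b :: "'a::real_inner"
  shows "hausdorff1 (closed_segment a b) = ennreal (dist a b)"
proof (cases "a = b")
  case False
  define f where "f t = a + t *\<^sub>R (b - a)" for t
  have d: "0 < dist a b" using False by simp
  have lip: "(dist a b)-lipschitz_on UNIV f"
    by (rule lipschitz_onI) (auto simp: f_def dist_norm norm_minus_commute scaleR_diff_left[symmetric])
  have img: "closed_segment a b = f ` {0..1}"
    by (simp add: f_def closed_segment_affine_image)
  show ?thesis
  proof (rule antisym)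
    have "hausdorff1 (closed_segment a b) \<le> ennreal (dist a b) * hausdorff1 {0..1::real}"
      unfolding img by (intro hausdorff1_lipschitz_image lipschitz_on_subset[OF lip] d) auto
    also have "\<dots> \<le> ennreal (dist a b) * ennreal (1 - 0)"
      by (intro mult_left_mono hausdorff1_atLeastAtMost) auto
    finally show "hausdorff1 (closed_segment a b) \<le> ennreal (dist a b)" by simp
    have "ennreal (dist (f 0) (f 1)) \<le> hausdorff1 (f ` {0..<1})"
      by (intro dist_le_hausdorff1_image lipschitz_on_continuous_on[OF lip]) auto
    also have "\<dots> \<le> hausdorff1 (closed_segment a b)"
      unfolding img by (intro hausdorff1_mono image_mono) auto
    finally show "ennreal (dist a b) \<le> hausdorff1 (closed_segment a b)" by (simp add: f_def)
  qed
qed simp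

lemma one_rectifiable_closed_segment:
  fixes a b :: "'a::real_inner"
  shows "one_rectifiable (closed_segment a b)"
proof -
  define f where "f t = a + t *\<^sub>R (b - a)" for t
  have lip: "(dist a b)-lipschitz_on UNIV f"
    by (rule lipschitz_onI) (auto simp: f_def dist_norm norm_minus_commute scaleR_diff_left[symmetric])
  have "closed_segment a b = f ` {0..1}"
    by (simp add: f_def closed_segment_affine_image)
  then show ?thesis
    using one_rectifiable_lipschitz_image[OF lip compact_imp_sigma_compact[OF compact_Icc]] by simp
qed

lemma count_line_singleton:
  "emeasure (count_space UNIV) (line_of \<omega> \<inter> {b}) = indicator {\<omega>. snd \<omega> = b \<bullet> dir (fst \<omega>)} \<omega>"
  by (cases "b \<in> line_of \<omega>") (auto simp: mem_line_of)

lemma borel_lines_through: "{\<omega>. snd \<omega> = b \<bullet> dir (fst \<omega>)} \<in> sets borel"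
  by (intro borel_closed closed_Collect_eq continuous_intros)

text \<open>Crossing counts are known to be Borel over subsets of \<open>{0..<1}\<close>, so the
  endpoint \<open>b\<close> is split off and counted by an indicator. A degenerate segment consists
  of that endpoint only.\<close>

lemma borel_measurable_crossings_segment:
  "(\<lambda>\<omega>. emeasure (count_space UNIV) (line_of \<omega> \<inter> closed_segment a b)) \<in> borel_measurable borel"
proof (cases "a = b")
  case True
  then show ?thesis
    using borel_lines_through[of b] unfolding True closed_segment_idem count_line_singleton by measurable
next
  case False
  define f where "f t = a + t *\<^sub>R (b - a)" for t
  have cont: "continuous_on UNIV f" unfolding f_def by (intro continuous_intros)
  have inj: "inj f" using False by (auto simp: f_def inj_def)
  have img: "closed_segment a b = f ` {0..1}"
    by (simp add: f_def closed_segment_affine_image)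
  have "{0..1} = {0..<1} \<union> {1::real}" by auto
  then have seg: "closed_segment a b = f ` {0..<1} \<union> {b}" unfolding img by (simp add: f_def)
  have "b = f 1" by (simp add: f_def)
  then have "b \<notin> f ` {0..<1}" using injD[OF inj] by fastforce
  have "emeasure (count_space UNIV) (line_of \<omega> \<inter> closed_segment a b)
    = crossing_count f {0..<1} \<omega> + indicator {\<omega>. snd \<omega> = b \<bullet> dir (fst \<omega>)} \<omega>" for \<omega>
  proof -
    have "emeasure (count_space UNIV) (line_of \<omega> \<inter> closed_segment a b)
       = emeasure (count_space UNIV) (line_of \<omega> \<inter> f ` {0..<1}) + emeasure (count_space UNIV) (line_of \<omega> \<inter> {b})"
      unfolding seg Int_Un_distrib
      by (rule plus_emeasure[symmetric]) (use \<open>b \<notin> f ` {0..<1}\<close> in auto)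
    then show ?thesis
      by (simp only: count_line_singleton crossing_count_inj[OF inj_on_subset[OF inj subset_UNIV]])
  qed
  moreover have [measurable]: "crossing_count f {0..<1} \<in> borel_measurable borel"
    by (intro borel_measurable_crossing_count cont sigma_compact_atLeastLessThan) auto
  ultimately show ?thesis using borel_lines_through[of b] by simp
qed

text \<open>A line meeting a proper segment more than once contains it and so passes through
  \<open>a\<close>. The lines through \<open>a\<close> form a null set, and every other line crosses
  the segment at most once.\<close>

lemma AE_crossings_segment:
  fixes a b :: "real^2"
  shows "AE \<omega> in line_params. emeasure (count_space UNIV) (line_of \<omega> \<inter> closed_segment a b)
    = indicator {\<omega>. snd \<omega> \<in> closed_segment (a \<bullet> dir (fst \<omega>)) (b \<bullet> dir (fst \<omega>))} \<omega>"
proof -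
  have "AE \<omega> in line_params. \<omega> \<notin> {\<omega>. snd \<omega> = a \<bullet> dir (fst \<omega>)}"
    by (rule AE_line_params[OF borel_lines_through]) simp
  then show ?thesis
  proof (rule AE_mp, intro AE_I2 impI)
    fix \<omega> assume "\<omega> \<notin> {\<omega>. snd \<omega> = a \<bullet> dir (fst \<omega>)}"
    then have ne: "a \<bullet> dir (fst \<omega>) \<noteq> snd \<omega>" by auto
    define h where "h t = (1 - t) * (a \<bullet> dir (fst \<omega>)) + t * (b \<bullet> dir (fst \<omega>))" for t
    have on: "(1 - t) *\<^sub>R a + t *\<^sub>R b \<in> line_of \<omega> \<longleftrightarrow> h t = snd \<omega>" for t
      by (simp add: mem_line_of h_def inner_add_left)
    have cs: "snd \<omega> \<in> closed_segment (a \<bullet> dir (fst \<omega>)) (b \<bullet> dir (fst \<omega>)) \<longleftrightarrow> (\<exists>t\<in>{0..1}. h t = snd \<omega>)"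
    proof -
      have "closed_segment (a \<bullet> dir (fst \<omega>)) (b \<bullet> dir (fst \<omega>)) = h ` {0..1}"
        unfolding closed_segment_image_interval h_def by simp
      then show ?thesis by (simp add: image_iff eq_commute[of "snd \<omega>"])
    qed
    have uniq: "s = t" if "h s = snd \<omega>" "h t = snd \<omega>" for s t
    proof -
      have "(s - t) * (b \<bullet> dir (fst \<omega>) - a \<bullet> dir (fst \<omega>)) = 0" using that by (simp add: h_def algebra_simps)
      moreover have "b \<bullet> dir (fst \<omega>) \<noteq> a \<bullet> dir (fst \<omega>)" using that ne by (auto simp: h_def algebra_simps)
      ultimately show ?thesis by simp
    qed
    show "emeasure (count_space UNIV) (line_of \<omega> \<inter> closed_segment a b)
      = indicator {\<omega>. snd \<omega> \<in> closed_segment (a \<bullet> dir (fst \<omega>)) (b \<bullet> dir (fst \<omega>))} \<omega>"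
    proof (cases "\<exists>t\<in>{0..1}. h t = snd \<omega>")
      case True
      then obtain t where t: "0 \<le> t" "t \<le> 1" "h t = snd \<omega>" by auto
      have "line_of \<omega> \<inter> closed_segment a b = {(1 - t) *\<^sub>R a + t *\<^sub>R b}"
      proof (intro subset_antisym subsetI)
        fix x assume "x \<in> line_of \<omega> \<inter> closed_segment a b"
        then obtain s where "x = (1 - s) *\<^sub>R a + s *\<^sub>R b" "h s = snd \<omega>"
          using on by (auto simp: closed_segment_def)
        then show "x \<in> {(1 - t) *\<^sub>R a + t *\<^sub>R b}" using uniq t by auto
      next
        fix x assume "x \<in> {(1 - t) *\<^sub>R a + t *\<^sub>R b}"
        then show "x \<in> line_of \<omega> \<inter> closed_segment a b" using t on[of t] by (auto simp: closed_segment_def)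
      qed
      then show ?thesis using cs t by (auto simp: indicator_def)
    next
      case False
      have "line_of \<omega> \<inter> closed_segment a b = {}"
        using False on by (auto simp: closed_segment_def)
      moreover have "snd \<omega> \<notin> closed_segment (a \<bullet> dir (fst \<omega>)) (b \<bullet> dir (fst \<omega>))" using cs False by simp
      ultimately show ?thesis by simp
    qed
  qed
qed

context planar_convex_body
begin

lemma borel_measurable_crossings_frontier:
  "(\<lambda>\<omega>. emeasure (count_space UNIV) (line_of \<omega> \<inter> frontier \<Omega>)) \<in> borel_measurable borel"
  using borel_crossing_count_curve[OF sigma_compact_atLeastLessThan[of 0 1]]
  by (simp add: crossing_count_curve[OF order_refl] curve_image cong: measurable_cong)

text \<open>The segment may lie on the boundary; a line crossing it then hits the closure of the
  body, hence almost always the body itself.\<close>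

lemma AE_segment_lines_hit:
  assumes "closed_segment a b \<subseteq> closure \<Omega>"
  shows "AE \<omega> in line_params. snd \<omega> \<in> closed_segment (a \<bullet> dir (fst \<omega>)) (b \<bullet> dir (fst \<omega>)) \<longrightarrow> \<omega> \<in> lines_hitting \<Omega>"
  using AE_crossings_segment[of a b] AE_lines_hitting_closure
proof eventually_elim
  case (elim \<omega>)
  show ?case
  proof
    assume "snd \<omega> \<in> closed_segment (a \<bullet> dir (fst \<omega>)) (b \<bullet> dir (fst \<omega>))"
    then have "emeasure (count_space UNIV) (line_of \<omega> \<inter> closed_segment a b) = 1" using elim(1) by simp
    then have "line_of \<omega> \<inter> closed_segment a b \<noteq> {}" by (metis emeasure_empty zero_neq_one)
    then show "\<omega> \<in> lines_hitting \<Omega>" using assms elim(2) by (auto simp: lines_hitting_def)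
  qed
qed

text \<open>The lines crossing the segment have measure \<open>4 * dist a b\<close> and, up to a
  null set, are among the lines meeting the body, of measure \<open>2 * P\<close>. In the sharp case
  this keeps \<open>2 * r / P\<close> in the unit interval.\<close>

lemma segment_length_le:
  assumes "closed_segment a b \<subseteq> closure \<Omega>"
  shows "2 * dist a b \<le> perimeter \<Omega>"
proof -
  have "ennreal (4 * dist a b) \<le> (\<integral>\<^sup>+\<omega>. indicator (lines_hitting \<Omega>) \<omega> \<partial>line_params)"
    unfolding nn_integral_separating_lines(2)[of a b, symmetric]
    using AE_segment_lines_hit[OF assms]
    by (intro nn_integral_mono_AE) (auto simp: indicator_def elim!: eventually_mono)
  then show ?thesis using perimeter_pos by (simp add: measure_lines_hitting_body)
qed

lemma energy_boundary_and_segment: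
  assumes seg: "closed_segment a b \<subseteq> closure \<Omega>"
  shows "energy (replicate n (frontier \<Omega>) @ [closed_segment a b])
    = ennreal (2 * (real n)\<^sup>2 * perimeter \<Omega> + (4 * real n + 1) * dist a b)"
proof -
  define P where "P = perimeter \<Omega>"
  have P: "0 < P" unfolding P_def by (rule perimeter_pos)
  define A where "A = {\<omega>. snd \<omega> \<in> closed_segment (a \<bullet> dir (fst \<omega>)) (b \<bullet> dir (fst \<omega>))}"
  have [measurable]: "A \<in> sets borel" and intA: "(\<integral>\<^sup>+\<omega>. indicator A \<omega> \<partial>line_params) = ennreal (4 * dist a b)"
    unfolding A_def by (rule nn_integral_separating_lines)+
  have [measurable]: "lines_hitting \<Omega> \<in> sets borel" by (rule borel_lines_hitting_body)
  have cr: "crossings l (replicate n (frontier \<Omega>) @ [closed_segment a b])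
    = of_nat n * emeasure (count_space UNIV) (l \<inter> frontier \<Omega>) + emeasure (count_space UNIV) (l \<inter> closed_segment a b)" for l
    by (simp add: crossings_def sum_list_replicate map_replicate_const)
  note [measurable] = borel_measurable_crossings_frontier borel_measurable_crossings_segment
  have "(\<integral>\<^sup>+l. (crossings l (replicate n (frontier \<Omega>) @ [closed_segment a b]))\<^sup>2 \<partial>kinematic_measure)
    = (\<integral>\<^sup>+\<omega>. (crossings (line_of \<omega>) (replicate n (frontier \<Omega>) @ [closed_segment a b]))\<^sup>2 \<partial>line_params)"
    unfolding cr by (rule nn_integral_kinematic, rule borel_measurable_line_params) measurable
  also have "\<dots> = (\<integral>\<^sup>+\<omega>. ennreal (4 * (real n)\<^sup>2) * indicator (lines_hitting \<Omega>) \<omega> + ennreal (4 * real n + 1) * indicator A \<omega> \<partial>line_params)"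
  proof (rule nn_integral_cong_AE)
    show "AE \<omega> in line_params. (crossings (line_of \<omega>) (replicate n (frontier \<Omega>) @ [closed_segment a b]))\<^sup>2
      = ennreal (4 * (real n)\<^sup>2) * indicator (lines_hitting \<Omega>) \<omega> + ennreal (4 * real n + 1) * indicator A \<omega>"
      using AE_crossings_segment[of a b] AE_segment_lines_hit[OF seg] AE_crossing_count_frontier
    proof eventually_elim
      case (elim \<omega>)
      have A: "\<omega> \<in> A \<Longrightarrow> \<omega> \<in> lines_hitting \<Omega>" using elim(2) by (simp add: A_def)
      have "crossings (line_of \<omega>) (replicate n (frontier \<Omega>) @ [closed_segment a b])
         = ennreal (real n * (2 * indicator (lines_hitting \<Omega>) \<omega>) + indicator A \<omega>)"
        unfolding cr elim(1)[folded A_def] elim(3)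
        by (auto simp: indicator_def ennreal_of_nat_eq_real_of_nat ennreal_mult'')
      then have "(crossings (line_of \<omega>) (replicate n (frontier \<Omega>) @ [closed_segment a b]))\<^sup>2
         = ennreal ((real n * (2 * indicator (lines_hitting \<Omega>) \<omega>) + indicator A \<omega>)\<^sup>2)"
        by (simp add: ennreal_power del: ennreal_plus)
      \<comment> \<open>Crossing the segment implies crossing the body, so that the cross term
        \<open>4 * n\<close> is carried by \<open>A\<close> alone and joins the square of its
        indicator.\<close>
      also have "(real n * (2 * indicator (lines_hitting \<Omega>) \<omega>) + indicator A \<omega>)\<^sup>2
        = 4 * (real n)\<^sup>2 * indicator (lines_hitting \<Omega>) \<omega> + (4 * real n + 1) * indicator A \<omega>"
        using A by (auto simp: indicator_def power2_eq_square algebra_simps)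
      also have "ennreal \<dots> = ennreal (4 * (real n)\<^sup>2) * indicator (lines_hitting \<Omega>) \<omega> + ennreal (4 * real n + 1) * indicator A \<omega>"
        by (auto simp: indicator_def)
      finally show ?case .
    qed
  qed
  also have "\<dots> = ennreal (4 * (real n)\<^sup>2) * (\<integral>\<^sup>+\<omega>. indicator (lines_hitting \<Omega>) \<omega> \<partial>line_params)
      + ennreal (4 * real n + 1) * (\<integral>\<^sup>+\<omega>. indicator A \<omega> \<partial>line_params)"
    by (subst nn_integral_add, measurable, subst (1 2) nn_integral_cmult, measurable)
  also have "\<dots> = ennreal (4 * (real n)\<^sup>2 * (2 * P) + (4 * real n + 1) * (4 * dist a b))"
    unfolding intA measure_lines_hitting_body P_def[symmetric] using P
    by (simp add: ennreal_mult[symmetric] ennreal_plus[symmetric] del: ennreal_plus)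
  finally show ?thesis unfolding energy_def
    using P by (simp add: ennreal_divide_numeral P_def[symmetric] add_divide_distrib mult.assoc del: ennreal_plus)
qed

lemma admissible_boundary_and_segment:
  assumes seg: "closed_segment a b \<subseteq> closure \<Omega>"
  shows "admissible \<Omega> (replicate n (frontier \<Omega>) @ [closed_segment a b])"
  using seg one_rectifiable_frontier hausdorff1_frontier
  by (auto simp: admissible_def frontier_def one_rectifiable_closed_segment hausdorff1_closed_segment)

lemma total_length_boundary_and_segment:
  "total_length (replicate n (frontier \<Omega>) @ [closed_segment a b]) = ennreal (real n * perimeter \<Omega> + dist a b)"
  using perimeter_pos
  by (simp add: total_length_def sum_list_replicate map_replicate_const hausdorff1_frontier
      hausdorff1_closed_segment ennreal_of_nat_eq_real_of_nat ennreal_mult'')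

text \<open>The diameter is attained on the compact closure, and a segment realizing it is shortened
  from one end.\<close>

lemma exists_segment:
  assumes "0 \<le> r" "r \<le> diameter \<Omega>"
  obtains a b where "closed_segment a b \<subseteq> closure \<Omega>" "dist a b = r"
proof -
  have "compact (closure \<Omega>)" using bounded_body by simp
  moreover have "closure \<Omega> \<noteq> {}" using nonempty_body by simp
  ultimately obtain x y where xy: "x \<in> closure \<Omega>" "y \<in> closure \<Omega>" "dist x y = diameter (closure \<Omega>)"
    using diameter_compact_attained by blast
  have d: "dist x y = diameter \<Omega>" using xy(3) diameter_closure[OF bounded_body] by simp
  define t where "t = r / dist x y"
  have t: "0 \<le> t" "t \<le> 1" "t * dist x y = r" using assms d by (auto simp: t_def divide_le_eq_1)
  have sub: "closed_segment x y \<subseteq> closure \<Omega>"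
    using xy by (intro closed_segment_subset convex_closure convex_body)
  define b where "b = x + t *\<^sub>R (y - x)"
  have "b \<in> closed_segment x y" using t by (auto simp: b_def closed_segment_affine_image)
  then have "closed_segment x b \<subseteq> closure \<Omega>" using sub by (metis closed_segment_subset convex_closure convex_body subsetD xy(1))
  moreover have "dist x b = r" using t by (simp add: b_def dist_norm norm_minus_commute)
  ultimately show thesis by (rule that)
qed

lemma sharp_case:
  assumes L: "0 \<le> L" and seg: "closed_segment a b \<subseteq> closure \<Omega>" and r: "dist a b = L - real n * perimeter \<Omega>"
  shows "extremal \<Omega> L (replicate n (frontier \<Omega>) @ [closed_segment a b])"
    and "excess \<Omega> L =
      ereal (perimeter \<Omega> / 2 * frac (2 * L / perimeter \<Omega>) * (1 - frac (2 * L / perimeter \<Omega>)))"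
proof -
  define P where "P = perimeter \<Omega>"
  have P: "0 < P" unfolding P_def by (rule perimeter_pos)
  define r where "r = dist a b"
  have Lr: "L = real n * P + r" using r by (simp add: r_def P_def)
  have r0: "0 \<le> r" "2 * r \<le> P" using segment_length_le[OF seg] by (auto simp: r_def P_def)
  let ?\<Gamma> = "replicate n (frontier \<Omega>) @ [closed_segment a b]"
  have adm: "admissible \<Omega> ?\<Gamma>" by (rule admissible_boundary_and_segment[OF seg])
  have len: "total_length ?\<Gamma> = ennreal L"
    unfolding total_length_boundary_and_segment by (simp add: Lr P_def r_def)
  have en: "energy ?\<Gamma> = ennreal (2 * (real n)\<^sup>2 * P + (4 * real n + 1) * r)"
    unfolding energy_boundary_and_segment[OF seg] by (simp add: P_def r_def)
  have up: "min_energy \<Omega> L \<le> energy ?\<Gamma>"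
    unfolding min_energy_def using adm len by (intro INF_lower) simp
  have lo: "energy ?\<Gamma> \<le> min_energy \<Omega> L"
  proof (cases "min_energy \<Omega> L")
    case (real m)
    \<comment> \<open>Here \<open>k = 2 * n\<close>, because almost every line meeting the body
      crosses the family \<open>2 * n\<close> or \<open>2 * n + 1\<close> times, and for these two
      values the integer inequality is an equality.\<close>
    have "(2 * real (2 * n) + 1) * L \<le> m + real (2 * n) * (real (2 * n) + 1) * P / 2"
      using min_energy_lower_bound[OF L, of "2 * n"] real P
      by (simp add: P_def ennreal_plus[symmetric] del: ennreal_plus)
    then have "2 * (real n)\<^sup>2 * P + (4 * real n + 1) * r \<le> m"
      by (simp add: Lr power2_eq_square field_simps)
    then show ?thesis using real by (simp add: en ennreal_leI)
  qed simp
  then have min: "min_energy \<Omega> L = energy ?\<Gamma>" using up by (rule antisym[rotated])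
  then show "extremal \<Omega> L ?\<Gamma>" using adm len by (simp add: extremal_def)
  have ex: "excess \<Omega> L = ereal (2 * (real n)\<^sup>2 * P + (4 * real n + 1) * r - 2 * L\<^sup>2 / P)"
    unfolding excess_def min en using P r0 by (simp add: enn2ereal_ennreal P_def del: ennreal_plus)
  have eq: "2 * (real n)\<^sup>2 * P + (4 * real n + 1) * r - 2 * L\<^sup>2 / P = P / 2 * (2 * r / P) * (1 - 2 * r / P)"
    using P by (simp add: Lr field_simps power2_eq_square)
  have "P / 2 * (2 * r / P) * (1 - 2 * r / P) = P / 2 * frac (2 * L / P) * (1 - frac (2 * L / P))"
  \<comment> \<open>At \<open>2 * r = P\<close> the fractional part is 0 instead of
    \<open>2 * r / P = 1\<close>; the product vanishes for either value.\<close>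
  proof (cases "2 * r = P")
    case True
    then have "2 * L / P = of_int (2 * int n + 1)" using P by (simp add: Lr field_simps)
    then have "frac (2 * L / P) = 0" by (simp only: frac_of_int)
    then show ?thesis using True P by simp
  next
    case False
    have "2 * L / P = 2 * r / P + of_int (2 * int n)" using P by (simp add: Lr field_simps)
    moreover have "frac (2 * r / P + of_int (2 * int n)) = 2 * r / P"
      using False r0 P by (simp add: frac_unique_iff)
    ultimately show ?thesis by simp
  qed
  then show "excess \<Omega> L = ereal (perimeter \<Omega> / 2 * frac (2 * L / perimeter \<Omega>) * (1 - frac (2 * L / perimeter \<Omega>)))"
    using ex eq by (simp add: P_def)
qed

end

section \<open>The upper bound\<close>

text \<open>Averaging over all subsets of size \<open>m\<close> is replaced by deleting one element
  at a time. An ordered pair in \<open>T\<close> survives the deletion of all elements but its own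
  two, so some deletion leaves at most the fraction \<open>(card T - 2) / card T\<close> of the sum,
  and these fractions telescope.\<close>

lemma exists_subset_small_pair_sum:
  fixes w :: "'a \<Rightarrow> 'a \<Rightarrow> real"
  assumes S: "finite S" and m: "m \<le> card S"
  obtains T where "T \<subseteq> S" "card T = m"
    "(\<Sum>i\<in>T. \<Sum>j\<in>T - {i}. w i j) * (real (card S) * (real (card S) - 1))
      \<le> real m * (real m - 1) * (\<Sum>i\<in>S. \<Sum>j\<in>S - {i}. w i j)"
proof -
  define f where "f T = (\<Sum>i\<in>T. \<Sum>j\<in>T - {i}. w i j)" for T
  define c where "c = real (card S) * (real (card S) - 1)"
  have c: "0 \<le> c" by (cases "card S") (auto simp: c_def)
  have remove: "\<exists>v\<in>T. real (card T) * f (T - {v}) \<le> (real (card T) - 2) * f T"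
    if T: "finite T" "T \<noteq> {}" for T
  proof (rule ccontr)
    assume "\<not> ?thesis"
    then have "\<And>v. v \<in> T \<Longrightarrow> (real (card T) - 2) * f T < real (card T) * f (T - {v})" by auto
    then have "(\<Sum>v\<in>T. (real (card T) - 2) * f T) < (\<Sum>v\<in>T. real (card T) * f (T - {v}))"
      using T by (intro sum_strict_mono) auto
    also have "\<dots> = real (card T) * (\<Sum>v\<in>T. f (T - {v}))" by (simp add: sum_distrib_left)
    also have "(\<Sum>v\<in>T. f (T - {v})) = (\<Sum>v\<in>T. f T - (\<Sum>j\<in>T - {v}. w v j) - (\<Sum>i\<in>T - {v}. w i v))"
    proof (intro sum.cong refl)
      fix v assume v: "v \<in> T"
      have "f T = (\<Sum>j\<in>T - {v}. w v j) + (\<Sum>i\<in>T - {v}. \<Sum>j\<in>T - {i}. w i j)"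
        unfolding f_def using sum.remove[OF T(1) v, of "\<lambda>i. \<Sum>j\<in>T - {i}. w i j"] by simp
      also have "(\<Sum>i\<in>T - {v}. \<Sum>j\<in>T - {i}. w i j) = (\<Sum>i\<in>T - {v}. w i v + (\<Sum>j\<in>T - {v} - {i}. w i j))"
      proof (intro sum.cong refl)
        fix i assume "i \<in> T - {v}"
        then have "(\<Sum>j\<in>T - {i}. w i j) = w i v + (\<Sum>j\<in>T - {i} - {v}. w i j)"
          using T v by (intro sum.remove) auto
        also have "T - {i} - {v} = T - {v} - {i}" by auto
        finally show "(\<Sum>j\<in>T - {i}. w i j) = w i v + (\<Sum>j\<in>T - {v} - {i}. w i j)" .
      qed
      also have "\<dots> = (\<Sum>i\<in>T - {v}. w i v) + f (T - {v})"
        by (simp add: sum.distrib f_def)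
      finally show "f (T - {v}) = f T - (\<Sum>j\<in>T - {v}. w v j) - (\<Sum>i\<in>T - {v}. w i v)" by simp
    qed
    also have "\<dots> = real (card T) * f T - f T - (\<Sum>v\<in>T. \<Sum>i\<in>T - {v}. w i v)"
      by (simp add: sum_subtractf f_def)
    also have "(\<Sum>v\<in>T. \<Sum>i\<in>T - {v}. w i v) = f T"
    proof -
      have "(\<Sum>v\<in>T. \<Sum>i\<in>T - {v}. w i v) = (\<Sum>v\<in>T. \<Sum>i | i \<in> T \<and> i \<noteq> v. w i v)"
        by (intro sum.cong) auto
      also have "\<dots> = (\<Sum>i\<in>T. \<Sum>v | v \<in> T \<and> i \<noteq> v. w i v)"
        using T(1) by (intro sum.swap_restrict) auto
      also have "\<dots> = f T" unfolding f_def by (intro sum.cong) auto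
      finally show ?thesis .
    qed
    finally show False by (simp add: algebra_simps)
  qed
  have "\<exists>T. T \<subseteq> S \<and> card T = card S - d \<and> f T * c \<le> real (card S - d) * (real (card S - d) - 1) * f S"
    if "d \<le> card S" for d
    using that
  proof (induction d)
    case 0
    then show ?case by (intro exI[of _ S]) (simp add: c_def mult_ac)
  next
    case (Suc d)
    then obtain T where T: "T \<subseteq> S" "card T = card S - d" "f T * c \<le> real (card S - d) * (real (card S - d) - 1) * f S"
      by auto
    have finT: "finite T" using T(1) S finite_subset by blast
    define k where "k = card T"
    have k: "1 \<le> k" using Suc.prems T(2) by (simp add: k_def)
    then have "T \<noteq> {}" by (auto simp: k_def)
    then obtain v where v: "v \<in> T" "real k * f (T - {v}) \<le> (real k - 2) * f T"
      using remove[OF finT] by (auto simp: k_def)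
    have card: "card (T - {v}) = card S - Suc d" using v(1) finT T(2) by simp
    have kk: "real (card S - d) = real k" "real (card S - Suc d) = real k - 1"
      using T(2) Suc.prems k by (auto simp: k_def of_nat_diff)
    have "f (T - {v}) * c \<le> (real k - 1) * (real k - 1 - 1) * f S"
    \<comment> \<open>For \<open>k = 1\<close> the factor \<open>k - 2\<close> is negative and the
      induction hypothesis cannot be multiplied by it, but then nothing remains after the
      deletion.\<close>
    proof (cases "k = 1")
      case True
      then have "T = {v}" using v(1) by (metis card_1_singletonE k_def singletonD)
      then show ?thesis using True by (simp add: f_def)
    next
      case False
      then have k2: "0 \<le> real k - 2" "0 < real k" using k by auto
      have "real k * (f (T - {v}) * c) \<le> (real k - 2) * (f T * c)"
        using mult_right_mono[OF v(2) c] by (simp add: mult_ac)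
      also have "\<dots> \<le> (real k - 2) * (real k * (real k - 1) * f S)"
        using T(3) k2(1) unfolding kk(1) by (rule mult_left_mono)
      also have "\<dots> = real k * ((real k - 1) * (real k - 1 - 1) * f S)" by (simp add: algebra_simps)
      finally show ?thesis using k2(2) by (simp only: mult_le_cancel_left_pos)
    qed
    then show ?case using card T(1) v(1) kk by (intro exI[of _ "T - {v}"]) auto
  qed
  from this[of "card S - m"] m show thesis
    using that by (auto simp: f_def c_def)
qed

section \<open>Arcs of equal length\<close>

context planar_convex_body
begin

definition arc_length :: "real \<Rightarrow> real" where
  "arc_length t = enn2real (hausdorff1 (curve ` {0..<t}))"

lemma hausdorff1_arc:
  assumes "0 \<le> a" "a \<le> b" "b \<le> 1"
  shows "hausdorff1 (curve ` {a..<b}) = ennreal (arc_length b - arc_length a)" and "arc_length a \<le> arc_length b"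
proof -
  have bor: "curve ` {c..<d} \<in> sets borel" for c d
    by (intro borel_sigma_compact sigma_compact_image continuous_curve sigma_compact_atLeastLessThan)
  have fin: "hausdorff1 (curve ` {c..<d}) = ennreal (enn2real (hausdorff1 (curve ` {c..<d})))"
    if "0 \<le> c" "d \<le> 1" for c d
    using hausdorff1_curve_finite[of "{c..<d}"] that by (auto simp: top.not_eq_extremum)
  have sub: "{0..<a} \<subseteq> {0..<1}" "{a..<b} \<subseteq> {0..<1}" using assms by auto
  have "curve ` {0..<a} \<inter> curve ` {a..<b} = curve ` ({0..<a} \<inter> {a..<b})"
    by (rule inj_on_image_Int[OF inj_on_curve sub, symmetric])
  then have disj: "curve ` {0..<a} \<inter> curve ` {a..<b} = {}" by simp
  have "{0..<b} = {0..<a} \<union> {a..<b}" using assms by auto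
  then have un: "curve ` {0..<b} = curve ` {0..<a} \<union> curve ` {a..<b}" by (simp add: image_Un)
  have "curve ` {0..<a} \<in> lambda_system UNIV UNIV hausdorff1"
    using bor by (rule borel_in_lambda_system_hausdorff1)
  then have "hausdorff1 (curve ` {0..<b} \<inter> curve ` {0..<a}) + hausdorff1 (curve ` {0..<b} - curve ` {0..<a})
      = hausdorff1 (curve ` {0..<b})"
    unfolding lambda_system_hausdorff1_iff by blast
  moreover have "curve ` {0..<b} \<inter> curve ` {0..<a} = curve ` {0..<a}" "curve ` {0..<b} - curve ` {0..<a} = curve ` {a..<b}"
    using un disj by auto
  ultimately have "hausdorff1 (curve ` {0..<a}) + hausdorff1 (curve ` {a..<b}) = hausdorff1 (curve ` {0..<b})" by simp
  then have "ennreal (arc_length a + enn2real (hausdorff1 (curve ` {a..<b}))) = ennreal (arc_length b)"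
    using fin[of 0 a] fin[of 0 b] fin[of a b] assms by (simp add: arc_length_def)
  then have *: "arc_length a + enn2real (hausdorff1 (curve ` {a..<b})) = arc_length b"
    by (subst (asm) ennreal_inj) (auto simp: arc_length_def)
  then show "hausdorff1 (curve ` {a..<b}) = ennreal (arc_length b - arc_length a)"
    using fin[of a b] assms by (metis add_diff_cancel_left')
  show "arc_length a \<le> arc_length b" using * enn2real_nonneg[of "hausdorff1 (curve ` {a..<b})"] by linarith
qed

lemma arc_length_0 [simp]: "arc_length 0 = 0"
  by (simp add: arc_length_def)

lemma arc_length_1 [simp]: "arc_length 1 = perimeter \<Omega>"
  by (simp add: arc_length_def curve_image perimeter_def)

lemma continuous_arc_length: "continuous_on {0..1} arc_length"
proof -
  obtain C where C: "0 < C" "C-lipschitz_on UNIV curve" using curve_lipschitz by blast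
  have le: "arc_length b - arc_length a \<le> C * (b - a)" if "0 \<le> a" "a \<le> b" "b \<le> 1" for a b
  proof -
    have "ennreal (arc_length b - arc_length a) \<le> ennreal C * hausdorff1 {a..<b}"
      using C hausdorff1_arc(1)[OF that] hausdorff1_lipschitz_image[OF lipschitz_on_subset[OF C(2)] C(1), of "{a..<b}"]
      by simp
    also have "\<dots> \<le> ennreal C * hausdorff1 {a..b}"
      by (intro mult_left_mono hausdorff1_mono) auto
    also have "\<dots> \<le> ennreal C * ennreal (b - a)"
      by (intro mult_left_mono hausdorff1_atLeastAtMost that) simp
    also have "\<dots> = ennreal (C * (b - a))" using C by (simp add: ennreal_mult')
    finally show ?thesis using C that by (subst (asm) ennreal_le_iff) auto
  qed
  have "C-lipschitz_on {0..1} arc_length"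
  proof (rule lipschitz_onI)
    fix s t :: real assume st: "s \<in> {0..1}" "t \<in> {0..1}"
    show "dist (arc_length s) (arc_length t) \<le> C * dist s t"
      using le[of s t] le[of t s] hausdorff1_arc(2)[of s t] hausdorff1_arc(2)[of t s] st
      by (cases "s \<le> t") (auto simp: dist_real_def)
  qed (use C in simp)
  then show ?thesis by (rule lipschitz_on_continuous_on)
qed

lemma arc_length_surj:
  assumes "0 \<le> a" "a \<le> b" "b \<le> 1" "arc_length a \<le> y" "y \<le> arc_length b"
  obtains t where "a \<le> t" "t \<le> b" "arc_length t = y"
  using IVT'[of arc_length a y b] assms continuous_on_subset[OF continuous_arc_length, of "{a..b}"] by auto

text \<open>Dividing by arc length gives all arcs the same length, so that any \<open>m\<close> of
  them can be shortened to a common prescribed length.\<close>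

definition breakpoint :: "nat \<Rightarrow> nat \<Rightarrow> real" where
  "breakpoint M i = (SOME t. t \<in> {0..1} \<and> arc_length t = real i * perimeter \<Omega> / real M)"

lemma breakpoint:
  assumes "0 < M" "i \<le> M"
  shows "breakpoint M i \<in> {0..1}" "arc_length (breakpoint M i) = real i * perimeter \<Omega> / real M"
proof -
  have "0 \<le> real i * perimeter \<Omega> / real M" "real i * perimeter \<Omega> / real M \<le> perimeter \<Omega>"
    using assms perimeter_pos by (auto simp: field_simps intro: mult_right_mono)
  then obtain t where "t \<in> {0..1}" "arc_length t = real i * perimeter \<Omega> / real M"
    using arc_length_surj[of 0 1 "real i * perimeter \<Omega> / real M"] by auto
  then have "\<exists>t. t \<in> {0..1} \<and> arc_length t = real i * perimeter \<Omega> / real M" by blast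
  from someI_ex[OF this] show "breakpoint M i \<in> {0..1}" "arc_length (breakpoint M i) = real i * perimeter \<Omega> / real M"
    unfolding breakpoint_def by auto
qed

lemma breakpoint_less:
  assumes "i < j" "j \<le> M"
  shows "breakpoint M i < breakpoint M j"
proof (rule ccontr)
  assume "\<not> ?thesis"
  then have "arc_length (breakpoint M j) \<le> arc_length (breakpoint M i)"
    using breakpoint[of M i] breakpoint[of M j] assms by (intro hausdorff1_arc(2)) auto
  then have "real j * perimeter \<Omega> / real M \<le> real i * perimeter \<Omega> / real M"
    using breakpoint(2)[of M i] breakpoint(2)[of M j] assms by auto
  then show False using assms perimeter_pos by (simp add: divide_le_cancel)
qed

definition boundary_arc :: "nat \<Rightarrow> nat \<Rightarrow> real set" where
  "boundary_arc M i = {breakpoint M i..<breakpoint M (Suc i)}"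

lemma boundary_arc_subset: "i < M \<Longrightarrow> boundary_arc M i \<subseteq> {0..<1}"
  using breakpoint(1)[of M i] breakpoint(1)[of M "Suc i"] by (auto simp: boundary_arc_def)

lemma hausdorff1_boundary_arc:
  assumes "i < M"
  shows "hausdorff1 (curve ` boundary_arc M i) = ennreal (perimeter \<Omega> / real M)"
proof -
  have "hausdorff1 (curve ` boundary_arc M i) = ennreal (arc_length (breakpoint M (Suc i)) - arc_length (breakpoint M i))"
    unfolding boundary_arc_def using assms breakpoint(1)[of M i] breakpoint(1)[of M "Suc i"] breakpoint_less[of i "Suc i" M]
    by (intro hausdorff1_arc) auto
  also have "arc_length (breakpoint M (Suc i)) - arc_length (breakpoint M i) = perimeter \<Omega> / real M"
    using assms breakpoint(2)[of M i] breakpoint(2)[of M "Suc i"] by (simp add: field_simps)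
  finally show ?thesis .
qed

lemma boundary_arc_disjoint:
  assumes "i < M" "j < M" "i \<noteq> j"
  shows "boundary_arc M i \<inter> boundary_arc M j = {}"
proof -
  have *: "boundary_arc M i \<inter> boundary_arc M j = {}" if "i < j" "j < M" for i j
  proof -
    have "breakpoint M (Suc i) \<le> breakpoint M j"
      using that breakpoint_less[of "Suc i" j M] by (cases "Suc i = j") auto
    then show ?thesis by (auto simp: boundary_arc_def)
  qed
  then show ?thesis using assms by (metis Int_commute linorder_neqE_nat)
qed

text \<open>Lines whose two boundary crossings fall into the same arc. Their crossings are not
  governed by pairs of different arcs, so they enter the estimate as an error term.\<close>

definition coincident :: "nat \<Rightarrow> (real \<times> real) set" where
  "coincident M = {\<omega> \<in> lines_hitting \<Omega>. \<exists>i<M. 2 \<le> crossing_count curve (boundary_arc M i) \<omega>}"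

lemma borel_coincident: "coincident M \<in> sets borel"
proof -
  have [measurable]: "lines_hitting \<Omega> \<in> sets borel" by (rule borel_lines_hitting_body)
  have "{\<omega>. 2 \<le> crossing_count curve (boundary_arc M i) \<omega>} \<in> sets borel" if "i < M" for i
  proof -
    have [measurable]: "crossing_count curve (boundary_arc M i) \<in> borel_measurable borel"
      by (rule borel_crossing_count_curve[OF _ boundary_arc_subset[OF that]]) (simp add: boundary_arc_def sigma_compact_atLeastLessThan)
    have "{\<omega> \<in> space borel. 2 \<le> crossing_count curve (boundary_arc M i) \<omega>} \<in> sets borel" by measurable
    then show ?thesis by simp
  qed
  then have "(\<Union>i\<in>{..<M}. {\<omega>. 2 \<le> crossing_count curve (boundary_arc M i) \<omega>}) \<in> sets borel"
    by (intro sets.finite_UN) auto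
  moreover have "coincident M = lines_hitting \<Omega> \<inter> (\<Union>i\<in>{..<M}. {\<omega>. 2 \<le> crossing_count curve (boundary_arc M i) \<omega>})"
    by (auto simp: coincident_def)
  ultimately show ?thesis by simp
qed

text \<open>The two crossing points of a fixed line have positive distance, and an arc of length
  \<open>P / M\<close> below that distance cannot contain both. Dominated convergence turns this
  into a statement on measures.\<close>

lemma coincident_tendsto_0:
  "(\<lambda>M. \<integral>\<^sup>+\<omega>. indicator (coincident M) \<omega> \<partial>line_params) \<longlonglongrightarrow> 0"
proof -
  have [measurable]: "lines_hitting \<Omega> \<in> sets borel" "coincident M \<in> sets borel" for M
    by (rule borel_lines_hitting_body borel_coincident)+
  have pt: "(\<lambda>M. indicator (coincident M) \<omega> :: ennreal) \<longlonglongrightarrow> 0" for \<omega>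
  proof (cases "\<omega> \<in> lines_hitting \<Omega>")
    case True
    obtain \<alpha> \<beta> where ab: "0 \<le> \<alpha>" "\<alpha> < \<beta>" "\<beta> < 1" "{t \<in> {0..<1}. curve t \<in> line_of \<omega>} = {\<alpha>, \<beta>}"
      using crossings_curve_parameters[OF True] .
    have "curve \<alpha> \<noteq> curve \<beta>" using inj_onD[OF inj_on_curve, of \<alpha> \<beta>] ab by auto
    then have c: "0 < dist (curve \<alpha>) (curve \<beta>)" by simp
    have "(\<lambda>M. perimeter \<Omega> / real M) \<longlonglongrightarrow> 0" by (rule lim_const_over_n)
    then have "\<forall>\<^sub>F M in sequentially. perimeter \<Omega> / real M < dist (curve \<alpha>) (curve \<beta>)"
      using c by (rule order_tendstoD)
    then have "\<forall>\<^sub>F M in sequentially. (indicator (coincident M) \<omega> :: ennreal) = 0"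
    proof eventually_elim
      case (elim M)
      have "\<omega> \<notin> coincident M"
      proof
        assume "\<omega> \<in> coincident M"
        then obtain i where i: "i < M" "2 \<le> crossing_count curve (boundary_arc M i) \<omega>" by (auto simp: coincident_def)
        define Y where "Y = {t \<in> boundary_arc M i. curve t \<in> line_of \<omega>}"
        have sub: "Y \<subseteq> {\<alpha>, \<beta>}" unfolding ab(4)[symmetric] Y_def using boundary_arc_subset[OF i(1)] by blast
        then have "finite Y" by (rule finite_subset) simp
        then have "2 \<le> card Y" using i(2) by (simp add: crossing_count_def Y_def[symmetric]) 
        moreover have "card {\<alpha>, \<beta>} = 2" using ab by simp
        ultimately have "Y = {\<alpha>, \<beta>}" using sub by (intro card_seteq) auto
        then have "\<alpha> \<in> boundary_arc M i" "\<beta> \<in> boundary_arc M i" unfolding Y_def by blast+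
        then have "{\<alpha>..<\<beta>} \<subseteq> boundary_arc M i" unfolding boundary_arc_def by auto
        then have "hausdorff1 (curve ` {\<alpha>..<\<beta>}) \<le> ennreal (perimeter \<Omega> / real M)"
          unfolding hausdorff1_boundary_arc[OF i(1), symmetric] by (intro hausdorff1_mono image_mono)
        then have "ennreal (dist (curve \<alpha>) (curve \<beta>)) \<le> ennreal (perimeter \<Omega> / real M)"
          using dist_le_hausdorff1_image[OF continuous_curve ab(2)] by (rule order_trans[rotated])
        then show False using elim perimeter_pos by (subst (asm) ennreal_le_iff) auto
      qed
      then show ?case by simp
    qed
    then show ?thesis by (rule tendsto_eventually)
  qed (simp add: coincident_def)
  have "(\<lambda>M. \<integral>\<^sup>+\<omega>. indicator (coincident M) \<omega> \<partial>line_params) \<longlonglongrightarrow> (\<integral>\<^sup>+\<omega>. 0 \<partial>line_params)"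
  proof (rule nn_integral_dominated_convergence[where w="indicator (lines_hitting \<Omega>)"])
    show "AE \<omega> in line_params. indicator (coincident M) \<omega> \<le> (indicator (lines_hitting \<Omega>) \<omega> :: ennreal)" for M
      by (auto simp: coincident_def split: split_indicator)
    show "integral\<^sup>N line_params (indicator (lines_hitting \<Omega>)) < \<infinity>"
      using measure_lines_hitting_body by simp
  qed (use pt in auto)
  then show ?thesis by simp
qed

end

section \<open>Lines crossing two chosen arcs\<close>

lemma pair_sum_indicator:
  assumes "finite T"
  shows "(\<Sum>i\<in>T. \<Sum>j\<in>T - {i}. indicator (H i \<inter> H j) \<omega> :: ennreal)
    = of_nat (card {i \<in> T. \<omega> \<in> H i} * (card {i \<in> T. \<omega> \<in> H i} - 1))"
proof -
  define C where "C = {i \<in> T. \<omega> \<in> H i}"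
  have C: "finite C" "C \<subseteq> T" using assms by (auto simp: C_def)
  have "(\<Sum>i\<in>T. \<Sum>j\<in>T - {i}. indicator (H i \<inter> H j) \<omega> :: ennreal) = (\<Sum>i\<in>C. of_nat (card C - 1))"
  proof (rule sum.mono_neutral_cong_right[OF assms C(2)])
    show "\<forall>i\<in>T - C. (\<Sum>j\<in>T - {i}. indicator (H i \<inter> H j) \<omega> :: ennreal) = 0"
      by (auto simp: C_def)
    fix i assume i: "i \<in> C"
    have "(\<Sum>j\<in>T - {i}. indicator (H i \<inter> H j) \<omega> :: ennreal) = (\<Sum>j\<in>T - {i}. if \<omega> \<in> H j then 1 else 0)"
      using i by (intro sum.cong refl) (simp add: C_def indicator_def)
    also have "\<dots> = of_nat (card ((T - {i}) \<inter> {j. \<omega> \<in> H j}))"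
      using assms by (simp add: sum.If_cases)
    also have "(T - {i}) \<inter> {j. \<omega> \<in> H j} = C - {i}" unfolding C_def by blast
    finally show "(\<Sum>j\<in>T - {i}. indicator (H i \<inter> H j) \<omega> :: ennreal) = of_nat (card C - 1)"
      using i C(1) by simp
  qed
  then show ?thesis by (simp add: C_def)
qed

text \<open>Write the square of the sum \<open>c\<close> as \<open>c + c * (c - 1)\<close>. The
  second term is positive only for \<open>c = 2\<close>, and then either two different indices
  contribute, which the ordered pairs in \<open>C\<close> account for, or a single index contributes
  2.\<close>

lemma square_sum_le_pairs:
  fixes a :: "'a \<Rightarrow> nat"
  assumes "finite T" "(\<Sum>i\<in>T. a i) \<le> 2" "{i \<in> T. 0 < a i} \<subseteq> C" "finite C"
  shows "(\<Sum>i\<in>T. a i)\<^sup>2 \<le> (\<Sum>i\<in>T. a i) + card C * (card C - 1) + (if \<exists>i\<in>T. 2 \<le> a i then 2 else 0)"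
proof -
  define s where "s = (\<Sum>i\<in>T. a i)"
  consider "s = 0" | "s = 1" | "s = 2" using assms(2) unfolding s_def by linarith
  then have "s\<^sup>2 \<le> s + card C * (card C - 1) + (if \<exists>i\<in>T. 2 \<le> a i then 2 else 0)"
  proof cases
    case 3
    show ?thesis
    proof (cases "\<exists>i\<in>T. 2 \<le> a i")
      case False
      then have a1: "a i \<le> 1" if "i \<in> T" for i using that by force
      have "s \<le> (\<Sum>i\<in>T. if 0 < a i then 1 else 0)" unfolding s_def
      proof (intro sum_mono)
        fix i assume "i \<in> T"
        then show "a i \<le> (if 0 < a i then 1 else 0)" using a1[of i] by auto
      qed
      also have "\<dots> = card {i \<in> T. 0 < a i}" using assms(1) by (simp add: sum.If_cases Int_def)
      also have "\<dots> \<le> card C" using assms by (intro card_mono)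
      finally have "2 \<le> card C" using 3 by simp
      then have "2 * 1 \<le> card C * (card C - 1)" by (intro mult_le_mono) auto
      then show ?thesis using 3 by simp
    qed (use 3 in simp)
  qed auto
  then show ?thesis by (simp add: s_def)
qed

context planar_convex_body
begin

text \<open>A line belongs to at most two of the sets and thus to at most two ordered pairs. The
  lines meeting the body have measure \<open>2 * P\<close>, whence the total
  \<open>4 * P\<close>.\<close>

lemma pairs_of_crossings:
  fixes H :: "nat \<Rightarrow> (real \<times> real) set"
  defines "w \<equiv> \<lambda>i j. enn2real (\<integral>\<^sup>+\<omega>. indicator (H i \<inter> H j) \<omega> \<partial>line_params)"
  assumes H: "\<And>i. i < M \<Longrightarrow> H i \<in> sets borel" "\<And>i. i < M \<Longrightarrow> H i \<subseteq> lines_hitting \<Omega>"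
    and two: "\<And>\<omega>. card {i. i < M \<and> \<omega> \<in> H i} \<le> 2"
  shows "T \<subseteq> {..<M} \<Longrightarrow> (\<integral>\<^sup>+\<omega>. (\<Sum>i\<in>T. \<Sum>j\<in>T - {i}. indicator (H i \<inter> H j) \<omega>) \<partial>line_params)
      = ennreal (\<Sum>i\<in>T. \<Sum>j\<in>T - {i}. w i j)"
    and "(\<Sum>i<M. \<Sum>j\<in>{..<M} - {i}. w i j) \<le> 4 * perimeter \<Omega>"
proof -
  have W[measurable]: "lines_hitting \<Omega> \<in> sets borel" by (rule borel_lines_hitting_body)
  have em: "(\<integral>\<^sup>+\<omega>. indicator (H i \<inter> H j) \<omega> \<partial>line_params) = ennreal (w i j)" if "i < M" for i j
  proof -
    have "(\<integral>\<^sup>+\<omega>. indicator (H i \<inter> H j) \<omega> \<partial>line_params) \<le> (\<integral>\<^sup>+\<omega>. indicator (lines_hitting \<Omega>) \<omega> \<partial>line_params)"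
      using H(2)[OF that] by (intro nn_integral_mono) (auto split: split_indicator)
    then have "(\<integral>\<^sup>+\<omega>. indicator (H i \<inter> H j) \<omega> \<partial>line_params) < top"
      unfolding measure_lines_hitting_body by (rule le_less_trans) simp
    then show ?thesis unfolding w_def by simp
  qed
  have eq: "(\<integral>\<^sup>+\<omega>. (\<Sum>i\<in>T. \<Sum>j\<in>T - {i}. indicator (H i \<inter> H j) \<omega>) \<partial>line_params)
      = ennreal (\<Sum>i\<in>T. \<Sum>j\<in>T - {i}. w i j)" if T: "T \<subseteq> {..<M}" for T
  proof -
    have m: "(\<lambda>\<omega>. indicator (H i \<inter> H j) \<omega> :: ennreal) \<in> borel_measurable line_params" if "i \<in> T" "j \<in> T" for i j
      using H(1)[of i] H(1)[of j] that T by (intro borel_measurable_line_params borel_measurable_indicator) auto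
    have "(\<integral>\<^sup>+\<omega>. (\<Sum>i\<in>T. \<Sum>j\<in>T - {i}. indicator (H i \<inter> H j) \<omega>) \<partial>line_params)
      = (\<Sum>i\<in>T. \<integral>\<^sup>+\<omega>. (\<Sum>j\<in>T - {i}. indicator (H i \<inter> H j) \<omega>) \<partial>line_params)"
      using m by (intro nn_integral_sum borel_measurable_sum) auto
    also have "\<dots> = (\<Sum>i\<in>T. \<Sum>j\<in>T - {i}. \<integral>\<^sup>+\<omega>. indicator (H i \<inter> H j) \<omega> \<partial>line_params)"
      using m by (intro sum.cong refl nn_integral_sum) auto
    also have "\<dots> = (\<Sum>i\<in>T. \<Sum>j\<in>T - {i}. ennreal (w i j))"
      using T by (intro sum.cong refl em) auto
    also have "\<dots> = ennreal (\<Sum>i\<in>T. \<Sum>j\<in>T - {i}. w i j)"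
      by (simp add: w_def sum_nonneg)
    finally show ?thesis .
  qed
  then show "T \<subseteq> {..<M} \<Longrightarrow> (\<integral>\<^sup>+\<omega>. (\<Sum>i\<in>T. \<Sum>j\<in>T - {i}. indicator (H i \<inter> H j) \<omega>) \<partial>line_params)
      = ennreal (\<Sum>i\<in>T. \<Sum>j\<in>T - {i}. w i j)" .
  have "ennreal (\<Sum>i<M. \<Sum>j\<in>{..<M} - {i}. w i j)
      = (\<integral>\<^sup>+\<omega>. (\<Sum>i<M. \<Sum>j\<in>{..<M} - {i}. indicator (H i \<inter> H j) \<omega>) \<partial>line_params)"
    by (rule eq[symmetric]) simp
  also have "\<dots> \<le> (\<integral>\<^sup>+\<omega>. 2 * indicator (lines_hitting \<Omega>) \<omega> \<partial>line_params)"
  proof (rule nn_integral_mono)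
    fix \<omega>
    define c where "c = card {i \<in> {..<M}. \<omega> \<in> H i}"
    have "c \<le> 2" using two[of \<omega>] by (simp add: c_def)
    then have "c * (c - 1) \<le> 2 * 1" by (intro mult_le_mono) auto
    moreover have "c = 0" if "\<omega> \<notin> lines_hitting \<Omega>"
    proof -
      have "{i \<in> {..<M}. \<omega> \<in> H i} = {}" using that H(2) by blast
      then show ?thesis by (simp add: c_def)
    qed
    ultimately have "c * (c - 1) \<le> (if \<omega> \<in> lines_hitting \<Omega> then 2 else 0)" by auto
    then have "(of_nat (c * (c - 1)) :: ennreal) \<le> of_nat (if \<omega> \<in> lines_hitting \<Omega> then 2 else 0)"
      by (simp only: of_nat_le_iff)
    also have "\<dots> = 2 * indicator (lines_hitting \<Omega>) \<omega>" by simp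
    finally show "(\<Sum>i<M. \<Sum>j\<in>{..<M} - {i}. indicator (H i \<inter> H j) \<omega>) \<le> (2 * indicator (lines_hitting \<Omega>) \<omega> :: ennreal)"
      unfolding c_def pair_sum_indicator[OF finite_lessThan] .
  qed
  also have "\<dots> = 2 * ennreal (2 * perimeter \<Omega>)"
    unfolding measure_lines_hitting_body[symmetric] by (rule nn_integral_cmult, rule borel_measurable_line_params) measurable
  also have "\<dots> = ennreal (4 * perimeter \<Omega>)" using perimeter_pos by (simp add: ennreal_mult')
  finally show "(\<Sum>i<M. \<Sum>j\<in>{..<M} - {i}. w i j) \<le> 4 * perimeter \<Omega>"
    using perimeter_pos by (subst (asm) ennreal_le_iff) auto
qed

text \<open>The arcs are disjoint, so each of the two crossing parameters accounts for at most one
  of them.\<close>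

lemma card_arcs_crossed_le_two:
  assumes "\<omega> \<in> lines_hitting \<Omega>"
  shows "card {i. i < M \<and> \<omega> \<in> lines_hitting (curve ` boundary_arc M i)} \<le> 2"
proof -
  obtain \<alpha> \<beta> where ab: "{t \<in> {0..<1}. curve t \<in> line_of \<omega>} = {\<alpha>, \<beta>}"
    using crossings_curve_parameters[OF assms] .
  define idx where "idx t = (THE i. i < M \<and> t \<in> boundary_arc M i)" for t
  have "{i. i < M \<and> \<omega> \<in> lines_hitting (curve ` boundary_arc M i)} \<subseteq> idx ` {\<alpha>, \<beta>}"
  proof clarify
    fix i assume i: "i < M" "\<omega> \<in> lines_hitting (curve ` boundary_arc M i)"
    then obtain t where t: "t \<in> boundary_arc M i" "curve t \<in> line_of \<omega>"
      by (auto simp: lines_hitting_def)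
    have "t \<in> {\<alpha>, \<beta>}" unfolding ab[symmetric] using t boundary_arc_subset[OF i(1)] by blast
    moreover have "idx t = i" unfolding idx_def
    proof (rule the_equality)
      fix j assume "j < M \<and> t \<in> boundary_arc M j"
      then show "j = i" using t(1) boundary_arc_disjoint[of i M j] i(1) by blast
    qed (use i t in simp)
    ultimately show "i \<in> idx ` {\<alpha>, \<beta>}" by blast
  qed
  then have "card {i. i < M \<and> \<omega> \<in> lines_hitting (curve ` boundary_arc M i)} \<le> card (idx ` {\<alpha>, \<beta>})"
    by (intro card_mono) auto
  also have "\<dots> \<le> card {\<alpha>, \<beta>}" by (rule card_image_le) simp
  also have "\<dots> \<le> 2" by (simp add: card_insert_if)
  finally show ?thesis .
qed

text \<open>Crossings are counted on the shortened arcs \<open>B i\<close>, but pairs on the full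
  arcs: the choice of arcs is made from the measures for full arcs, before any shortening.\<close>

lemma square_crossings_le:
  assumes hit: "\<omega> \<in> lines_hitting \<Omega>" and T: "T \<subseteq> {..<M}"
    and B: "\<And>i. i \<in> T \<Longrightarrow> B i \<subseteq> boundary_arc M i"
  obtains c k :: nat
  where "(\<Sum>i\<in>T. crossing_count curve (B i) \<omega>) = of_nat c"
    "k = card {i \<in> T. \<omega> \<in> lines_hitting (curve ` boundary_arc M i) \<inter> lines_hitting \<Omega>}"
    "c\<^sup>2 \<le> c + k * (k - 1) + (if \<omega> \<in> coincident M then 2 else 0)"
proof -
  have finT: "finite T" using T finite_subset by blast
  obtain \<alpha> \<beta> where ab: "{t \<in> {0..<1}. curve t \<in> line_of \<omega>} = {\<alpha>, \<beta>}"
    using crossings_curve_parameters[OF hit] .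
  define Y where "Y i = {t \<in> B i. curve t \<in> line_of \<omega>}" for i
  have iM: "i < M" if "i \<in> T" for i using T that by auto
  have Y: "Y i \<subseteq> {\<alpha>, \<beta>}" if "i \<in> T" for i
    unfolding ab[symmetric] Y_def using B[OF that] boundary_arc_subset[OF iM[OF that]] by blast
  then have finY: "finite (Y i)" if "i \<in> T" for i
    using that by (meson finite.emptyI finite.insertI finite_subset)
  define c where "c = (\<Sum>i\<in>T. card (Y i))"
  define K where "K = {i \<in> T. \<omega> \<in> lines_hitting (curve ` boundary_arc M i) \<inter> lines_hitting \<Omega>}"
  show thesis
  proof
    show "(\<Sum>i\<in>T. crossing_count curve (B i) \<omega>) = of_nat c"
      unfolding c_def crossing_count_def Y_def[symmetric] using finY by simp
    show "card K = card {i \<in> T. \<omega> \<in> lines_hitting (curve ` boundary_arc M i) \<inter> lines_hitting \<Omega>}"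
      by (simp add: K_def)
    have "c = card (\<Union>i\<in>T. Y i)" unfolding c_def
    proof (rule card_UN_disjoint[symmetric, OF finT])
      show "\<forall>i\<in>T. finite (Y i)" using finY by blast
      show "\<forall>i\<in>T. \<forall>j\<in>T. i \<noteq> j \<longrightarrow> Y i \<inter> Y j = {}"
      proof (intro ballI impI)
        fix i j assume ij: "i \<in> T" "j \<in> T" "i \<noteq> j"
        then show "Y i \<inter> Y j = {}"
          using boundary_arc_disjoint[OF iM iM, of i j] B unfolding Y_def by blast
      qed
    qed
    also have "\<dots> \<le> card {\<alpha>, \<beta>}" using Y by (intro card_mono UN_least) simp_all
    also have "\<dots> \<le> 2" by (simp add: card_insert_if)
    finally have c2: "c \<le> 2" .
    have "c\<^sup>2 \<le> c + card K * (card K - 1) + (if \<exists>i\<in>T. 2 \<le> card (Y i) then 2 else 0)"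
      unfolding c_def
    proof (rule square_sum_le_pairs)
      show "(\<Sum>i\<in>T. card (Y i)) \<le> 2" using c2 by (simp add: c_def)
      show "{i \<in> T. 0 < card (Y i)} \<subseteq> K"
      proof clarify
        fix i assume i: "i \<in> T" "0 < card (Y i)"
        then obtain t where "t \<in> Y i" by (metis card_gt_0_iff ex_in_conv)
        then have "t \<in> boundary_arc M i" "curve t \<in> line_of \<omega>"
          using B[OF i(1)] unfolding Y_def by blast+
        then show "i \<in> K" using hit i(1) by (auto simp: K_def lines_hitting_def)
      qed
    qed (use finT in \<open>auto simp: K_def\<close>)
    moreover have "\<omega> \<in> coincident M" if "\<exists>i\<in>T. 2 \<le> card (Y i)"
    proof -
      obtain i where i: "i \<in> T" "2 \<le> card (Y i)" using \<open>\<exists>i\<in>T. 2 \<le> card (Y i)\<close> by blast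
      have "(2::ennreal) = of_nat 2" by simp
      also have "\<dots> \<le> of_nat (card (Y i))" using i(2) by (simp only: of_nat_le_iff)
      also have "\<dots> = crossing_count curve (B i) \<omega>"
        unfolding crossing_count_def Y_def[symmetric] using finY[OF i(1)] by simp
      also have "\<dots> \<le> crossing_count curve (boundary_arc M i) \<omega>"
        unfolding crossing_count_def using B[OF i(1)] by (intro emeasure_mono) auto
      finally show ?thesis using hit iM[OF i(1)] by (auto simp: coincident_def)
    qed
    ultimately show "c\<^sup>2 \<le> c + card K * (card K - 1) + (if \<omega> \<in> coincident M then 2 else 0)"
      by (auto split: if_splits)
  qed
qed

text \<open>Among all choices of \<open>m\<close> out of \<open>M\<close> arcs of equal length, the average measure of the
  lines that cross two different chosen arcs is at most \<open>(m / M)\<^sup>2\<close> times that for all arcs.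
  Some choice is no worse than the average; its arcs are then shortened to the required length.\<close>

lemma min_energy_arcs:
  assumes M: "2 \<le> M" and m: "1 \<le> m" "m \<le> M" and r: "0 \<le> r" "r \<le> real m * perimeter \<Omega> / real M"
  shows "min_energy \<Omega> (real n * perimeter \<Omega> + r)
    \<le> ennreal (2 * (real n)\<^sup>2 * perimeter \<Omega> + (4 * real n + 1) * r + (real m / real M)\<^sup>2 * perimeter \<Omega>)
      + (\<integral>\<^sup>+\<omega>. indicator (coincident M) \<omega> \<partial>line_params)"
proof -
  define P where "P = perimeter \<Omega>"
  have P: "0 < P" unfolding P_def by (rule perimeter_pos)
  define H where "H i = lines_hitting (curve ` boundary_arc M i) \<inter> lines_hitting \<Omega>" for i
  define w where "w i j = enn2real (\<integral>\<^sup>+\<omega>. indicator (H i \<inter> H j) \<omega> \<partial>line_params)" for i j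
  have W[measurable]: "lines_hitting \<Omega> \<in> sets borel" by (rule borel_lines_hitting_body)
  have Hm[measurable]: "H i \<in> sets borel" for i
    unfolding H_def boundary_arc_def
    by (intro sets.Int borel_lines_hitting sigma_compact_image continuous_curve sigma_compact_atLeastLessThan W)
  have HW: "H i \<subseteq> lines_hitting \<Omega>" for i by (simp add: H_def)
  have two: "card {i. i < M \<and> \<omega> \<in> H i} \<le> 2" for \<omega>
  proof (cases "\<omega> \<in> lines_hitting \<Omega>")
    case True
    then show ?thesis using card_arcs_crossed_le_two[of \<omega> M] by (simp add: H_def)
  qed (simp add: H_def)
  have pairs: "(\<integral>\<^sup>+\<omega>. (\<Sum>i\<in>T. \<Sum>j\<in>T - {i}. indicator (H i \<inter> H j) \<omega>) \<partial>line_params)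
      = ennreal (\<Sum>i\<in>T. \<Sum>j\<in>T - {i}. w i j)" if "T \<subseteq> {..<M}" for T
    unfolding w_def using Hm HW two that by (rule pairs_of_crossings(1))
  have total: "(\<Sum>i<M. \<Sum>j\<in>{..<M} - {i}. w i j) \<le> 4 * P"
    unfolding w_def P_def using Hm HW two by (rule pairs_of_crossings(2))
  have "m \<le> card {..<M}" using m by simp
  from exists_subset_small_pair_sum[OF finite_lessThan this, of w, unfolded card_lessThan]
  obtain T where T: "T \<subseteq> {..<M}" "card T = m"
    "(\<Sum>i\<in>T. \<Sum>j\<in>T - {i}. w i j) * (real M * (real M - 1)) \<le> real m * (real m - 1) * (\<Sum>i<M. \<Sum>j\<in>{..<M} - {i}. w i j)"
    .
  have finT: "finite T" using T(1) finite_subset by blast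
  have TM: "i < M" if "i \<in> T" for i using that T(1) by auto
  define q where "q = (\<Sum>i\<in>T. \<Sum>j\<in>T - {i}. w i j)"
  have q: "q \<le> 4 * ((real m / real M)\<^sup>2 * P)"
  proof -
    have Mm: "0 < real M" "0 < real M - 1" "0 \<le> real m - 1" "real m \<le> real M" using M m by auto
    have "q * (real M * (real M - 1)) \<le> real m * (real m - 1) * (\<Sum>i<M. \<Sum>j\<in>{..<M} - {i}. w i j)"
      using T(3) by (simp add: q_def)
    also have "\<dots> \<le> real m * (real m - 1) * (4 * P)"
      using total Mm by (intro mult_left_mono) auto
    finally have "q * (real M * (real M - 1)) * real M \<le> real m * (real m - 1) * (4 * P) * real M"
      using Mm by (intro mult_right_mono) auto
    also have "\<dots> = (real m * (4 * P)) * ((real m - 1) * real M)" by (simp add: mult_ac)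
    \<comment> \<open>This is \<open>(m - 1) / (M - 1) \<le> m / M\<close> with cleared
      denominators.\<close>
    also have "\<dots> \<le> (real m * (4 * P)) * (real m * (real M - 1))"
      using Mm P by (intro mult_left_mono) (auto simp: algebra_simps)
    finally have "(q * (real M)\<^sup>2) * (real M - 1) \<le> (4 * ((real m)\<^sup>2 * P)) * (real M - 1)"
      by (simp add: power2_eq_square mult_ac)
    then have "q * (real M)\<^sup>2 \<le> 4 * ((real m)\<^sup>2 * P)" using Mm by (simp only: mult_le_cancel_right_pos)
    then show ?thesis using Mm by (simp add: power_divide field_simps)
  qed
  \<comment> \<open>From each chosen arc the initial part of length \<open>r / m\<close> is kept, so
    that the \<open>m\<close> parts have total length \<open>r\<close>.\<close>
  have "\<exists>s. breakpoint M i \<le> s \<and> s \<le> breakpoint M (Suc i) \<and> arc_length s = arc_length (breakpoint M i) + r / real m"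
    if iM: "i < M" for i
  proof -
    have rm: "0 \<le> r / real m" "r / real m \<le> P / real M" using r m M by (auto simp: P_def field_simps)
    have "arc_length (breakpoint M (Suc i)) = arc_length (breakpoint M i) + P / real M"
      using breakpoint(2)[of M i] breakpoint(2)[of M "Suc i"] iM by (simp add: P_def field_simps)
    then have "arc_length (breakpoint M i) \<le> arc_length (breakpoint M i) + r / real m"
      "arc_length (breakpoint M i) + r / real m \<le> arc_length (breakpoint M (Suc i))" using rm by auto
    moreover have "0 \<le> breakpoint M i" "breakpoint M (Suc i) \<le> 1" "breakpoint M i \<le> breakpoint M (Suc i)"
      using breakpoint(1)[of M i] breakpoint(1)[of M "Suc i"] breakpoint_less[of i "Suc i" M] iM by auto
    ultimately show ?thesis
      using arc_length_surj[of "breakpoint M i" "breakpoint M (Suc i)" "arc_length (breakpoint M i) + r / real m"]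
      by metis
  qed
  then obtain s where s: "\<And>i. i < M \<Longrightarrow> breakpoint M i \<le> s i" "\<And>i. i < M \<Longrightarrow> s i \<le> breakpoint M (Suc i)"
      "\<And>i. i < M \<Longrightarrow> arc_length (s i) = arc_length (breakpoint M i) + r / real m" by metis
  define B where "B i = {breakpoint M i..<s i}" for i
  have Barc: "B i \<subseteq> boundary_arc M i" if "i < M" for i
    unfolding B_def boundary_arc_def using s(2)[OF that] by auto
  have B01: "B i \<subseteq> {0..<1}" if "i < M" for i using Barc boundary_arc_subset that by blast
  have Bsc: "sigma_compact (B i)" for i unfolding B_def by (rule sigma_compact_atLeastLessThan)
  have bd: "0 \<le> breakpoint M i" "s i \<le> 1" if "i < M" for i
    using s(2)[OF that] breakpoint(1)[of M i] breakpoint(1)[of M "Suc i"] that by auto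
  have BH: "hausdorff1 (curve ` B i) = ennreal (r / real m)" if "i < M" for i
    unfolding B_def using hausdorff1_arc(1)[of "breakpoint M i" "s i"] bd[OF that] s(1,3)[OF that] by simp
  have Bint: "(\<integral>\<^sup>+\<omega>. crossing_count curve (B i) \<omega> \<partial>line_params) = ennreal (4 * (r / real m))" if "i < M" for i
  proof -
    have "ennreal (4 * (r / real m)) = 4 * ennreal (r / real m)"
      by (simp only: ennreal_mult'[of 4] ennreal_numeral zero_le_numeral)
    then show ?thesis
      using crofton_arc[of "breakpoint M i" "s i"] bd[OF that] s(1)[OF that] BH[OF that]
      unfolding B_def by simp
  qed
  define xs where "xs = sorted_list_of_set T"
  have xs: "set xs = T" "distinct xs" using finT by (auto simp: xs_def)
  define \<Gamma>s where "\<Gamma>s = replicate n (frontier \<Omega>) @ map (\<lambda>i. curve ` B i) xs"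
  have adm: "admissible \<Omega> \<Gamma>s"
    unfolding admissible_def
  proof
    fix \<Gamma> assume "\<Gamma> \<in> set \<Gamma>s"
    then consider "\<Gamma> = frontier \<Omega>" | i where "i \<in> T" "\<Gamma> = curve ` B i"
      using xs(1) by (auto simp: \<Gamma>s_def)
    then show "\<Gamma> \<subseteq> closure \<Omega> \<and> one_rectifiable \<Gamma> \<and> hausdorff1 \<Gamma> < \<infinity>"
    proof cases
      case 1
      then show ?thesis using one_rectifiable_frontier hausdorff1_frontier by (simp add: frontier_def)
    next
      case 2
      have "curve ` B i \<subseteq> closure \<Omega>" using curve_in_frontier by (auto simp: frontier_def)
      then show ?thesis using 2 one_rectifiable_curve[OF Bsc] BH[OF TM] by simp
    qed
  qed
  have "total_length \<Gamma>s = of_nat n * ennreal P + (\<Sum>i\<in>T. hausdorff1 (curve ` B i))"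
    using sum_list_distinct_conv_sum_set[OF xs(2), of "\<lambda>i. hausdorff1 (curve ` B i)"] xs(1)
    by (simp add: total_length_def \<Gamma>s_def sum_list_replicate map_replicate_const hausdorff1_frontier P_def comp_def)
  also have "(\<Sum>i\<in>T. hausdorff1 (curve ` B i)) = (\<Sum>i\<in>T. ennreal (r / real m))"
    using BH TM by (intro sum.cong) auto
  also have "\<dots> = ennreal r"
    using r(1) m T(2) by (simp add: ennreal_of_nat_eq_real_of_nat ennreal_mult[symmetric])
  finally have len: "total_length \<Gamma>s = ennreal (real n * P + r)"
    using r(1) P by (simp add: ennreal_of_nat_eq_real_of_nat ennreal_mult)
  define N where "N \<omega> = (\<Sum>i\<in>T. crossing_count curve (B i) \<omega>)" for \<omega>
  have cr: "crossings (line_of \<omega>) \<Gamma>s = of_nat n * emeasure (count_space UNIV) (line_of \<omega> \<inter> frontier \<Omega>) + N \<omega>" for \<omega>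
  proof -
    have "crossings (line_of \<omega>) \<Gamma>s = of_nat n * emeasure (count_space UNIV) (line_of \<omega> \<inter> frontier \<Omega>)
        + (\<Sum>i\<in>T. emeasure (count_space UNIV) (line_of \<omega> \<inter> curve ` B i))"
      using sum_list_distinct_conv_sum_set[OF xs(2), of "\<lambda>i. emeasure (count_space UNIV) (line_of \<omega> \<inter> curve ` B i)"] xs(1)
      by (simp add: crossings_def \<Gamma>s_def sum_list_replicate map_replicate_const comp_def)
    also have "(\<Sum>i\<in>T. emeasure (count_space UNIV) (line_of \<omega> \<inter> curve ` B i)) = N \<omega>"
      unfolding N_def using TM B01 by (intro sum.cong refl crossing_count_curve[symmetric]) auto
    finally show ?thesis .
  qed
  have Bm: "crossing_count curve (B i) \<in> borel_measurable borel" if "i \<in> T" for i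
    using Bsc B01[OF TM[OF that]] by (rule borel_crossing_count_curve)
  then have Nm[measurable]: "N \<in> borel_measurable borel" unfolding N_def by (intro borel_measurable_sum)
  have Nint: "(\<integral>\<^sup>+\<omega>. N \<omega> \<partial>line_params) = ennreal (4 * r)"
  proof -
    have "(\<integral>\<^sup>+\<omega>. N \<omega> \<partial>line_params) = (\<Sum>i\<in>T. \<integral>\<^sup>+\<omega>. crossing_count curve (B i) \<omega> \<partial>line_params)"
      unfolding N_def using Bm by (intro nn_integral_sum borel_measurable_line_params)
    also have "\<dots> = (\<Sum>i\<in>T. ennreal (4 * (r / real m)))" using TM Bint by (intro sum.cong) auto
    also have "\<dots> = ennreal (4 * r)"
      using r(1) m T(2) by (simp add: ennreal_of_nat_eq_real_of_nat ennreal_mult[symmetric])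
    finally show ?thesis .
  qed
  define R where "R \<omega> = (\<Sum>i\<in>T. \<Sum>j\<in>T - {i}. indicator (H i \<inter> H j) \<omega> :: ennreal)" for \<omega>
  have Rm[measurable]: "R \<in> borel_measurable borel" unfolding R_def by measurable
  have Cm[measurable]: "coincident M \<in> sets borel" by (rule borel_coincident)
  note [measurable] = borel_measurable_crossings_frontier
  have "(\<integral>\<^sup>+l. (crossings l \<Gamma>s)\<^sup>2 \<partial>kinematic_measure) = (\<integral>\<^sup>+\<omega>. (crossings (line_of \<omega>) \<Gamma>s)\<^sup>2 \<partial>line_params)"
    by (rule nn_integral_kinematic, rule borel_measurable_line_params, unfold cr, measurable)
  also have "\<dots> \<le> (\<integral>\<^sup>+\<omega>. ennreal (4 * (real n)\<^sup>2) * indicator (lines_hitting \<Omega>) \<omega>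
      + (ennreal (4 * real n + 1) * N \<omega> + (R \<omega> + 2 * indicator (coincident M) \<omega>)) \<partial>line_params)"
  proof (rule nn_integral_mono_AE)
    show "AE \<omega> in line_params. (crossings (line_of \<omega>) \<Gamma>s)\<^sup>2 \<le> ennreal (4 * (real n)\<^sup>2) * indicator (lines_hitting \<Omega>) \<omega>
      + (ennreal (4 * real n + 1) * N \<omega> + (R \<omega> + 2 * indicator (coincident M) \<omega>))"
      using AE_lines_hitting_closure AE_crossing_count_frontier
    proof eventually_elim
      case (elim \<omega>)
      show ?case
      proof (cases "\<omega> \<in> lines_hitting \<Omega>")
        case False
        then have "line_of \<omega> \<inter> closure \<Omega> = {}" using elim(1) by (auto simp: lines_hitting_def)
        then have "{t \<in> B i. curve t \<in> line_of \<omega>} = {}" for i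
          using curve_in_frontier by (auto simp: frontier_def)
        then have "N \<omega> = 0" unfolding N_def crossing_count_def by (simp only: emeasure_empty sum.neutral_const)
        then have "crossings (line_of \<omega>) \<Gamma>s = 0" unfolding cr elim(2) using False by simp
        then show ?thesis by simp
      next
        case True
        obtain c k where ck: "(\<Sum>i\<in>T. crossing_count curve (B i) \<omega>) = of_nat c"
          "k = card {i \<in> T. \<omega> \<in> lines_hitting (curve ` boundary_arc M i) \<inter> lines_hitting \<Omega>}"
          "c\<^sup>2 \<le> c + k * (k - 1) + (if \<omega> \<in> coincident M then 2 else 0)"
          using square_crossings_le[OF True T(1), of B] Barc TM by blast
        have Nc: "N \<omega> = of_nat c" unfolding N_def by (rule ck(1))
        \<comment> \<open>In the square of \<open>2 * n + c\<close>, the cross term and the linear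
          part of the bound for the square of \<open>c\<close> combine to
          \<open>(4 * n + 1) * c\<close>, whose integral Crofton's formula gives exactly. Only
          \<open>k * (k - 1)\<close> and the error \<open>d\<close> depend on how the arcs
          lie.\<close>
        define d :: nat where "d = (if \<omega> \<in> coincident M then 1 else 0)"
        have R: "R \<omega> = of_nat (k * (k - 1))"
          unfolding R_def pair_sum_indicator[OF finT] ck(2) H_def ..
        have "c\<^sup>2 \<le> c + k * (k - 1) + 2 * d" using ck(3) by (auto simp: d_def)
        moreover have "(n * 2 + c)\<^sup>2 = 4 * n\<^sup>2 + 4 * n * c + c\<^sup>2"
          by (simp add: power2_eq_square algebra_simps)
        ultimately have "(n * 2 + c)\<^sup>2 \<le> 4 * n\<^sup>2 + ((4 * n + 1) * c + (k * (k - 1) + 2 * d))"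
          by (simp add: distrib_right)
        then have "(of_nat ((n * 2 + c)\<^sup>2) :: ennreal) \<le> of_nat (4 * n\<^sup>2 + ((4 * n + 1) * c + (k * (k - 1) + 2 * d)))"
          by (simp only: of_nat_le_iff)
        also have "\<dots> = of_nat (4 * n\<^sup>2) + (of_nat (4 * n + 1) * of_nat c + (of_nat (k * (k - 1)) + of_nat (2 * d)))"
          by (simp only: of_nat_add of_nat_mult)
        also have "(of_nat (4 * n\<^sup>2) :: ennreal) = ennreal (4 * (real n)\<^sup>2)"
          unfolding ennreal_of_nat_eq_real_of_nat by simp
        also have "(of_nat (4 * n + 1) :: ennreal) = ennreal (4 * real n + 1)"
          unfolding ennreal_of_nat_eq_real_of_nat by (simp add: add.commute del: ennreal_plus)
        also have "(of_nat (2 * d) :: ennreal) = 2 * indicator (coincident M) \<omega>"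
          by (simp add: d_def)
        also have "(of_nat ((n * 2 + c)\<^sup>2) :: ennreal) = (crossings (line_of \<omega>) \<Gamma>s)\<^sup>2"
          unfolding cr elim(2) Nc using True by simp
        finally show ?thesis unfolding Nc R using True by simp
      qed
    qed
  qed
  also have "\<dots> = ennreal (4 * (real n)\<^sup>2) * (\<integral>\<^sup>+\<omega>. indicator (lines_hitting \<Omega>) \<omega> \<partial>line_params)
      + (ennreal (4 * real n + 1) * (\<integral>\<^sup>+\<omega>. N \<omega> \<partial>line_params)
      + ((\<integral>\<^sup>+\<omega>. R \<omega> \<partial>line_params) + 2 * (\<integral>\<^sup>+\<omega>. indicator (coincident M) \<omega> \<partial>line_params)))"
  proof -
    have m1: "(\<lambda>\<omega>. indicator (lines_hitting \<Omega>) \<omega> :: ennreal) \<in> borel_measurable line_params"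
      by (rule borel_measurable_line_params) measurable
    have m2: "N \<in> borel_measurable line_params" by (rule borel_measurable_line_params[OF Nm])
    have m3: "R \<in> borel_measurable line_params" by (rule borel_measurable_line_params[OF Rm])
    have m4: "(\<lambda>\<omega>. indicator (coincident M) \<omega> :: ennreal) \<in> borel_measurable line_params"
      by (rule borel_measurable_line_params) measurable
    have linear: "(\<integral>\<^sup>+\<omega>. a * f \<omega> + (b * g \<omega> + (h \<omega> + c * k \<omega>)) \<partial>\<mu>) =
        a * (\<integral>\<^sup>+\<omega>. f \<omega> \<partial>\<mu>) + (b * (\<integral>\<^sup>+\<omega>. g \<omega> \<partial>\<mu>) + ((\<integral>\<^sup>+\<omega>. h \<omega> \<partial>\<mu>) + c * (\<integral>\<^sup>+\<omega>. k \<omega> \<partial>\<mu>)))"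
      if "f \<in> borel_measurable \<mu>" "g \<in> borel_measurable \<mu>" "h \<in> borel_measurable \<mu>" "k \<in> borel_measurable \<mu>"
      for \<mu> :: "(real \<times> real) measure" and f g h k and a b c :: ennreal
      using that by (simp add: nn_integral_add nn_integral_cmult)
    show ?thesis by (rule linear[OF m1 m2 m3 m4])
  qed
  also have "(\<integral>\<^sup>+\<omega>. R \<omega> \<partial>line_params) = ennreal q"
    unfolding R_def q_def by (rule pairs[OF T(1)])
  finally have "(\<integral>\<^sup>+l. (crossings l \<Gamma>s)\<^sup>2 \<partial>kinematic_measure) \<le>
     ennreal (4 * (real n)\<^sup>2) * ennreal (2 * P) + (ennreal (4 * real n + 1) * ennreal (4 * r) + (ennreal q
      + 2 * (\<integral>\<^sup>+\<omega>. indicator (coincident M) \<omega> \<partial>line_params)))"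
    unfolding Nint measure_lines_hitting_body P_def .
  \<comment> \<open>The coefficient 2 of the error term is enlarged to 4, so that a common factor 4
    cancels the division in the energy.\<close>
  also have "\<dots> \<le> ennreal (4 * (real n)\<^sup>2) * ennreal (2 * P) + (ennreal (4 * real n + 1) * ennreal (4 * r)
      + (ennreal (4 * ((real m / real M)\<^sup>2 * P)) + 4 * (\<integral>\<^sup>+\<omega>. indicator (coincident M) \<omega> \<partial>line_params)))"
    using q by (intro add_left_mono add_mono ennreal_leI mult_right_mono) auto
  also have "\<dots> = 4 * (ennreal (2 * (real n)\<^sup>2 * P + (4 * real n + 1) * r + (real m / real M)\<^sup>2 * P)
      + (\<integral>\<^sup>+\<omega>. indicator (coincident M) \<omega> \<partial>line_params))" (is "_ = 4 * ?X")
  proof -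
    have e1: "ennreal (4 * (real n)\<^sup>2) * ennreal (2 * P) = 4 * ennreal (2 * (real n)\<^sup>2 * P)"
    proof -
      have "ennreal (4 * (real n)\<^sup>2) * ennreal (2 * P) = ennreal (4 * (2 * (real n)\<^sup>2 * P))"
        using P by (subst ennreal_mult[symmetric]) (auto simp: mult_ac)
      then show ?thesis by (simp only: ennreal_mult'[of 4] ennreal_numeral zero_le_numeral)
    qed
    have e2: "ennreal (4 * real n + 1) * ennreal (4 * r) = 4 * ennreal ((4 * real n + 1) * r)"
    proof -
      have "ennreal (4 * real n + 1) * ennreal (4 * r) = ennreal (4 * ((4 * real n + 1) * r))"
        using r(1) by (subst ennreal_mult[symmetric]) (auto simp: mult_ac)
      then show ?thesis by (simp only: ennreal_mult'[of 4] ennreal_numeral zero_le_numeral)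
    qed
    have e3: "ennreal (4 * ((real m / real M)\<^sup>2 * P)) = 4 * ennreal ((real m / real M)\<^sup>2 * P)"
      by (simp only: ennreal_mult'[of 4] ennreal_numeral zero_le_numeral)
    have e4: "ennreal (2 * (real n)\<^sup>2 * P + (4 * real n + 1) * r + (real m / real M)\<^sup>2 * P)
      = ennreal (2 * (real n)\<^sup>2 * P) + ennreal ((4 * real n + 1) * r) + ennreal ((real m / real M)\<^sup>2 * P)"
    proof -
      have "0 \<le> 2 * (real n)\<^sup>2 * P" "0 \<le> (4 * real n + 1) * r" "0 \<le> (real m / real M)\<^sup>2 * P"
        using P r(1) by auto
      then show ?thesis by (simp only: ennreal_plus add_nonneg_nonneg)
    qed
    show ?thesis unfolding e1 e2 e3 e4 by (simp only: distrib_left add.assoc)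
  qed
  finally have "energy \<Gamma>s \<le> ?X"
    unfolding energy_def by (intro divide_le_posI_ennreal) auto
  moreover have "min_energy \<Omega> (real n * P + r) \<le> energy \<Gamma>s"
    unfolding min_energy_def using adm len by (intro INF_lower) simp
  ultimately show ?thesis unfolding P_def by (rule order_trans[rotated])
qed

lemma min_energy_upper_bound:
  assumes L: "0 \<le> L"
  shows "min_energy \<Omega> L \<le> ennreal (2 * L\<^sup>2 / perimeter \<Omega> + perimeter \<Omega> / 4)"
proof -
  define P where "P = perimeter \<Omega>"
  have P: "0 < P" unfolding P_def by (rule perimeter_pos)
  define n where "n = nat \<lfloor>L / P\<rfloor>"
  define r where "r = L - real n * P"
  have "0 \<le> L / P" using L P by simp
  then have "real n \<le> L / P" "L / P < real n + 1" unfolding n_def by linarith+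
  then have r: "0 \<le> r" "r < P" using P by (auto simp: r_def field_simps)
  \<comment> \<open>The fraction \<open>m / M\<close> of chosen arcs differs from
    \<open>r / P\<close> by rounding only, which costs at most \<open>1 / M\<close> and disappears
    in the limit.\<close>
  define b where "b M = 2 * (real n)\<^sup>2 * P + (4 * real n + 1) * r + (r / P + 1 / real M)\<^sup>2 * P" for M
  have le: "min_energy \<Omega> L \<le> ennreal (b M) + (\<integral>\<^sup>+\<omega>. indicator (coincident M) \<omega> \<partial>line_params)" if M: "2 \<le> M" for M
  proof -
    \<comment> \<open>One more than the floor, so that \<open>m\<close> arcs of length
      \<open>P / M\<close> have room for the length \<open>r\<close> and \<open>m\<close> is at
      least 1; \<open>r < P\<close> keeps \<open>m\<close> within \<open>M\<close>.\<close>
    define m where "m = nat \<lfloor>r * real M / P\<rfloor> + 1"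
    have x: "0 \<le> r * real M / P" "r * real M / P < real M" using r P M by (auto simp: field_simps)
    then have "nat \<lfloor>r * real M / P\<rfloor> < M" by (simp add: nat_less_iff floor_less_iff)
    then have m1: "1 \<le> m" "m \<le> M" by (auto simp: m_def)
    have m2: "r * real M / P \<le> real m" "real m \<le> r * real M / P + 1" using x unfolding m_def by linarith+
    have "r \<le> real m * P / real M" using m2(1) M P by (simp add: field_simps)
    then have "min_energy \<Omega> (real n * P + r)
        \<le> ennreal (2 * (real n)\<^sup>2 * P + (4 * real n + 1) * r + (real m / real M)\<^sup>2 * P)
          + (\<integral>\<^sup>+\<omega>. indicator (coincident M) \<omega> \<partial>line_params)"
      unfolding P_def using M m1 r(1) by (intro min_energy_arcs) auto
    also have "real n * P + r = L" by (simp add: r_def)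
    also have "ennreal (2 * (real n)\<^sup>2 * P + (4 * real n + 1) * r + (real m / real M)\<^sup>2 * P) \<le> ennreal (b M)"
    proof -
      have "real m / real M \<le> r / P + 1 / real M" using m2(2) M P by (simp add: field_simps)
      then have "(real m / real M)\<^sup>2 \<le> (r / P + 1 / real M)\<^sup>2" by (intro power_mono) auto
      then show ?thesis unfolding b_def using P by (intro ennreal_leI add_left_mono mult_right_mono) auto
    qed
    finally show ?thesis by (simp add: add_right_mono)
  qed
  have "b \<longlonglongrightarrow> 2 * (real n)\<^sup>2 * P + (4 * real n + 1) * r + (r / P + 0)\<^sup>2 * P"
    unfolding b_def by (intro tendsto_intros lim_const_over_n)
  then have "(\<lambda>M. ennreal (b M) + (\<integral>\<^sup>+\<omega>. indicator (coincident M) \<omega> \<partial>line_params))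
      \<longlonglongrightarrow> ennreal (2 * (real n)\<^sup>2 * P + (4 * real n + 1) * r + (r / P + 0)\<^sup>2 * P) + 0"
    by (intro tendsto_add tendsto_ennrealI coincident_tendsto_0)
  then have "min_energy \<Omega> L \<le> ennreal (2 * (real n)\<^sup>2 * P + (4 * real n + 1) * r + (r / P + 0)\<^sup>2 * P) + 0"
    by (rule LIMSEQ_le_const) (use le in blast)
  also have "\<dots> \<le> ennreal (2 * L\<^sup>2 / P + P / 4)"
    unfolding add_0_right
  proof (rule ennreal_leI)
    \<comment> \<open>The limit falls short of the claimed bound by exactly this square, which is
      the inequality \<open>y * (1 - y) \<le> 1 / 4\<close> for \<open>y = r / P\<close>, multiplied
      by \<open>P\<close>.\<close>
    have "0 \<le> (r - P / 2)\<^sup>2 / P" using P by simp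
    also have "\<dots> = 2 * L\<^sup>2 / P + P / 4 - (2 * (real n)\<^sup>2 * P + (4 * real n + 1) * r + (r / P)\<^sup>2 * P)"
      using P by (simp add: r_def field_simps power2_eq_square)
    finally show "2 * (real n)\<^sup>2 * P + (4 * real n + 1) * r + (r / P)\<^sup>2 * P \<le> 2 * L\<^sup>2 / P + P / 4" by simp
  qed
  finally show ?thesis by (simp add: P_def)
qed

lemma excess_upper_bound:
  assumes "0 \<le> L"
  shows "excess \<Omega> L \<le> ereal (perimeter \<Omega> / 4)"
proof -
  obtain e where e: "min_energy \<Omega> L = ennreal e" "0 \<le> e"
    using min_energy_upper_bound[OF assms] by (cases "min_energy \<Omega> L") (auto simp: top_unique)
  have "ennreal e \<le> ennreal (2 * L\<^sup>2 / perimeter \<Omega> + perimeter \<Omega> / 4)"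
    using min_energy_upper_bound[OF assms] unfolding e(1) .
  then have "e \<le> 2 * L\<^sup>2 / perimeter \<Omega> + perimeter \<Omega> / 4"
    using perimeter_pos by (subst (asm) ennreal_le_iff) auto
  then show ?thesis using e by (simp add: excess_def enn2ereal_ennreal)
qed

end

theorem mainTheorem3:
  fixes \<Omega> :: "(real^2) set" and L :: real
  assumes "open \<Omega>" and "\<Omega> \<noteq> {}" and "bounded \<Omega>" and "convex \<Omega>" and "C1_boundary \<Omega>"
    and "L \<ge> 0"
  shows
    "ereal (perimeter \<Omega> / 2 * frac (2 * L / perimeter \<Omega>) * (1 - frac (2 * L / perimeter \<Omega>)))
        \<le> excess \<Omega> L
     \<and> excess \<Omega> L \<le> ereal (perimeter \<Omega> / 4)
     \<and> (\<forall>n::nat. n * perimeter \<Omega> \<le> L \<and> L \<le> n * perimeter \<Omega> + diameter \<Omega> \<longrightarrow>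
          excess \<Omega> L =
            ereal (perimeter \<Omega> / 2 * frac (2 * L / perimeter \<Omega>) * (1 - frac (2 * L / perimeter \<Omega>)))
          \<and> (\<exists>a b. closed_segment a b \<subseteq> closure \<Omega> \<and> dist a b = L - n * perimeter \<Omega>)
          \<and> (\<forall>a b. closed_segment a b \<subseteq> closure \<Omega> \<and> dist a b = L - n * perimeter \<Omega> \<longrightarrow>
               extremal \<Omega> L (replicate n (frontier \<Omega>) @ [closed_segment a b])))"
proof -
  interpret planar_convex_body \<Omega> by standard (use assms in auto)
  note L = \<open>L \<ge> 0\<close>
  show ?thesis
  proof (intro conjI allI impI)
    fix n :: nat assume n: "n * perimeter \<Omega> \<le> L \<and> L \<le> n * perimeter \<Omega> + diameter \<Omega>"
    then obtain a b where ab: "closed_segment a b \<subseteq> closure \<Omega>" "dist a b = L - n * perimeter \<Omega>"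
      using exists_segment[of "L - n * perimeter \<Omega>"] by auto
    then show "\<exists>a b. closed_segment a b \<subseteq> closure \<Omega> \<and> dist a b = L - n * perimeter \<Omega>" by blast
    show "excess \<Omega> L = ereal (perimeter \<Omega> / 2 * frac (2 * L / perimeter \<Omega>) * (1 - frac (2 * L / perimeter \<Omega>)))"
      by (rule sharp_case(2)[OF L ab])
  next
    fix n a b assume "closed_segment a b \<subseteq> closure \<Omega> \<and> dist a b = L - real n * perimeter \<Omega>"
    then show "extremal \<Omega> L (replicate n (frontier \<Omega>) @ [closed_segment a b])"
      using sharp_case(1)[OF L] by blast
  qed (use excess_lower_bound[OF L] excess_upper_bound[OF L] in auto)
qed

end
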